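(* Let $(\lambda_N)_{N}$ be a sequence of non-trivial conjugacy classes $\lambda_N\subset\mathfrak{S}(N)$ which converges, with limiting data $(\lambda(i))_{i\ge 2}$ and $\alpha\in[0,1]$, and for each $N$ let $(S^N_t)_{t\ge 0}$ be a $\lambda_N$-random walk on $\mathfrak{S}(N)$. (i) For any $t\ge 0$, the mean eigenvalue distributions of $S^N_t$ converge as $N\to\infty$ to a probability measure $\overline{\mu}^{\lambda}_t$ on the unit circle $\mathbb{U}$ of the form $$\overline{\mu}_{t}^{\lambda} = \sum_{n \ge 1} \sum_{k=0}^{n-1} \frac{m_{n^c}(t)}{n}\,\delta_{e^{2ik\pi/n}} + m_{\infty^{c}}(t)\, \lambda_{\mathbb{U}},$$ where $m_{n^c}(t)\ge 0$ for every $n\ge 1$, $m_{\infty^c}(t)=1-\sum_{n\ge 1} m_{n^c}(t)\ge 0$, and $\lambda_{\mathbb{U}}$ is the uniform probability measure on $\mathbb{U}$. (ii) Let $\big((m_{\sigma^c}(t))_{\sigma\in\cup_{k\ge1}\mathfrak{S}_k}\big)_{t\ge 0}$ be the unique solution of the system: for all $k\ge 1$, $\sigma_0\in\mathfrak{S}_k$, $t_0\ge 0$, $$\frac{d}{dt}\Big|_{t=t_0} m_{\sigma_0^c}(t)=\frac{(1-\alpha)^k-1}{\alpha}\,m_{\sigma_0^c}(t_0)+\sum_{\sigma\in\mathfrak{S}_k\setminus\{id\},\ \sigma\le\sigma_0}\alpha^{{\sf nc}(\sigma\vee id)-[\sigma](1)-1}\Big(\prod_{i=2}^k\lambda(i)^{[\sigma](i)/i}\Big)(1-\alpha)^{[\sigma](1)}\,m_{(\sigma^{-1}\sigma_0)^c}(t_0),$$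 with initial conditions $m_{\sigma^c}(0)=\delta_{\sigma=id}$ for all $k\geq 1$ and $\sigma\in\mathfrak{S}_k$. (By convention $\frac{(1-0)^k-1}{0}=-k$ and $0^0=1$.) Then for every $n\ge1$ and $t\ge 0$, $m_{n^c}(t)=m_{(1,\dots,n)^c}(t)$, where $(1,\dots,n)\in\mathfrak{S}_n$ is an $n$-cycle. Moreover, for every $k\ge1$, $\sigma\in\mathfrak{S}_k$, $t\ge0$, $$m_{\sigma^c}(t)=\lim_{N\to\infty}\mathbb{E}\,m_{\sigma^c}\big[S^N_t\big].$$
   Context: Random walks. $\mathfrak{S}(N)$ is the symmetric group; permutations $S$ are identified with $N\times N$ permutation matrices ($S e_j=e_{S(j)}$). For a permutation $\sigma$, the period of $j$ in $\sigma$ is the smallest $n\ge1$ with $\sigma^n(j)=j$. For a conjugacy class $\lambda_N$ of $\mathfrak{S}(N)$, $\lambda_N(i)$ is the number of $j\in\{1,\dots,N\}$ whose period in $\sigma$ equals $i$ (any $\sigma\in\lambda_N$), and $\lambda_N(1^c)=N-\lambda_N(1)$. Classes are assumed non-trivial: $\lambda_N\neq\{id_N\}$ ($N\ge2$). The $\lambda_N$-random walk $(S^N_t)_{t\ge0}$ is the Markov process on $\mathfrak{S}(N)$ with $S^N_0=id_N$ and generator $$H_Nf(\sigma_0)=\frac{N}{\lambda_N(1^c)}\frac{1}{\#\lambda_N}\sum_{\sigma\in\lambda_N}[f(\sigma\sigma_0)-f(\sigma_0)].$$ The sequence $(\lambda_N)_N$ converges if there are $\lambda(i)\ge0$ ($i\ge2$)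 with $\sum_{i\ge2}\lambda(i)\le1$ and $\lambda_N(i)/\lambda_N(1^c)\to\lambda(i)$ for every $i\ge2$, and there is $\alpha\in[0,1]$ with $\lambda_N(1)/N\to1-\alpha$. The mean eigenvalue distribution of a random matrix is the expectation of its (normalized) empirical eigenvalue distribution. Exclusive moments. For $\sigma\in\mathfrak{S}_k$, $[\sigma](i)$ is the number of elements of $\{1,\dots,k\}$ of period $i$ in $\sigma$, and ${\sf nc}(\sigma\vee id)$ is the number of cycles of $\sigma$ (including fixed points). For a permutation matrix $S\in \mathfrak{S}(N)$, $$m_{\sigma^c}(S)=\frac{1}{N^{{\sf nc}(\sigma\vee id)}}\#\{(i_1,\dots,i_k)\in\{1,\dots,N\}^k \text{ pairwise distinct}:\ S(i_{\sigma(l)})=i_l\ \forall l\},$$ and $\mathbb{E}m_{\sigma^c}[S]$ is its expectation if $S$ is random. Order. For $\sigma,\sigma_0\in\mathfrak{S}_k$, let $d(\sigma,\sigma_0)=k-\#\{\text{cycles of }\sigma^{-1}\sigma_0\}$; $\sigma\le\sigma_0$ means $d(id,\sigma)+d(\sigma,\sigma_0)=d(id,\sigma_0)$. *)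

theory Defs
  imports
    "HOL-Probability.Probability"
    "HOL-Combinatorics.Combinatorics"
    "Jordan_Normal_Form.Char_Poly"
begin

section \<open>Permutations and conjugacy classes\<close>

text \<open>The symmetric group on \<open>k\<close> letters is the set of all \<open>p\<close> with \<open>p permutes {1..k}\<close>, with the
  product \<open>p \<circ> q\<close>. Such a \<open>p\<close> is also a permutation of \<open>{1..k + 1}\<close>, so everything that depends on
  \<open>k\<close> takes \<open>k\<close> as an explicit argument. The period of \<open>j\<close> in \<open>p\<close> is \<open>least_power p j\<close>.\<close>

definition period_count :: "nat \<Rightarrow> (nat \<Rightarrow> nat) \<Rightarrow> nat \<Rightarrow> nat" where
  "period_count k p i = card {j \<in> {1..k}. least_power p j = i}"

definition num_cycles :: "nat \<Rightarrow> (nat \<Rightarrow> nat) \<Rightarrow> nat" where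
  "num_cycles k p = card (orbit p ` {1..k})"

definition perm_dist :: "nat \<Rightarrow> (nat \<Rightarrow> nat) \<Rightarrow> (nat \<Rightarrow> nat) \<Rightarrow> nat" where
  "perm_dist k p q = k - num_cycles k (inv_into UNIV p \<circ> q)"

definition perm_le :: "nat \<Rightarrow> (nat \<Rightarrow> nat) \<Rightarrow> (nat \<Rightarrow> nat) \<Rightarrow> bool" where
  "perm_le k p q \<longleftrightarrow> perm_dist k id p + perm_dist k p q = perm_dist k id q"

definition is_conjugacy_class :: "nat \<Rightarrow> (nat \<Rightarrow> nat) set \<Rightarrow> bool" where
  "is_conjugacy_class N C \<longleftrightarrow>
     (\<exists>p. p permutes {1..N} \<and> C = {q \<circ> p \<circ> inv_into UNIV q | q. q permutes {1..N}})"

text \<open>All elements of a conjugacy class have the same period counts.\<close>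

definition class_count :: "nat \<Rightarrow> (nat \<Rightarrow> nat) set \<Rightarrow> nat \<Rightarrow> nat" where
  "class_count N C i = period_count N (SOME p. p \<in> C) i"

definition class_moved :: "nat \<Rightarrow> (nat \<Rightarrow> nat) set \<Rightarrow> nat" where
  "class_moved N C = N - class_count N C 1"

definition classes_converge ::
    "(nat \<Rightarrow> (nat \<Rightarrow> nat) set) \<Rightarrow> (nat \<Rightarrow> real) \<Rightarrow> real \<Rightarrow> bool" where
  "classes_converge C lam \<alpha> \<longleftrightarrow>
     (\<forall>i\<ge>2. 0 \<le> lam i) \<and>
     summable (\<lambda>i. lam (i + 2)) \<and> (\<Sum>i. lam (i + 2)) \<le> 1 \<and>
     (\<forall>i\<ge>2. (\<lambda>N. real (class_count N (C N) i) / real (class_moved N (C N))) \<longlonglongrightarrow> lam i) \<and>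
     0 \<le> \<alpha> \<and> \<alpha> \<le> 1 \<and>
     (\<lambda>N. real (class_count N (C N) 1) / real N) \<longlonglongrightarrow> 1 - \<alpha>"

section \<open>Markov processes on a finite state space and the random walk\<close>

definition markov_semigroup :: "'s set \<Rightarrow> (real \<Rightarrow> 's \<Rightarrow> 's pmf) \<Rightarrow> bool" where
  "markov_semigroup E P \<longleftrightarrow>
     (\<forall>t\<ge>0. \<forall>x\<in>E. set_pmf (P t x) \<subseteq> E) \<and>
     (\<forall>x\<in>E. P 0 x = return_pmf x) \<and>
     (\<forall>s\<ge>0. \<forall>t\<ge>0. \<forall>x\<in>E. P (s + t) x = bind_pmf (P s x) (P t))"

definition has_generator ::
    "'s set \<Rightarrow> (real \<Rightarrow> 's \<Rightarrow> 's pmf) \<Rightarrow> (('s \<Rightarrow> real) \<Rightarrow> 's \<Rightarrow> real) \<Rightarrow> bool" where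
  "has_generator E P H \<longleftrightarrow>
     (\<forall>f. \<forall>x\<in>E. ((\<lambda>t. (measure_pmf.expectation (P t x) f - f x) / t) \<longlongrightarrow> H f x) (at_right 0))"

definition natural_filtration ::
    "'a measure \<Rightarrow> 's set \<Rightarrow> (real \<Rightarrow> 'a \<Rightarrow> 's) \<Rightarrow> real \<Rightarrow> 'a measure" where
  "natural_filtration M E X s =
     sigma (space M) {X u -` A \<inter> space M | u A. 0 \<le> u \<and> u \<le> s \<and> A \<subseteq> E}"

definition markov_process ::
    "'a measure \<Rightarrow> 's set \<Rightarrow> (real \<Rightarrow> 'a \<Rightarrow> 's) \<Rightarrow> (('s \<Rightarrow> real) \<Rightarrow> 's \<Rightarrow> real) \<Rightarrow> bool" where
  "markov_process M E X H \<longleftrightarrow>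
     prob_space M \<and>
     (\<forall>t\<ge>0. X t \<in> measurable M (count_space E)) \<and>
     (\<exists>P. markov_semigroup E P \<and> has_generator E P H \<and>
        (\<forall>s\<ge>0. \<forall>t\<ge>0. \<forall>f :: 's \<Rightarrow> real. AE \<omega> in M.
           real_cond_exp M (natural_filtration M E X s) (\<lambda>\<omega>'. f (X (s + t) \<omega>')) \<omega>
             = measure_pmf.expectation (P t (X s \<omega>)) f))"

definition walk_generator ::
    "nat \<Rightarrow> (nat \<Rightarrow> nat) set \<Rightarrow> ((nat \<Rightarrow> nat) \<Rightarrow> real) \<Rightarrow> (nat \<Rightarrow> nat) \<Rightarrow> real" where
  "walk_generator N C f p0 =
     real N / real (class_moved N C) * (1 / real (card C)) * (\<Sum>p\<in>C. f (p \<circ> p0) - f p0)"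

definition random_walk ::
    "nat \<Rightarrow> (nat \<Rightarrow> nat) set \<Rightarrow> 'a measure \<Rightarrow> (real \<Rightarrow> 'a \<Rightarrow> nat \<Rightarrow> nat) \<Rightarrow> bool" where
  "random_walk N C M S \<longleftrightarrow>
     markov_process M {p. p permutes {1..N}} S (walk_generator N C) \<and>
     (AE \<omega> in M. S 0 \<omega> = id)"

section \<open>Eigenvalue distributions\<close>

text \<open>Matrix indices start at 0, hence the shifts by one.\<close>

definition perm_matrix :: "nat \<Rightarrow> (nat \<Rightarrow> nat) \<Rightarrow> complex mat" where
  "perm_matrix N p = mat N N (\<lambda>(i, j). if p (Suc j) = Suc i then 1 else 0)"

text \<open>\<open>proots (char_poly A)\<close> is the multiset of eigenvalues of \<open>A\<close>, counted with algebraic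
  multiplicity.\<close>

definition eigenvalue_distribution :: "complex mat \<Rightarrow> complex pmf" where
  "eigenvalue_distribution A = pmf_of_multiset (proots (char_poly A))"

definition mean_eigenvalue_distribution ::
    "'a measure \<Rightarrow> ('a \<Rightarrow> complex mat) \<Rightarrow> complex measure" where
  "mean_eigenvalue_distribution M A =
     measure_of UNIV (sets borel)
       (\<lambda>B. \<integral>\<^sup>+ \<omega>. emeasure (measure_pmf (eigenvalue_distribution (A \<omega>))) B \<partial>M)"

definition weakly_converges ::
    "(nat \<Rightarrow> 'b::topological_space measure) \<Rightarrow> 'b measure \<Rightarrow> bool" where
  "weakly_converges \<mu>s \<mu> \<longleftrightarrow>
     (\<forall>f :: 'b \<Rightarrow> real. continuous_on UNIV f \<and> bounded (range f) \<longrightarrow>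
        (\<lambda>N. integral\<^sup>L (\<mu>s N) f) \<longlonglongrightarrow> integral\<^sup>L \<mu> f)"

definition uniform_circle :: "complex measure" where
  "uniform_circle = distr (uniform_measure lborel {0..2 * pi}) borel cis"

text \<open>The measure putting mass \<open>m n / n\<close> on each \<open>n\<close>-th root of unity, for every \<open>n \<ge> 1\<close>, plus
  \<open>minf\<close> times the uniform measure.\<close>

definition circle_mixture :: "(nat \<Rightarrow> real) \<Rightarrow> real \<Rightarrow> complex measure" where
  "circle_mixture m minf =
     measure_of UNIV (sets borel)
       (\<lambda>B. (\<Sum>n. \<Sum>k<Suc n. ennreal (m (Suc n) / real (Suc n)) *
                indicator B (cis (2 * real k * pi / real (Suc n))))
            + ennreal minf * emeasure uniform_circle B)"

section \<open>Exclusive moments and their limiting system\<close>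

definition exclusive_moment :: "nat \<Rightarrow> (nat \<Rightarrow> nat) \<Rightarrow> nat \<Rightarrow> (nat \<Rightarrow> nat) \<Rightarrow> real" where
  "exclusive_moment k p N S =
     real (card {i \<in> {1..k} \<rightarrow>\<^sub>E {1..N}. inj_on i {1..k} \<and> (\<forall>l\<in>{1..k}. S (i (p l)) = i l)})
       / real N ^ num_cycles k p"

text \<open>The case \<open>\<alpha> = 0\<close> is the convention for the quotient, which is its limit as \<open>\<alpha>\<close> tends to 0.\<close>

definition drift :: "real \<Rightarrow> nat \<Rightarrow> real" where
  "drift \<alpha> k = (if \<alpha> = 0 then - real k else ((1 - \<alpha>) ^ k - 1) / \<alpha>)"

text \<open>The truncated subtraction and the division on natural numbers are exact here: a permutation
  \<open>p \<noteq> id\<close> has at least one cycle that is not a fixed point, and \<open>i\<close> divides the number of points of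
  period \<open>i\<close>.\<close>

definition jump_coeff :: "(nat \<Rightarrow> real) \<Rightarrow> real \<Rightarrow> nat \<Rightarrow> (nat \<Rightarrow> nat) \<Rightarrow> real" where
  "jump_coeff lam \<alpha> k p =
     \<alpha> ^ (num_cycles k p - period_count k p 1 - 1) *
     (\<Prod>i=2..k. lam i ^ (period_count k p i div i)) *
     (1 - \<alpha>) ^ period_count k p 1"

definition moment_system ::
    "(nat \<Rightarrow> real) \<Rightarrow> real \<Rightarrow> (nat \<Rightarrow> (nat \<Rightarrow> nat) \<Rightarrow> real \<Rightarrow> real) \<Rightarrow> bool" where
  "moment_system lam \<alpha> m \<longleftrightarrow>
     (\<forall>k\<ge>1. \<forall>p0. p0 permutes {1..k} \<longrightarrow>
        (\<forall>t0\<ge>0. (m k p0 has_real_derivative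
            drift \<alpha> k * m k p0 t0 +
            (\<Sum>p | p permutes {1..k} \<and> p \<noteq> id \<and> perm_le k p p0.
               jump_coeff lam \<alpha> k p * m k (inv_into UNIV p \<circ> p0) t0)) (at t0 within {0..})) \<and>
        m k p0 0 = (if p0 = id then 1 else 0))"

end

theory Submission
  imports Defs "HOL-Real_Asymp.Real_Asymp"
begin

text \<open>Fix a permutation \<open>S\<close> of \<open>{1..N}\<close> and let \<open>s\<close> be uniform in the class. A tuple \<open>i\<close> counted by the
  exclusive moment of \<open>s \<circ> S\<close> at \<open>p\<close> satisfies \<open>s a\<^sub>l = i\<^sub>l\<close>, where \<open>a\<^sub>l = S (i (p l))\<close>. If \<open>a\<close> and \<open>i\<close> have the
  same range, then \<open>a\<^sub>l = i (q l)\<close> for a permutation \<open>q\<close> of \<open>{1..k}\<close>, and \<open>i\<close> contributes to the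
  exclusive moments of \<open>S\<close> at \<open>q\<^sup>-\<^sup>1 p\<close> and of \<open>s\<close> at \<open>q\<close>. The powers of \<open>N\<close> balance exactly when \<open>q \<le> p\<close>, by
  the triangle inequality for cycle counts. Otherwise some \<open>a\<^sub>l\<close> lies outside the range of \<open>i\<close>, so the
  walk \<open>S \<circ> s\<close> started there closes up without \<open>s\<close> hitting its starting point; a switching argument (conjugating
  \<open>s\<close> by a transposition with a fresh point) shows that this costs an extra factor \<open>1/N\<close>, uniformly in \<open>S\<close>.
  Hence the generator acts on exclusive moments by a matrix converging to that of the limiting system, up to a
  vanishing deterministic error, and Gronwall's inequality gives the convergence of the expected moments.
  The eigenvalue distribution of a permutation matrix is the mixture of the uniform measures on \<open>n\<close>-th roots of
  unity with weights the exclusive moments of the \<open>n\<close>-cycles; mass escaping to \<open>n = \<infinity>\<close>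
  becomes uniform on the circle.\<close>

section \<open>Cycles of permutations\<close>

text \<open>The obstacle is the rate \<open>N / class_moved N C\<close>: when
  \<open>\<alpha> = 0\<close> it can be of order \<open>N\<close>, for instance for transpositions,
  so an error that is only \<open>O(1/N)\<close> per class element need not vanish after
  multiplication by it. Every error count must therefore also carry a factor
  \<open>class_moved N C\<close>. This is why the switching argument injects into the class elements
  that move the given point instead of into the whole class, and why coincidences between cycles are
  counted together with a nontrivial cycle of \<open>s\<close>. The same cancellation explains the
  exponent of \<open>\<alpha>\<close> in the jump coefficients: one nontrivial cycle pays for the
  rate, each further one contributes a factor \<open>\<alpha>\<close>. Since the error bound holds
  for every \<open>S\<close>, nothing about the law of the walk at time \<open>t\<close> is needed:
  for each fixed \<open>k\<close> the expected moments satisfy a finite closed linear system up to a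
  small forcing term.\<close>

lemma permutation_if_permutes: "p permutes {1..k::nat} \<Longrightarrow> permutation p"
  by (auto simp: permutation_permutes)

lemma orbit_eq_if_mem:
  assumes "permutation p" "y \<in> orbit p x"
  shows "orbit p y = orbit p x"
  using assms by (meson cyclic_on_orbit' orbit_cyclic_eq3)

lemma orbit_comp_transpose:
  assumes p: "permutation p" and "u \<notin> orbit p x" "v \<notin> orbit p x"
  shows "orbit (Transposition.transpose u v \<circ> p) x = orbit p x"
proof (rule orbit_cong)
  show "x \<in> orbit p x" by (rule permutation_self_in_orbit[OF p])
  fix s assume "s \<in> orbit p x"
  then have "p s \<in> orbit p x" by (rule orbit.step)
  then show "(Transposition.transpose u v \<circ> p) s = p s"
    using assms by (metis comp_apply transpose_apply_other)
qed

text \<open>Cycles of \<open>p\<close> containing neither \<open>u\<close> nor \<open>v\<close>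
  survive unchanged. At most two cycles are lost, and at least one new cycle passes through
  \<open>u\<close>. If \<open>v = p u\<close> and \<open>u \<noteq> v\<close>, only one cycle is
  lost, while \<open>u\<close> becomes a fixed point separate from the cycle of
  \<open>v\<close>.\<close>

lemma num_cycles_transpose:
  assumes p: "p permutes {1..k}" and uv: "u \<in> {1..k}" "v \<in> {1..k}"
  shows "num_cycles k p \<le> num_cycles k (Transposition.transpose u v \<circ> p) + 1" (is ?weak)
    and "v = p u \<Longrightarrow> u \<noteq> v \<Longrightarrow> num_cycles k p + 1 \<le> num_cycles k (Transposition.transpose u v \<circ> p)"
      (is "_ \<Longrightarrow> _ \<Longrightarrow> ?split")
proof -
  define p' where "p' = Transposition.transpose u v \<circ> p"
  have p': "p' permutes {1..k}" unfolding p'_def by (intro permutes_compose p permutes_swap_id uv)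
  note P = permutation_if_permutes[OF p] and P' = permutation_if_permutes[OF p']
  define A where "A = {X \<in> orbit p ` {1..k}. u \<notin> X \<and> v \<notin> X}"
  have finA: "finite A" unfolding A_def by auto
  have self: "x \<in> orbit p x" "x \<in> orbit p' x" for x
    by (rule permutation_self_in_orbit[OF P], rule permutation_self_in_orbit[OF P'])
  have A_sub: "A \<subseteq> orbit p' ` {1..k}"
    unfolding A_def p'_def using orbit_comp_transpose[OF P, of u _ v] by (auto simp: image_iff)
  have O_sub: "orbit p ` {1..k} \<subseteq> insert (orbit p u) (insert (orbit p v) A)"
    unfolding A_def using orbit_eq_if_mem[OF P] by blast
  have notin: "orbit p' u \<notin> A" "orbit p' v \<notin> A"
    unfolding A_def using self by auto
  have "num_cycles k p \<le> card A + 2"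
    unfolding num_cycles_def using card_mono[OF _ O_sub] finA
    by (auto simp: card_insert_if split: if_splits)
  moreover have "insert (orbit p' u) A \<subseteq> orbit p' ` {1..k}" using A_sub uv by auto
  then have "card (insert (orbit p' u) A) \<le> num_cycles k p'"
    unfolding num_cycles_def by (intro card_mono) auto
  then have "card A + 1 \<le> num_cycles k p'" using notin finA by simp
  ultimately show ?weak unfolding p'_def by simp
  assume v: "v = p u" and neq: "u \<noteq> v"
  have "orbit p v = orbit p u" unfolding v by (rule permutation_orbit_step[OF P])
  then have "num_cycles k p \<le> card A + 1"
    unfolding num_cycles_def using card_mono[OF _ O_sub] finA
    by (auto simp: card_insert_if split: if_splits)
  moreover have "p' u = u" unfolding p'_def v by simp
  then have "orbit p' u = {u}" by (simp add: orbit_eq_singleton_iff)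
  then have neq': "orbit p' u \<noteq> orbit p' v" using self(2)[of v] neq by auto
  have "insert (orbit p' u) (insert (orbit p' v) A) \<subseteq> orbit p' ` {1..k}" using A_sub uv by auto
  then have "card (insert (orbit p' u) (insert (orbit p' v) A)) \<le> num_cycles k p'"
    unfolding num_cycles_def by (intro card_mono) auto
  then have "card A + 2 \<le> num_cycles k p'" using notin finA neq' by simp
  ultimately show ?split unfolding p'_def by simp
qed

lemma num_cycles_le: "num_cycles k p \<le> k"
  unfolding num_cycles_def using card_image_le[of "{1..k}" "orbit p"] by simp

lemma num_cycles_id: "num_cycles k id = k"
proof -
  have "orbit id x = {x}" for x :: nat by (simp add: orbit_eq_singleton_iff)
  then show ?thesis unfolding num_cycles_def by (subst card_image) (auto simp: inj_on_def)
qed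

text \<open>Composing with the transposition of \<open>u\<close> and \<open>p u\<close> raises the
  cycle count of \<open>p\<close> by at least one and that of \<open>p \<circ> q\<close> by at most
  one, so the inequality descends from the modified \<open>p\<close> to \<open>p\<close>. The
  identity, where equality holds, is the base case.\<close>

lemma num_cycles_comp:
  assumes "p permutes {1..k}" "q permutes {1..k}"
  shows "num_cycles k p + num_cycles k q \<le> k + num_cycles k (p \<circ> q)"
  using assms(1)
proof (induction "k - num_cycles k p" arbitrary: p rule: less_induct)
  case less
  show ?case
  proof (cases "p = id")
    case True
    then show ?thesis by (simp add: num_cycles_id)
  next
    case False
    then obtain u where u: "p u \<noteq> u" by fastforce
    then have u_in: "u \<in> {1..k}" using less.prems by (meson permutes_not_in)
    then have v_in: "p u \<in> {1..k}" using less.prems by (simp only: permutes_in_image)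
    define t where "t = Transposition.transpose u (p u)"
    have tp: "t \<circ> p permutes {1..k}"
      unfolding t_def by (intro permutes_compose less.prems permutes_swap_id u_in v_in)
    have up: "num_cycles k p + 1 \<le> num_cycles k (t \<circ> p)"
      unfolding t_def using u u_in v_in by (intro num_cycles_transpose(2) less.prems) auto
    then have "num_cycles k (t \<circ> p) + num_cycles k q \<le> k + num_cycles k ((t \<circ> p) \<circ> q)"
      using num_cycles_le[of k "t \<circ> p"] by (intro less.hyps tp) linarith
    moreover have "num_cycles k ((t \<circ> p) \<circ> q) \<le> num_cycles k (t \<circ> ((t \<circ> p) \<circ> q)) + 1"
      unfolding t_def
      by (intro num_cycles_transpose(1) u_in v_in permutes_compose assms(2) tp[unfolded t_def])
    moreover have "t \<circ> ((t \<circ> p) \<circ> q) = p \<circ> q" by (auto simp: t_def fun_eq_iff)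
    ultimately show ?thesis using up by simp
  qed
qed

text \<open>The order is the equality case of the triangle inequality. All counts are at most
  \<open>k\<close>, so the truncated subtractions in \<open>perm_dist\<close> lose nothing. The
  defect of the inequality reappears later as a surplus power of \<open>1/N\<close>.\<close>

lemma num_cycles_quotient:
  assumes "p permutes {1..k}" "q permutes {1..k}"
  shows "num_cycles k p + num_cycles k (inv_into UNIV p \<circ> q) \<le> k + num_cycles k q"
    and "perm_le k p q \<longleftrightarrow> num_cycles k p + num_cycles k (inv_into UNIV p \<circ> q) = k + num_cycles k q"
proof -
  have *: "p \<circ> (inv_into UNIV p \<circ> q) = q"
    using permutes_inv_o(1)[OF assms(1)] by (metis comp_assoc id_comp)
  have "inv_into UNIV p \<circ> q permutes {1..k}" using assms by (simp add: permutes_compose permutes_inv)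
  from num_cycles_comp[OF assms(1) this]
  show le: "num_cycles k p + num_cycles k (inv_into UNIV p \<circ> q) \<le> k + num_cycles k q" unfolding * .
  have "inv_into UNIV id \<circ> r = r" for r :: "nat \<Rightarrow> nat" by (simp add: inv_id fun_eq_iff)
  then show "perm_le k p q \<longleftrightarrow> num_cycles k p + num_cycles k (inv_into UNIV p \<circ> q) = k + num_cycles k q"
    unfolding perm_le_def perm_dist_def
    using num_cycles_le[of k p] num_cycles_le[of k q] num_cycles_le[of k "inv_into UNIV p \<circ> q"] le by auto
qed

section \<open>Cycle representatives and the tuples they determine\<close>

definition transversal :: "nat \<Rightarrow> (nat \<Rightarrow> nat) \<Rightarrow> nat set \<Rightarrow> bool" where
  "transversal k p R \<longleftrightarrow> R \<subseteq> {1..k} \<and> inj_on (orbit p) R \<and> orbit p ` R = orbit p ` {1..k}"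

lemma transversal_exists:
  assumes "p permutes {1..k}" "l \<in> {1..k}"
  shows "\<exists>R. transversal k p R \<and> l \<in> R"
proof -
  have P: "permutation p" by (rule permutation_if_permutes[OF assms(1)])
  \<comment> \<open>Each cycle gets an arbitrary representative, except that \<open>l\<close>
    represents its own cycle; the value at a prescribed position can then serve as one of the free
    parameters of a tuple.\<close>
  define r where "r x = (if l \<in> orbit p x then l else SOME y. y \<in> orbit p x)" for x
  have r: "r x \<in> orbit p x" for x
    unfolding r_def using someI[of "\<lambda>y. y \<in> orbit p x"] permutation_self_in_orbit[OF P] by auto
  have orb: "orbit p (r x) = orbit p x" for x by (rule orbit_eq_if_mem[OF P r])
  have r_cong: "r x = r y" if "orbit p x = orbit p y" for x y using that by (simp add: r_def)
  have "r x \<in> {1..k}" if "x \<in> {1..k}" for x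
    using r[of x] permutes_orbit_subset[OF assms(1) that] by auto
  moreover have "l \<in> r ` {1..k}"
    using assms(2) permutation_self_in_orbit[OF P, of l] by (force simp: r_def image_iff)
  moreover have "inj_on (orbit p) (r ` {1..k})"
  proof (rule inj_onI)
    fix a b assume ab: "a \<in> r ` {1..k}" "b \<in> r ` {1..k}" "orbit p a = orbit p b"
    then obtain x y where xy: "a = r x" "b = r y" by blast
    then have "orbit p x = orbit p y" using ab(3) by (simp add: orb)
    then show "a = b" unfolding xy by (rule r_cong)
  qed
  moreover have "orbit p ` r ` {1..k} = orbit p ` {1..k}" by (simp add: image_image orb)
  ultimately show ?thesis unfolding transversal_def by blast
qed

lemma transversalD:
  assumes "transversal k p R"
  shows "R \<subseteq> {1..k}" "finite R" "card R = num_cycles k p"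
  using assms card_image[of "orbit p" R] finite_subset[of R "{1..k}"]
  by (auto simp: transversal_def num_cycles_def)

lemma transversal_cover:
  assumes "p permutes {1..k}" "transversal k p R" "x \<in> {1..k}"
  obtains r where "r \<in> R" "x \<in> orbit p r"
proof -
  have "orbit p x \<in> orbit p ` R" using assms by (simp add: transversal_def)
  then show ?thesis
    using that permutation_self_in_orbit[OF permutation_if_permutes[OF assms(1)], of x] by blast
qed

definition pattern_tuples :: "nat \<Rightarrow> (nat \<Rightarrow> nat) \<Rightarrow> nat \<Rightarrow> (nat \<Rightarrow> nat) \<Rightarrow> (nat \<Rightarrow> nat) set" where
  "pattern_tuples k p N f =
     {i \<in> {1..k} \<rightarrow>\<^sub>E {1..N}. inj_on i {1..k} \<and> (\<forall>l\<in>{1..k}. f (i (p l)) = i l)}"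

lemma exclusive_moment_eq:
  "exclusive_moment k p N f = real (card (pattern_tuples k p N f)) / real N ^ num_cycles k p"
  unfolding exclusive_moment_def pattern_tuples_def ..

lemma finite_pattern_tuples: "finite (pattern_tuples k p N f)"
  unfolding pattern_tuples_def by (rule finite_subset[of _ "{1..k} \<rightarrow>\<^sub>E {1..N}"]) (auto intro: finite_PiE)

text \<open>Injectivity of \<open>f\<close> lets the relation be solved for \<open>i (p l)\<close>
  in terms of \<open>i l\<close>, so one value propagates along the whole cycle. Hence a tuple has
  at most one degree of freedom per cycle.\<close>

lemma tuple_determined:
  assumes p: "p permutes {1..k}" and f: "inj f" and x: "x \<in> orbit p r" and r: "r \<in> {1..k}"
    and i: "\<forall>l\<in>{1..k}. f (i (p l)) = i l" and j: "\<forall>l\<in>{1..k}. f (j (p l)) = j l"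
    and ij: "i r = j r"
  shows "i x = j x"
proof -
  have "i x = j x \<and> x \<in> {1..k}"
    using x
  proof induction
    case base
    have "f (i (p r)) = f (j (p r))" using i j r ij by simp
    then show ?case using f permutes_in_image[OF p] r by (auto dest: injD)
  next
    case (step y)
    then have "f (i (p y)) = f (j (p y))" using i j by simp
    then show ?case using f permutes_in_image[OF p] step by (auto dest: injD)
  qed
  then show ?thesis ..
qed

text \<open>Restriction to \<open>R\<close> is injective on \<open>I\<close>, so each position of
  \<open>R\<close> contributes one factor. The form of \<open>det\<close> allows \<open>R\<close> to
  miss a cycle: agreement on \<open>R\<close> need only propagate to some \<open>R'\<close> meeting
  all cycles, as happens when values on two cycles are tied together.\<close>

lemma card_tuples_le_prod:
  assumes p: "p permutes {1..k}" and f: "inj f" and R: "finite R" "R \<subseteq> {1..k}"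
    and Y: "\<And>r. r \<in> R \<Longrightarrow> finite (Y r)"
    and I: "\<And>i. i \<in> I \<Longrightarrow> i \<in> extensional {1..k} \<and> (\<forall>l\<in>{1..k}. f (i (p l)) = i l) \<and> (\<forall>r\<in>R. i r \<in> Y r)"
    and det: "\<And>i j. i \<in> I \<Longrightarrow> j \<in> I \<Longrightarrow> \<forall>r\<in>R. i r = j r \<Longrightarrow> \<exists>R'\<subseteq>{1..k}. {1..k} \<subseteq> (\<Union>r\<in>R'. orbit p r) \<and> (\<forall>r\<in>R'. i r = j r)"
  shows "card I \<le> (\<Prod>r\<in>R. card (Y r))"
proof -
  have "inj_on (\<lambda>i. restrict i R) I"
  proof (rule inj_onI)
    fix i j assume ij: "i \<in> I" "j \<in> I" "restrict i R = restrict j R"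
    then have "\<forall>r\<in>R. i r = j r" by (metis restrict_apply')
    from det[OF ij(1,2) this] obtain R' where R': "R' \<subseteq> {1..k}" "{1..k} \<subseteq> (\<Union>r\<in>R'. orbit p r)" "\<forall>r\<in>R'. i r = j r"
      by blast
    have "i x = j x" if x: "x \<in> {1..k}" for x
    proof -
      obtain r where "r \<in> R'" "x \<in> orbit p r" using R'(2) x by blast
      then show ?thesis using R' I[OF ij(1)] I[OF ij(2)] by (intro tuple_determined[OF p f]) auto
    qed
    then show "i = j" using I[OF ij(1)] I[OF ij(2)] by (meson extensionalityI)
  qed
  then have "card I = card ((\<lambda>i. restrict i R) ` I)" by (simp add: card_image)
  also have "\<dots> \<le> card (PiE R Y)"
    using I R Y by (intro card_mono finite_PiE) auto
  also have "\<dots> = (\<Prod>r\<in>R. card (Y r))" by (rule card_PiE[OF R(1)])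
  finally show ?thesis .
qed

text \<open>With \<open>l\<close> in the transversal, its value has \<open>card X\<close> choices
  and every other cycle at most \<open>N\<close>. Confining one coordinate to \<open>X\<close> thus
  replaces one factor \<open>N\<close> by \<open>card X\<close>.\<close>

lemma card_pattern_tuples_at:
  assumes p: "p permutes {1..k}" and f: "inj f" and l: "l \<in> {1..k}" and X: "finite X"
  shows "card {i \<in> pattern_tuples k p N f. i l \<in> X} \<le> card X * N ^ (num_cycles k p - 1)"
proof -
  obtain R where R: "transversal k p R" "l \<in> R" using transversal_exists[OF p l] by blast
  have "card {i \<in> pattern_tuples k p N f. i l \<in> X} \<le> (\<Prod>r\<in>R. card (if r = l then X else {1..N}))"
  proof (rule card_tuples_le_prod[OF p f])
    show "\<exists>R'\<subseteq>{1..k}. {1..k} \<subseteq> (\<Union>r\<in>R'. orbit p r) \<and> (\<forall>r\<in>R'. i r = j r)"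
      if "\<forall>r\<in>R. i r = j r" for i j
      using that transversal_cover[OF p R(1)] transversalD(1)[OF R(1)] by (intro exI[of _ R]) blast
  qed (use transversalD[OF R(1)] X in \<open>auto simp: pattern_tuples_def PiE_iff Pi_iff\<close>)
  also have "\<dots> = card X * (\<Prod>r\<in>R - {l}. N)"
    using R(2) transversalD(2)[OF R(1)] by (subst prod.remove[of _ l]) (auto intro!: prod.cong)
  also have "\<dots> = card X * N ^ (num_cycles k p - 1)"
    using transversalD[OF R(1)] R(2) by simp
  finally show ?thesis .
qed

lemma card_pattern_tuples_le:
  assumes p: "p permutes {1..k}" and f: "inj f" and k: "k \<ge> 1"
  shows "card (pattern_tuples k p N f) \<le> N ^ num_cycles k p"
proof -
  have "1 \<in> {1..k}" using k by simp
  from card_pattern_tuples_at[OF p f this, of "{1..N}" N]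
  have "card {i \<in> pattern_tuples k p N f. i 1 \<in> {1..N}} \<le> N * N ^ (num_cycles k p - 1)" by simp
  moreover have "{i \<in> pattern_tuples k p N f. i 1 \<in> {1..N}} = pattern_tuples k p N f"
    using k by (auto simp: pattern_tuples_def)
  moreover have "num_cycles k p \<noteq> 0"
    unfolding num_cycles_def using k by simp
  ultimately show ?thesis by (metis power_eq_if)
qed

section \<open>Conjugacy classes and closed walks\<close>

lemma conj_funpow:
  assumes "bij q"
  shows "(q \<circ> p \<circ> inv_into UNIV q) ^^ n = q \<circ> p ^^ n \<circ> inv_into UNIV q"
proof (induction n)
  case 0
  show ?case using assms by (auto simp: fun_eq_iff bij_is_surj surj_f_inv_f)
next
  case (Suc n)
  show ?case unfolding funpow.simps Suc using assms by (simp add: fun_eq_iff bij_is_inj)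
qed

lemma least_power_conj:
  assumes "bij q"
  shows "least_power (q \<circ> p \<circ> inv_into UNIV q) (q x) = least_power p x"
  unfolding least_power_def conj_funpow[OF assms]
  using assms by (simp add: bij_is_inj inj_eq)

lemma least_power_eq_1: "permutation p \<Longrightarrow> least_power p x = 1 \<longleftrightarrow> p x = x"
  using least_power_dvd[of p x 1] by simp

lemma period_count_conj:
  assumes q: "q permutes {1..k}"
  shows "period_count k (q \<circ> p \<circ> inv_into UNIV q) n = period_count k p n"
proof -
  have "{j \<in> {1..k}. least_power (q \<circ> p \<circ> inv_into UNIV q) j = n} = q ` {j \<in> {1..k}. least_power p j = n}"
    (is "?L = ?R")
  proof
    show "?R \<subseteq> ?L" using least_power_conj[OF permutes_bij[OF q]] permutes_in_image[OF q] by auto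
    show "?L \<subseteq> ?R"
    proof
      fix j assume j: "j \<in> ?L"
      have "j \<in> q ` {1..k}" using j permutes_image[OF q] by auto
      then obtain y where "y \<in> {1..k}" "j = q y" by blast
      then show "j \<in> ?R" using j least_power_conj[OF permutes_bij[OF q], of p y] by auto
    qed
  qed
  then show ?thesis
    unfolding period_count_def by (simp only: card_image[OF permutes_inj_on[OF q]])
qed

context
  fixes N C
  assumes C: "is_conjugacy_class N C"
begin

lemma class_permutes: "s \<in> C \<Longrightarrow> s permutes {1..N}"
  using C unfolding is_conjugacy_class_def
  by (auto intro!: permutes_compose permutes_inv)

lemma class_finite: "finite C"
proof (rule finite_subset)
  show "C \<subseteq> {p. p permutes {1..N}}" using class_permutes by auto
qed (simp add: finite_permutations)

lemma class_nonempty: "C \<noteq> {}"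
  using C unfolding is_conjugacy_class_def using permutes_id by auto

lemma class_card_pos: "card C > 0"
  using class_finite class_nonempty by (simp add: card_gt_0_iff)

lemma class_conj:
  assumes "s \<in> C" "t permutes {1..N}"
  shows "t \<circ> s \<circ> inv_into UNIV t \<in> C"
proof -
  obtain p where p: "C = {q \<circ> p \<circ> inv_into UNIV q | q. q permutes {1..N}}"
    using C unfolding is_conjugacy_class_def by auto
  then obtain q where q: "q permutes {1..N}" "s = q \<circ> p \<circ> inv_into UNIV q" using assms by auto
  have "inv_into UNIV (t \<circ> q) = inv_into UNIV q \<circ> inv_into UNIV t"
    by (intro o_inv_distrib permutes_bij[OF q(1)] permutes_bij[OF assms(2)])
  then have "t \<circ> s \<circ> inv_into UNIV t = (t \<circ> q) \<circ> p \<circ> inv_into UNIV (t \<circ> q)"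
    by (simp add: q(2) comp_assoc)
  then show ?thesis unfolding p using permutes_compose[OF q(1) assms(2)] by blast
qed

lemma class_transitive:
  assumes "s \<in> C" "s' \<in> C"
  obtains t where "t permutes {1..N}" "s' = t \<circ> s \<circ> inv_into UNIV t"
proof -
  obtain p where p: "C = {q \<circ> p \<circ> inv_into UNIV q | q. q permutes {1..N}}"
    using C unfolding is_conjugacy_class_def by auto
  obtain q where q: "q permutes {1..N}" "s = q \<circ> p \<circ> inv_into UNIV q" using assms p by auto
  obtain q' where q': "q' permutes {1..N}" "s' = q' \<circ> p \<circ> inv_into UNIV q'" using assms p by auto
  have inv: "inv_into UNIV (q' \<circ> inv_into UNIV q) = q \<circ> inv_into UNIV q'"
    using permutes_bij[OF q(1)] permutes_bij[OF q'(1)]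
    by (subst o_inv_distrib) (auto simp: bij_imp_bij_inv inv_inv_eq)
  have "(q' \<circ> inv_into UNIV q) \<circ> s \<circ> (q \<circ> inv_into UNIV q')
      = q' \<circ> (inv_into UNIV q \<circ> q) \<circ> p \<circ> (inv_into UNIV q \<circ> q) \<circ> inv_into UNIV q'"
    by (simp add: q(2) comp_assoc)
  also have "\<dots> = s'" by (simp add: permutes_inv_o(2)[OF q(1)] q'(2))
  finally show ?thesis
    using that[of "q' \<circ> inv_into UNIV q"] inv
    by (metis permutes_compose permutes_inv q(1) q'(1))
qed

lemma class_count_eq:
  assumes "s \<in> C"
  shows "class_count N C n = period_count N s n"
proof -
  have "(SOME p. p \<in> C) \<in> C" using someI[of "\<lambda>p. p \<in> C"] assms .
  from class_transitive[OF this assms] show ?thesis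
    unfolding class_count_def by (metis period_count_conj)
qed

lemma class_moved_eq:
  assumes "s \<in> C"
  shows "card {x \<in> {1..N}. s x \<noteq> x} = class_moved N C"
proof -
  have P: "permutation s" using class_permutes[OF assms] by (auto simp: permutation_permutes)
  have "period_count N s 1 = card {x \<in> {1..N}. s x = x}"
    unfolding period_count_def least_power_eq_1[OF P] ..
  moreover have "card {x \<in> {1..N}. s x \<noteq> x} = card ({1..N} - {x \<in> {1..N}. s x = x})"
    by (rule arg_cong[where f = card]) auto
  moreover have "\<dots> = card {1..N} - card {x \<in> {1..N}. s x = x}"
    by (rule card_Diff_subset) auto
  ultimately show ?thesis
    unfolding class_moved_def class_count_eq[OF assms] by simp
qed

lemma class_count_le: "class_count N C n \<le> N"
proof -
  have "card {j \<in> {1..N}. least_power (SOME p. p \<in> C) j = n} \<le> card {1..N}" by (intro card_mono) auto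
  then show ?thesis unfolding class_count_def period_count_def by simp
qed

text \<open>A point whose period is not 1 is moved. This is the bound on the values available to a
  nontrivial cycle, expressed by the quantity that cancels against the rate of the walk.\<close>

lemma class_count_le_moved:
  assumes "n \<noteq> 1"
  shows "class_count N C n \<le> class_moved N C"
proof -
  obtain s where s: "s \<in> C" using class_nonempty by auto
  have P: "permutation s" using class_permutes[OF s] by (auto simp: permutation_permutes)
  show ?thesis
    unfolding class_count_eq[OF s] period_count_def class_moved_eq[OF s, symmetric]
    using least_power_eq_1[OF P] assms by (intro card_mono) auto
qed

lemma class_moved_pos:
  assumes "C \<noteq> {id}"
  shows "class_moved N C > 0"
proof (rule ccontr)
  assume "\<not> class_moved N C > 0"
  have "s = id" if s: "s \<in> C" for s
  proof
    fix x
    have "card {x \<in> {1..N}. s x \<noteq> x} = 0"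
      using class_moved_eq[OF s] \<open>\<not> class_moved N C > 0\<close> by simp
    then show "s x = id x" using permutes_not_in[OF class_permutes[OF s], of x] by auto
  qed
  then show False using assms class_nonempty by blast
qed

text \<open>Double counting of the pairs of a class element and a point moved by it. The factor
  \<open>class_moved N C\<close> produced here is the one that the rate
  \<open>N / class_moved N C\<close> consumes.\<close>

lemma sum_class_moved: "(\<Sum>x=1..N. card {s \<in> C. s x \<noteq> x}) = card C * class_moved N C"
proof -
  have "(\<Sum>x=1..N. card {s \<in> C. s x \<noteq> x}) = (\<Sum>s\<in>C. card {x \<in> {1..N}. s x \<noteq> x})"
    using sum_multicount_gen[OF class_finite, of "{1..N}" "\<lambda>s x. s x \<noteq> x" "\<lambda>x. card {s \<in> C. s x \<noteq> x}"]
    by simp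
  also have "\<dots> = (\<Sum>s\<in>C. class_moved N C)" by (intro sum.cong refl class_moved_eq)
  finally show ?thesis by simp
qed

end

section \<open>Closed walks on which \<open>s\<close> avoids the starting point\<close>

definition bad_walks :: "('a \<Rightarrow> 'a) set \<Rightarrow> ('a \<Rightarrow> 'a) \<Rightarrow> nat \<Rightarrow> 'a \<Rightarrow> ('a \<Rightarrow> 'a) set" where
  "bad_walks C S n x = {s \<in> C. ((S \<circ> s) ^^ n) x = x \<and> (\<forall>j<n. s (((S \<circ> s) ^^ j) x) \<noteq> x)}"

text \<open>At step \<open>m\<close> the walk touches \<open>w\<close> for the first time, whether
  as a position or as an image under \<open>s\<close>, and \<open>s\<close> has not yet hit
  \<open>x\<close>. The past of the walk does not involve \<open>w\<close>, so exchanging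
  \<open>w\<close> with another unvisited point cannot change it.\<close>

definition fresh_hit :: "('a \<Rightarrow> 'a) set \<Rightarrow> ('a \<Rightarrow> 'a) \<Rightarrow> 'a \<Rightarrow> nat \<Rightarrow> 'a \<Rightarrow> ('a \<Rightarrow> 'a) set" where
  "fresh_hit C S x m w = {s \<in> C. s (((S \<circ> s) ^^ m) x) = w \<and>
     (\<forall>j\<le>m. s (((S \<circ> s) ^^ j) x) \<noteq> x \<and> ((S \<circ> s) ^^ j) x \<noteq> w) \<and>
     (\<forall>j<m. s (((S \<circ> s) ^^ j) x) \<noteq> w)}"

text \<open>The point \<open>S\<^sup>-\<^sup>1 x\<close> is hit at step \<open>n - 1\<close>. Among all hits of \<open>S\<^sup>-\<^sup>r x\<close> at a step \<open>m\<close> with \<open>m + r \<le> n\<close>, the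
  first one is fresh: had the walk visited \<open>S\<^sup>-\<^sup>r x\<close> before, then it would have hit \<open>S\<^sup>-\<^sup>r\<^sup>-\<^sup>1 x\<close> one step earlier.\<close>

lemma bad_walks_subset:
  assumes S: "bij S" and n: "n > 0"
  shows "bad_walks C S n x \<subseteq> (\<Union>m<n. \<Union>r\<in>{1..n}. fresh_hit C S x m ((inv_into UNIV S ^^ r) x))"
proof
  fix s assume s: "s \<in> bad_walks C S n x"
  define T where "T = inv_into UNIV S"
  have TS: "T (S y) = y" for y unfolding T_def using S by (simp add: bij_is_inj)
  define a where "a j = ((S \<circ> s) ^^ j) x" for j
  have a_Suc: "a (Suc j) = S (s (a j))" for j by (simp add: a_def)
  have an: "a n = x" and ax: "\<And>j. j < n \<Longrightarrow> s (a j) \<noteq> x" and sC: "s \<in> C"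
    using s by (auto simp: bad_walks_def a_def)
  \<comment> \<open>The constraint \<open>m + r \<le> n\<close> is stable under going back one step,
    which lowers the time by one and raises \<open>r\<close> by one. It confines \<open>r\<close> to
    \<open>{1..n}\<close>, so only finitely many targets occur, in a number independent of
    \<open>N\<close>.\<close>
  define Q where "Q m \<longleftrightarrow> m < n \<and> (\<exists>r\<ge>1. m + r \<le> n \<and> s (a m) = (T ^^ r) x)" for m
  have "s (a (n - 1)) = T x" using a_Suc[of "n - 1"] an n TS by (metis Suc_diff_1)
  then have "Q (n - 1)" unfolding Q_def using n by (intro conjI exI[of _ 1]) auto
  define m where "m = (LEAST m. Q m)"
  have "Q m" unfolding m_def by (rule LeastI[of Q]) fact
  have min: "\<not> Q j" if "j < m" for j using that unfolding m_def by (rule not_less_Least)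
  obtain r where r: "r \<ge> 1" "m + r \<le> n" "s (a m) = (T ^^ r) x" and m: "m < n"
    using \<open>Q m\<close> unfolding Q_def by auto
  have 1: "a j \<noteq> (T ^^ r) x" if "j \<le> m" for j
  proof (cases j)
    case 0
    then show ?thesis using ax[OF m] r(3) by (auto simp: a_def)
  next
    case (Suc i)
    show ?thesis
    proof
      assume "a j = (T ^^ r) x"
      then have "s (a i) = (T ^^ Suc r) x" using TS Suc a_Suc by (metis comp_apply funpow.simps(2))
      then have "Q i" unfolding Q_def using that Suc r m by (intro conjI exI[of _ "Suc r"]) auto
      then show False using min[of i] Suc that by simp
    qed
  qed
  have 2: "s (a j) \<noteq> (T ^^ r) x" if "j < m" for j
    using min[OF that] that r m unfolding Q_def by force
  have "s \<in> fresh_hit C S x m ((T ^^ r) x)"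
    unfolding fresh_hit_def using sC r(3) 1 2 ax m by (auto simp: a_def)
  then show "s \<in> (\<Union>m<n. \<Union>r\<in>{1..n}. fresh_hit C S x m ((inv_into UNIV S ^^ r) x))"
    using m r(1,2) unfolding T_def by (intro UN_I[of m] UN_I[of r]) auto
qed

text \<open>Conjugating by the transposition of \<open>w\<close> with a fresh point \<open>z\<close> redirects the walk from \<open>x\<close>
  at time \<open>m\<close> from \<open>w\<close> to \<open>z\<close>; since \<open>z\<close> can be read off the conjugate, this is injective
  in the pair of the permutation and \<open>z\<close>.\<close>

lemma card_fresh_hit:
  assumes C: "is_conjugacy_class N C" and w: "w \<in> {1..N}"
  shows "card (fresh_hit C S x m w) * (N - 2 * Suc m) \<le> card {s \<in> C. s x \<noteq> x}"
proof -
  define G where "G = fresh_hit C S x m w"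
  define a where "a s j = ((S \<circ> s) ^^ j) x" for s j
  have a_Suc: "a s (Suc j) = S (s (a s j))" and a_0: "a s 0 = x" for s j by (simp_all add: a_def)
  \<comment> \<open>The points the walk has not touched up to step \<open>m\<close>. Positions and
    images under \<open>s\<close> exclude at most \<open>2 * Suc m\<close> points, among them
    \<open>x\<close> (position 0) and \<open>w\<close> (the last image).\<close>
  define Z where "Z s = {1..N} - (a s ` {..m} \<union> (\<lambda>j. s (a s j)) ` {..m})" for s
  define t where "t = Transposition.transpose w"
  define F where "F = (\<lambda>(s, z). t z \<circ> s \<circ> t z)"
  have G: "s \<in> C" "s (a s m) = w" "\<And>j. j \<le> m \<Longrightarrow> s (a s j) \<noteq> x" "\<And>j. j \<le> m \<Longrightarrow> a s j \<noteq> w"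
    "\<And>j. j < m \<Longrightarrow> s (a s j) \<noteq> w" if "s \<in> G" for s
    using that by (auto simp: G_def fresh_hit_def a_def)
  have [simp]: "t z (t z y) = y" for z y by (simp add: t_def)
  have fixed: "t z y = y" if "y \<noteq> w" "y \<noteq> z" for y z using that by (simp add: t_def)
  have same: "a (F (s, z)) j = a s j" if s: "s \<in> G" and z: "z \<in> Z s" and "j \<le> m" for s z j
    using \<open>j \<le> m\<close>
  proof (induction j)
    case (Suc j)
    have "t z (a s j) = a s j" using G(4)[OF s, of j] z Suc.prems by (intro fixed) (auto simp: Z_def)
    moreover have "t z (s (a s j)) = s (a s j)" using G(5)[OF s, of j] z Suc.prems by (intro fixed) (auto simp: Z_def)
    ultimately show ?case using Suc by (simp add: a_Suc F_def)
  qed (simp add: a_0)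
  have step: "F (s, z) (a s j) = t z (s (a s j))" if s: "s \<in> G" and z: "z \<in> Z s" and "j \<le> m" for s z j
  proof -
    have "t z (a s j) = a s j" using G(4)[OF s, of j] z that by (intro fixed) (auto simp: Z_def)
    then show ?thesis by (simp add: F_def)
  qed
  have hit: "F (s, z) (a (F (s, z)) m) = z" if s: "s \<in> G" and z: "z \<in> Z s" for s z
    using step[OF s z, of m] same[OF s z, of m] G(2)[OF s] by (simp add: t_def)
  have inj: "inj_on F (Sigma G Z)"
  proof (rule inj_onI, clarify)
    fix s z s' z' assume *: "s \<in> G" "z \<in> Z s" "s' \<in> G" "z' \<in> Z s'" "F (s, z) = F (s', z')"
    then have z: "z = z'" using hit by metis
    have "t z \<circ> F (s, z) \<circ> t z = s" "t z' \<circ> F (s', z') \<circ> t z' = s'" by (auto simp: F_def fun_eq_iff)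
    then show "s = s' \<and> z = z'" using * z by metis
  qed
  \<comment> \<open>Landing among the elements that move \<open>x\<close>, not merely in
    \<open>C\<close>, is what yields \<open>class_moved\<close> after summation over
    \<open>x\<close>. For \<open>m = 0\<close> the new image of \<open>x\<close> is
    \<open>z\<close>; for larger \<open>m\<close> the image of \<open>x\<close> is unchanged and
    differs from \<open>x\<close> by freshness.\<close>
  have "F (s, z) \<in> {s \<in> C. s x \<noteq> x}" if s: "s \<in> G" and z: "z \<in> Z s" for s z
  proof -
    have tz: "t z permutes {1..N}" unfolding t_def using w z by (intro permutes_swap_id) (auto simp: Z_def)
    have "inv_into UNIV (t z) = t z" by (simp add: t_def)
    then have "F (s, z) \<in> C" using class_conj[OF C G(1)[OF s] tz] by (simp add: F_def)
    moreover have "F (s, z) x \<noteq> x"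
    proof (cases "m = 0")
      case True
      then show ?thesis using hit[OF s z] z by (auto simp: a_0 Z_def)
    next
      case False
      have "F (s, z) x = t z (s x)" using step[OF s z, of 0] by (simp add: a_0)
      also have "\<dots> = s x"
      proof (rule fixed)
        show "s x \<noteq> w" using G(5)[OF s, of 0] False by (simp add: a_0)
        have "s (a s 0) \<in> (\<lambda>j. s (a s j)) ` {..m}" by blast
        then show "s x \<noteq> z" using z by (auto simp: Z_def a_0)
      qed
      finally show ?thesis using G(3)[OF s, of 0] by (simp add: a_0)
    qed
    ultimately show ?thesis by simp
  qed
  then have "F ` Sigma G Z \<subseteq> {s \<in> C. s x \<noteq> x}" by auto
  then have "card (Sigma G Z) \<le> card {s \<in> C. s x \<noteq> x}"
    by (intro card_inj_on_le[OF inj]) (auto simp: class_finite[OF C])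
  moreover have "card (Sigma G Z) = (\<Sum>s\<in>G. card (Z s))"
    unfolding G_def fresh_hit_def Z_def by (intro card_SigmaI) (auto simp: class_finite[OF C])
  moreover have "(\<Sum>s\<in>G. N - 2 * Suc m) \<le> (\<Sum>s\<in>G. card (Z s))"
  proof (intro sum_mono)
    fix s
    have "card (a s ` {..m} \<union> (\<lambda>j. s (a s j)) ` {..m}) \<le> card (a s ` {..m}) + card ((\<lambda>j. s (a s j)) ` {..m})"
      by (rule card_Un_le)
    also have "\<dots> \<le> Suc m + Suc m"
      using card_image_le[of "{..m}" "a s"] card_image_le[of "{..m}" "\<lambda>j. s (a s j)"] by simp
    finally show "N - 2 * Suc m \<le> card (Z s)"
      using diff_card_le_card_Diff[of "a s ` {..m} \<union> (\<lambda>j. s (a s j)) ` {..m}" "{1..N}"]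
      unfolding Z_def by simp
  qed
  ultimately show ?thesis unfolding G_def by simp
qed

text \<open>A union bound over the at most \<open>n * n\<close> pairs of a hitting time and a target
  on the backward \<open>S\<close>-orbit of \<open>x\<close>. The restriction \<open>m < n\<close>
  makes \<open>N - 2 * n\<close> a common lower bound for the number of fresh points.\<close>

lemma card_bad_walks:
  assumes C: "is_conjugacy_class N C" and S: "S permutes {1..N}" and x: "x \<in> {1..N}" and n: "n > 0"
  shows "card (bad_walks C S n x) * (N - 2 * n) \<le> n * n * card {s \<in> C. s x \<noteq> x}"
proof -
  define H where "H m r = fresh_hit C S x m ((inv_into UNIV S ^^ r) x)" for m r
  have fin: "finite (H m r)" for m r
    unfolding H_def fresh_hit_def using class_finite[OF C] by simp
  have "card (bad_walks C S n x) \<le> card (\<Union>m<n. \<Union>r\<in>{1..n}. H m r)"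
    using bad_walks_subset[OF permutes_bij[OF S] n] fin unfolding H_def by (intro card_mono) auto
  also have "\<dots> \<le> (\<Sum>m<n. card (\<Union>r\<in>{1..n}. H m r))" by (rule card_UN_le) simp
  also have "\<dots> \<le> (\<Sum>m<n. \<Sum>r\<in>{1..n}. card (H m r))" by (intro sum_mono card_UN_le) simp
  finally have "card (bad_walks C S n x) * (N - 2 * n) \<le> (\<Sum>m<n. \<Sum>r\<in>{1..n}. card (H m r)) * (N - 2 * n)"
    by simp
  also have "\<dots> = (\<Sum>m<n. \<Sum>r\<in>{1..n}. card (H m r) * (N - 2 * n))" by (simp add: sum_distrib_right)
  also have "\<dots> \<le> (\<Sum>m<n. \<Sum>r\<in>{1..n}. card {s \<in> C. s x \<noteq> x})"
  proof (intro sum_mono)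
    fix m r assume "m \<in> {..<n}" "r \<in> {1..n}"
    have "(inv_into UNIV S ^^ r) x \<in> {1..N}"
      using x permutes_in_image[OF permutes_funpow[OF permutes_inv[OF S]]] by blast
    from card_fresh_hit[OF C this] have "card (H m r) * (N - 2 * Suc m) \<le> card {s \<in> C. s x \<noteq> x}"
      unfolding H_def .
    moreover have "card (H m r) * (N - 2 * n) \<le> card (H m r) * (N - 2 * Suc m)"
      using \<open>m \<in> {..<n}\<close> by (intro mult_le_mono2) auto
    ultimately show "card (H m r) * (N - 2 * n) \<le> card {s \<in> C. s x \<noteq> x}" by linarith
  qed
  finally show ?thesis by simp
qed

section \<open>Exclusive moments and the generator\<close>

text \<open>Relabelling positions, \<open>i\<close> to \<open>i \<circ> q\<close>, is a bijection.
  It is needed because splitting a tuple yields the pattern \<open>p \<circ> q^-1\<close>, whereas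
  the limiting system is written with the conjugate pattern \<open>q^-1 \<circ> p\<close>.\<close>

lemma card_pattern_tuples_conj:
  assumes q: "q permutes {1..k}" and p: "p permutes {1..k}"
  shows "card (pattern_tuples k (q \<circ> p \<circ> inv_into UNIV q) N f) = card (pattern_tuples k p N f)"
proof (rule bij_betw_same_card)
  note qin = permutes_in_image[OF q] permutes_in_image[OF permutes_inv[OF q]]
    and pin = permutes_in_image[OF p]
  note qq = permutes_inverses[OF q]
  show "bij_betw (\<lambda>i. restrict (i \<circ> q) {1..k}) (pattern_tuples k (q \<circ> p \<circ> inv_into UNIV q) N f) (pattern_tuples k p N f)"
  proof (rule bij_betwI[where g = "\<lambda>i. restrict (i \<circ> inv_into UNIV q) {1..k}"])
    show "(\<lambda>i. restrict (i \<circ> q) {1..k}) \<in> pattern_tuples k (q \<circ> p \<circ> inv_into UNIV q) N f \<rightarrow> pattern_tuples k p N f"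
    proof
      fix i assume i: "i \<in> pattern_tuples k (q \<circ> p \<circ> inv_into UNIV q) N f"
      have "f (i (q (p l))) = i (q l)" if "l \<in> {1..k}" for l
      proof -
        have "q l \<in> {1..k}" using that qin by blast
        then have "f (i ((q \<circ> p \<circ> inv_into UNIV q) (q l))) = i (q l)"
          using i unfolding pattern_tuples_def by blast
        then show ?thesis by (simp add: qq)
      qed
      moreover have "inj_on (restrict (i \<circ> q) {1..k}) {1..k}"
        using i comp_inj_on[OF permutes_inj_on[OF q, of "{1..k}"], of i] permutes_image[OF q]
        by (simp add: pattern_tuples_def)
      ultimately show "restrict (i \<circ> q) {1..k} \<in> pattern_tuples k p N f"
        using i qin pin unfolding pattern_tuples_def by (auto simp del: atLeastAtMost_iff)
    qed
    show "(\<lambda>i. restrict (i \<circ> inv_into UNIV q) {1..k}) \<in> pattern_tuples k p N f \<rightarrow> pattern_tuples k (q \<circ> p \<circ> inv_into UNIV q) N f"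
    proof
      fix i assume i: "i \<in> pattern_tuples k p N f"
      have "f (i (p (inv_into UNIV q l))) = i (inv_into UNIV q l)" if "l \<in> {1..k}" for l
        using i that qin unfolding pattern_tuples_def by blast
      moreover have "inj_on (restrict (i \<circ> inv_into UNIV q) {1..k}) {1..k}"
        using i comp_inj_on[OF permutes_inj_on[OF permutes_inv[OF q], of "{1..k}"], of i] permutes_image[OF permutes_inv[OF q]]
        by (simp add: pattern_tuples_def)
      ultimately show "restrict (i \<circ> inv_into UNIV q) {1..k} \<in> pattern_tuples k (q \<circ> p \<circ> inv_into UNIV q) N f"
        using i qin pin qq unfolding pattern_tuples_def by (auto simp del: atLeastAtMost_iff)
    qed
    show "restrict (restrict (i \<circ> q) {1..k} \<circ> inv_into UNIV q) {1..k} = i"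
      if "i \<in> pattern_tuples k (q \<circ> p \<circ> inv_into UNIV q) N f" for i
    proof
      fix l show "restrict (restrict (i \<circ> q) {1..k} \<circ> inv_into UNIV q) {1..k} l = i l"
        using that qin(2)[of l] qq unfolding pattern_tuples_def
        by (cases "l \<in> {1..k}") (auto simp del: atLeastAtMost_iff)
    qed
    show "restrict (restrict (i \<circ> inv_into UNIV q) {1..k} \<circ> q) {1..k} = i"
      if "i \<in> pattern_tuples k p N f" for i
    proof
      fix l show "restrict (restrict (i \<circ> inv_into UNIV q) {1..k} \<circ> q) {1..k} l = i l"
        using that qin(1)[of l] qq unfolding pattern_tuples_def
        by (cases "l \<in> {1..k}") (auto simp del: atLeastAtMost_iff)
    qed
  qed
qed

text \<open>Relabelling values by \<open>t\<close> conjugates the permutation being followed. The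
  relation between \<open>i\<close> and \<open>j\<close> is required only on \<open>{1..k}\<close>
  because both tuples are extensional, so \<open>j\<close> is not literally
  \<open>t \<circ> i\<close>.\<close>

lemma pattern_tuples_conj_iff:
  assumes t: "t permutes {1..N}" and ij: "\<And>l. l \<in> {1..k} \<Longrightarrow> j l = t (i l)" and p: "p permutes {1..k}"
    and "i \<in> extensional {1..k}" "j \<in> extensional {1..k}"
  shows "j \<in> pattern_tuples k p N (t \<circ> f \<circ> inv_into UNIV t) \<longleftrightarrow> i \<in> pattern_tuples k p N f"
proof -
  have "inj_on j {1..k} \<longleftrightarrow> inj_on (t \<circ> i) {1..k}" using ij by (intro inj_on_cong) auto
  also have "\<dots> \<longleftrightarrow> inj_on i {1..k}"
    by (simp add: inj_on_def inj_eq[OF permutes_inj[OF t]])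
  finally have 1: "inj_on j {1..k} \<longleftrightarrow> inj_on i {1..k}" .
  have 2: "(t \<circ> f \<circ> inv_into UNIV t) (j (p l)) = j l \<longleftrightarrow> f (i (p l)) = i l" if l: "l \<in> {1..k}" for l
  proof -
    have "p l \<in> {1..k}" using l permutes_in_image[OF p] by blast
    then show ?thesis using ij l by (simp add: permutes_inverses[OF t] inj_eq[OF permutes_inj[OF t]])
  qed
  have 3: "j l \<in> {1..N} \<longleftrightarrow> i l \<in> {1..N}" if "l \<in> {1..k}" for l
    using ij[OF that] permutes_in_image[OF t] by simp
  show ?thesis
    unfolding pattern_tuples_def PiE_iff mem_Collect_eq
    using assms(4,5) by (intro conj_cong ball_cong refl 1 2 3) auto
qed

text \<open>Relabelling values by a conjugating permutation. It makes the count a function of the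
  class, so the arbitrary choice in \<open>pattern_count\<close> is harmless.\<close>

lemma card_pattern_tuples_class:
  assumes C: "is_conjugacy_class N C" and p: "p permutes {1..k}" and s: "s \<in> C" "s' \<in> C"
  shows "card (pattern_tuples k p N s) = card (pattern_tuples k p N s')"
proof -
  obtain t where t: "t permutes {1..N}" "s' = t \<circ> s \<circ> inv_into UNIV t"
    using class_transitive[OF C s] by blast
  note tt = permutes_inverses[OF t(1)]
  have "bij_betw (\<lambda>i. restrict (t \<circ> i) {1..k}) (pattern_tuples k p N s) (pattern_tuples k p N s')"
  proof (rule bij_betwI[where g = "\<lambda>i. restrict (inv_into UNIV t \<circ> i) {1..k}"])
    show "(\<lambda>i. restrict (t \<circ> i) {1..k}) \<in> pattern_tuples k p N s \<rightarrow> pattern_tuples k p N s'"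
    proof
      fix i assume i: "i \<in> pattern_tuples k p N s"
      then have "i \<in> extensional {1..k}" by (simp add: pattern_tuples_def PiE_iff)
      then show "restrict (t \<circ> i) {1..k} \<in> pattern_tuples k p N s'"
        unfolding t(2) using i by - (rule iffD2[OF pattern_tuples_conj_iff[OF t(1) _ p, where i = i]], simp_all)
    qed
    show "(\<lambda>i. restrict (inv_into UNIV t \<circ> i) {1..k}) \<in> pattern_tuples k p N s' \<rightarrow> pattern_tuples k p N s"
    proof
      fix i assume i: "i \<in> pattern_tuples k p N s'"
      then have "i \<in> extensional {1..k}" by (simp add: pattern_tuples_def PiE_iff)
      then show "restrict (inv_into UNIV t \<circ> i) {1..k} \<in> pattern_tuples k p N s"
        using i[unfolded t(2)] by - (rule iffD1[OF pattern_tuples_conj_iff[OF t(1) _ p, where j = i]], simp_all add: tt)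
    qed
    show "restrict (inv_into UNIV t \<circ> restrict (t \<circ> i) {1..k}) {1..k} = i" if "i \<in> pattern_tuples k p N s" for i
    proof (rule extensionalityI[of _ "{1..k}"])
      show "i \<in> extensional {1..k}" using that by (simp add: pattern_tuples_def PiE_iff)
    qed (simp_all add: tt)
    show "restrict (t \<circ> restrict (inv_into UNIV t \<circ> i) {1..k}) {1..k} = i" if "i \<in> pattern_tuples k p N s'" for i
    proof (rule extensionalityI[of _ "{1..k}"])
      show "i \<in> extensional {1..k}" using that by (simp add: pattern_tuples_def PiE_iff)
    qed (simp_all add: tt)
  qed
  then show ?thesis by (rule bij_betw_same_card)
qed

section \<open>Averaging a pattern over a conjugacy class\<close>

definition inj_tuples :: "nat \<Rightarrow> nat \<Rightarrow> (nat \<Rightarrow> nat) set" where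
  "inj_tuples k N = {i \<in> {1..k} \<rightarrow>\<^sub>E {1..N}. inj_on i {1..k}}"

lemma card_inj_tuples: "card (inj_tuples k N) = (\<Prod>j<k. N - j)"
  unfolding inj_tuples_def using card_inj_on_subset_funcset[of "{1..k}" "{1..N}" "{1..k}"]
  by (simp add: atLeast0LessThan)

lemma finite_inj_tuples: "finite (inj_tuples k N)"
  unfolding inj_tuples_def by (rule finite_subset[of _ "{1..k} \<rightarrow>\<^sub>E {1..N}"]) (auto intro: finite_PiE)

text \<open>The partial map from the values of \<open>i\<close> to those of \<open>j\<close> extends
  to a permutation because the complements of the two ranges in \<open>{1..N}\<close> have equal
  size.\<close>

lemma inj_tuples_transitive:
  assumes i: "i \<in> inj_tuples k N" and j: "j \<in> inj_tuples k N"
  obtains t where "t permutes {1..N}" "\<And>l. l \<in> {1..k} \<Longrightarrow> j l = t (i l)"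
proof -
  let ?K = "{1..k}"
  have sub: "i ` ?K \<subseteq> {1..N}" "j ` ?K \<subseteq> {1..N}" using i j by (auto simp: inj_tuples_def)
  have inj: "inj_on i ?K" "inj_on j ?K" using i j by (auto simp: inj_tuples_def)
  have "card ({1..N} - i ` ?K) = card ({1..N} - j ` ?K)"
    using sub inj by (simp add: card_Diff_subset card_image)
  then obtain h where h: "bij_betw h ({1..N} - i ` ?K) ({1..N} - j ` ?K)"
    using finite_same_card_bij[of "{1..N} - i ` ?K" "{1..N} - j ` ?K"] by blast
  define t where "t x = (if x \<in> i ` ?K then j (inv_into ?K i x) else if x \<in> {1..N} then h x else x)" for x
  have ti: "t (i l) = j l" if "l \<in> ?K" for l using that inj by (auto simp: t_def)
  have "bij_betw t (i ` ?K) (j ` ?K)"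
  proof (rule bij_betw_imageI)
    show "inj_on t (i ` ?K)" by (auto intro!: inj_onI simp: ti inj_on_eq_iff[OF inj(2)])
    show "t ` i ` ?K = j ` ?K" unfolding image_image by (intro image_cong refl ti)
  qed
  moreover have "bij_betw t ({1..N} - i ` ?K) ({1..N} - j ` ?K)"
    using h by (subst bij_betw_cong[of _ t h]) (auto simp: t_def)
  ultimately have "bij_betw t (i ` ?K \<union> ({1..N} - i ` ?K)) (j ` ?K \<union> ({1..N} - j ` ?K))"
    by (rule bij_betw_combine) auto
  moreover have "i ` ?K \<union> ({1..N} - i ` ?K) = {1..N}" "j ` ?K \<union> ({1..N} - j ` ?K) = {1..N}"
    using sub by auto
  ultimately have "bij_betw t {1..N} {1..N}" by metis
  moreover have "t x = x" if "x \<notin> {1..N}" for x using that sub(1) by (auto simp: t_def)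
  ultimately have "t permutes {1..N}" by (rule bij_imp_permutes)
  then show ?thesis using that ti by metis
qed

text \<open>Conjugation preserves the class and acts transitively on injective tuples, so the number of
  elements of the class that follow the pattern on a given tuple does not depend on the tuple.\<close>

lemma card_class_pattern:
  assumes C: "is_conjugacy_class N C" and p: "p permutes {1..k}" and s: "s \<in> C"
    and i: "i \<in> inj_tuples k N"
  shows "card {s \<in> C. i \<in> pattern_tuples k p N s} * card (inj_tuples k N) = card C * card (pattern_tuples k p N s)"
proof -
  have le: "card {s \<in> C. i \<in> pattern_tuples k p N s} \<le> card {s \<in> C. j \<in> pattern_tuples k p N s}"
    if i: "i \<in> inj_tuples k N" and j: "j \<in> inj_tuples k N" for i j
  proof -
    obtain t where t: "t permutes {1..N}" "\<And>l. l \<in> {1..k} \<Longrightarrow> j l = t (i l)"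
      using inj_tuples_transitive[OF i j] by blast
    show ?thesis
    proof (rule card_inj_on_le)
      show "inj_on (\<lambda>s. t \<circ> s \<circ> inv_into UNIV t) {s \<in> C. i \<in> pattern_tuples k p N s}"
      proof (rule inj_onI)
        fix s s' assume "t \<circ> s \<circ> inv_into UNIV t = t \<circ> s' \<circ> inv_into UNIV t"
        then have "t (s (inv_into UNIV t (t x))) = t (s' (inv_into UNIV t (t x)))" for x by (metis comp_apply)
        then show "s = s'" by (simp add: fun_eq_iff permutes_inverses[OF t(1)] inj_eq[OF permutes_inj[OF t(1)]])
      qed
      show "(\<lambda>s. t \<circ> s \<circ> inv_into UNIV t) ` {s \<in> C. i \<in> pattern_tuples k p N s} \<subseteq> {s \<in> C. j \<in> pattern_tuples k p N s}"
        using class_conj[OF C _ t(1)] pattern_tuples_conj_iff[OF t(1) t(2) p] i j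
        by (auto simp: inj_tuples_def PiE_iff)
    qed (simp add: class_finite[OF C])
  qed
  have eq: "card {s \<in> C. j \<in> pattern_tuples k p N s} = card {s \<in> C. i \<in> pattern_tuples k p N s}"
    if "j \<in> inj_tuples k N" for j
    using le[OF that i] le[OF i that] by simp
  have "card {s \<in> C. i \<in> pattern_tuples k p N s} * card (inj_tuples k N) =
    (\<Sum>j\<in>inj_tuples k N. card {s \<in> C. j \<in> pattern_tuples k p N s})"
    by (simp add: eq)
  also have "\<dots> = (\<Sum>s\<in>C. card {j \<in> inj_tuples k N. j \<in> pattern_tuples k p N s})"
    using sum_multicount_gen[OF class_finite[OF C] finite_inj_tuples[of k N], of "\<lambda>s j. j \<in> pattern_tuples k p N s"
      "\<lambda>j. card {s \<in> C. j \<in> pattern_tuples k p N s}"] by simp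
  also have "\<dots> = (\<Sum>s'\<in>C. card (pattern_tuples k p N s))"
  proof (intro sum.cong refl)
    fix s' assume "s' \<in> C"
    have "{j \<in> inj_tuples k N. j \<in> pattern_tuples k p N s'} = pattern_tuples k p N s'"
      by (auto simp: inj_tuples_def pattern_tuples_def)
    then show "card {j \<in> inj_tuples k N. j \<in> pattern_tuples k p N s'} = card (pattern_tuples k p N s)"
      using card_pattern_tuples_class[OF C p \<open>s' \<in> C\<close> s] by simp
  qed
  finally show ?thesis by simp
qed

section \<open>Decomposition of the tuples of a product \<open>s \<circ> S\<close>\<close>

definition bad_tuples :: "nat \<Rightarrow> (nat \<Rightarrow> nat) \<Rightarrow> nat \<Rightarrow> (nat \<Rightarrow> nat) \<Rightarrow> (nat \<Rightarrow> nat) \<Rightarrow> (nat \<Rightarrow> nat) set" where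
  "bad_tuples k p N S s = {i \<in> pattern_tuples k p N (s \<circ> S). \<exists>l\<in>{1..k}. S (i (p l)) \<notin> i ` {1..k}}"

text \<open>The tuple relation says that \<open>s\<close> sends \<open>S (i (p l))\<close> to
  \<open>i l\<close>, which is \<open>i (p l')\<close> with \<open>l' = p^-1 l\<close>. The walk
  therefore runs through the values \<open>S (i (p l'))\<close> backwards along the cycle of
  \<open>l\<close> and is back after \<open>n\<close> rounds, while \<open>s\<close> only ever hits
  values of \<open>i\<close>, and the starting point is not one of them.\<close>

lemma bad_tuple_walk:
  assumes S: "S permutes {1..N}" and p: "p permutes {1..k}" and n: "p ^^ n = id"
    and s: "s \<in> C" and i: "i \<in> pattern_tuples k p N (s \<circ> S)" and l: "l \<in> {1..k}"
    and bad: "S (i (p l)) \<notin> i ` {1..k}"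
  shows "s \<in> bad_walks C S n (S (i (p l)))"
proof -
  define q where "q = inv_into UNIV p"
  have q: "q permutes {1..k}" unfolding q_def by (rule permutes_inv[OF p])
  have pq: "p (q x) = x" for x unfolding q_def by (rule permutes_inverses(1)[OF p])
  have ql: "(q ^^ j) l \<in> {1..k}" for j
    using l permutes_in_image[OF permutes_funpow[OF q]] by blast
  have hit: "s (S (i (p l))) = i l" if "l \<in> {1..k}" for l using i that by (auto simp: pattern_tuples_def)
  have walk: "((S \<circ> s) ^^ j) (S (i (p l))) = S (i (p ((q ^^ j) l)))" for j
    by (induction j) (simp_all add: hit[OF ql] pq)
  have "(q ^^ n) l = l"
  proof -
    have "(p ^^ j) ((q ^^ j) l) = l" for j
    proof (induction j)
      case (Suc j)
      have "(p ^^ Suc j) ((q ^^ Suc j) l) = (p ^^ j) (p ((q ^^ Suc j) l))" by (simp only: funpow_Suc_right comp_apply)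
      then show ?case using Suc by (simp add: pq)
    qed simp
    from this[of n] show ?thesis unfolding n by simp
  qed
  then have "((S \<circ> s) ^^ n) (S (i (p l))) = S (i (p l))" using walk by simp
  moreover have "s (((S \<circ> s) ^^ j) (S (i (p l)))) \<noteq> S (i (p l))" for j
    using bad ql[of j] unfolding walk hit[OF ql] by (metis imageI)
  ultimately show ?thesis using s by (simp add: bad_walks_def)
qed

text \<open>A bad tuple has a coordinate in the preimage under \<open>S\<close> of the bad starting
  points of \<open>s\<close>, and confining one coordinate to that set costs a factor
  \<open>N\<close>. Exchanging the sums over \<open>s\<close> and over starting points reduces the
  total to the count of bad walks, and double counting then supplies
  \<open>class_moved N C\<close>.\<close>

lemma card_bad_tuples:
  assumes C: "is_conjugacy_class N C" and S: "S permutes {1..N}" and p: "p permutes {1..k}"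
    and n: "p ^^ n = id" "n > 0"
  shows "(\<Sum>s\<in>C. card (bad_tuples k p N S s)) * (N - 2 * n)
    \<le> k * n * n * card C * class_moved N C * N ^ (num_cycles k p - 1)"
proof -
  define X where "X s = {x \<in> {1..N}. s \<in> bad_walks C S n x}" for s
  define Y where "Y s = inv_into UNIV S ` X s" for s
  have finX: "finite (X s)" for s by (simp add: X_def)
  have cardY: "card (Y s) = card (X s)" for s
    unfolding Y_def by (intro card_image permutes_inj_on[OF permutes_inv[OF S]])
  have "card (bad_tuples k p N S s) \<le> k * (card (X s) * N ^ (num_cycles k p - 1))" if s: "s \<in> C" for s
  proof -
    have inj: "inj (s \<circ> S)" by (intro inj_compose permutes_inj[OF S] permutes_inj[OF class_permutes[OF C s]])
    let ?T = "\<lambda>l. {i \<in> pattern_tuples k p N (s \<circ> S). i l \<in> Y s}"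
    have "bad_tuples k p N S s \<subseteq> (\<Union>l\<in>{1..k}. ?T l)"
    proof
      fix i assume i: "i \<in> bad_tuples k p N S s"
      then obtain l where l: "l \<in> {1..k}" "S (i (p l)) \<notin> i ` {1..k}" and i': "i \<in> pattern_tuples k p N (s \<circ> S)"
        unfolding bad_tuples_def by blast
      have pl: "p l \<in> {1..k}" using l permutes_in_image[OF p] by blast
      then have "i (p l) \<in> {1..N}" using i' unfolding pattern_tuples_def by blast
      then have "S (i (p l)) \<in> X s"
        unfolding X_def using bad_tuple_walk[OF S p n(1) s i' l] permutes_in_image[OF S] by blast
      then have "i (p l) \<in> Y s" unfolding Y_def using permutes_inverses(2)[OF S] by (metis imageI)
      then show "i \<in> (\<Union>l\<in>{1..k}. ?T l)" using i' pl by blast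
    qed
    then have "card (bad_tuples k p N S s) \<le> card (\<Union>l\<in>{1..k}. ?T l)"
      by (intro card_mono) (auto simp: finite_pattern_tuples)
    also have "\<dots> \<le> (\<Sum>l\<in>{1..k}. card (?T l))" by (rule card_UN_le) simp
    also have "\<dots> \<le> (\<Sum>l\<in>{1..k}. card (Y s) * N ^ (num_cycles k p - 1))"
      using finX by (intro sum_mono card_pattern_tuples_at[OF p inj]) (auto simp: Y_def)
    finally show ?thesis by (simp add: cardY)
  qed
  then have "(\<Sum>s\<in>C. card (bad_tuples k p N S s)) \<le> (\<Sum>s\<in>C. k * (card (X s) * N ^ (num_cycles k p - 1)))"
    by (rule sum_mono)
  also have "\<dots> = k * N ^ (num_cycles k p - 1) * (\<Sum>s\<in>C. card (X s))"
    unfolding sum_distrib_left by (intro sum.cong refl) (simp only: mult_ac)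
  also have "(\<Sum>s\<in>C. card (X s)) = (\<Sum>x\<in>{1..N}. card (bad_walks C S n x))"
  proof -
    have "{s \<in> C. s \<in> bad_walks C S n x} = bad_walks C S n x" for x by (auto simp: bad_walks_def)
    then show ?thesis
      unfolding X_def using sum_multicount_gen[of "{1..N}" C "\<lambda>x s. s \<in> bad_walks C S n x" "\<lambda>s. card (X s)"]
        class_finite[OF C] by (simp add: X_def)
  qed
  finally have "(\<Sum>s\<in>C. card (bad_tuples k p N S s)) * (N - 2 * n) \<le>
     k * N ^ (num_cycles k p - 1) * (\<Sum>x\<in>{1..N}. card (bad_walks C S n x)) * (N - 2 * n)" by simp
  also have "\<dots> = k * N ^ (num_cycles k p - 1) * (\<Sum>x\<in>{1..N}. card (bad_walks C S n x) * (N - 2 * n))"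
    by (simp add: sum_distrib_right mult.assoc)
  also have "\<dots> \<le> k * N ^ (num_cycles k p - 1) * (\<Sum>x\<in>{1..N}. n * n * card {s \<in> C. s x \<noteq> x})"
    by (intro mult_le_mono2 sum_mono card_bad_walks[OF C S _ n(2)])
  also have "\<dots> = k * N ^ (num_cycles k p - 1) * (n * n * (card C * class_moved N C))"
    using sum_class_moved[OF C] by (simp only: sum_distrib_left[symmetric])
  finally show ?thesis by (simp add: mult_ac)
qed

lemma full_tuples_split:
  assumes S: "S permutes {1..N}" and p: "p permutes {1..k}"
  shows "pattern_tuples k p N (s \<circ> S) - bad_tuples k p N S s =
    (\<Union>q\<in>{q. q permutes {1..k}}. pattern_tuples k (p \<circ> inv_into UNIV q) N S \<inter> pattern_tuples k q N s)"
    (is "?L = ?R")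
proof (intro Set.equalityI subsetI)
  let ?K = "{1..k}"
  note pin = permutes_in_image[OF p]
  fix i assume i: "i \<in> ?L"
  then have full: "S (i (p l)) \<in> i ` ?K" if "l \<in> ?K" for l using that unfolding bad_tuples_def by blast
  have inj: "inj_on i ?K" and iPi: "i \<in> ?K \<rightarrow>\<^sub>E {1..N}" and si: "\<And>l. l \<in> ?K \<Longrightarrow> s (S (i (p l))) = i l"
    using i unfolding pattern_tuples_def by auto
  \<comment> \<open>The map \<open>l\<close> to \<open>S (i (p l))\<close>, read as a map of
    positions through the injective tuple \<open>i\<close>. It is injective because
    \<open>S\<close>, \<open>i\<close> and \<open>p\<close> are, hence a permutation of the finite
    set of positions.\<close>
  define q where "q l = (if l \<in> ?K then inv_into ?K i (S (i (p l))) else l)" for l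
  have q_in: "q l \<in> ?K" and iq: "i (q l) = S (i (p l))" if "l \<in> ?K" for l
    using full[OF that] that by (simp_all add: q_def inv_into_into f_inv_into_f del: atLeastAtMost_iff)
  have "inj_on q ?K"
  proof (rule inj_onI)
    fix l l' assume l: "l \<in> ?K" "l' \<in> ?K" "q l = q l'"
    then have "S (i (p l)) = S (i (p l'))" using iq by metis
    then have "i (p l) = i (p l')" using permutes_inj[OF S] by (simp add: inj_eq)
    then have "p l = p l'" using inj_onD[OF inj] l pin by blast
    then show "l = l'" using permutes_inj[OF p] by (simp add: inj_eq)
  qed
  moreover have "q ` ?K \<subseteq> ?K" using q_in by blast
  ultimately have "bij_betw q ?K ?K" by (simp add: bij_betw_def endo_inj_surj)
  moreover have "q x = x" if "x \<notin> ?K" for x using that by (simp add: q_def del: atLeastAtMost_iff)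
  ultimately have q: "q permutes ?K" by (rule bij_imp_permutes)
  have "s (i (q l)) = i l" if "l \<in> ?K" for l using iq[OF that] si[OF that] by simp
  moreover have "S (i ((p \<circ> inv_into UNIV q) l)) = i l" if "l \<in> ?K" for l
  proof -
    have "inv_into UNIV q l \<in> ?K" using that permutes_in_image[OF permutes_inv[OF q]] by blast
    then show ?thesis using iq[of "inv_into UNIV q l"] by (simp add: permutes_inverses(1)[OF q])
  qed
  ultimately have "i \<in> pattern_tuples k (p \<circ> inv_into UNIV q) N S \<inter> pattern_tuples k q N s"
    using inj iPi unfolding pattern_tuples_def by blast
  then show "i \<in> ?R" using q by blast
next
  let ?K = "{1..k}"
  fix i assume "i \<in> ?R"
  then obtain q where q: "q permutes ?K" and i: "i \<in> pattern_tuples k (p \<circ> inv_into UNIV q) N S" "i \<in> pattern_tuples k q N s"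
    by blast
  have ql: "q l \<in> ?K" if "l \<in> ?K" for l using that permutes_in_image[OF q] by blast
  have iq: "S (i (p l)) = i (q l)" if "l \<in> ?K" for l
  proof -
    have "S (i ((p \<circ> inv_into UNIV q) (q l))) = i (q l)" using ql[OF that] i(1) unfolding pattern_tuples_def by blast
    then show ?thesis by (simp add: permutes_inverses(2)[OF q])
  qed
  have "s (S (i (p l))) = i l" if "l \<in> ?K" for l using iq[OF that] i(2) that by (simp add: pattern_tuples_def)
  then have "i \<in> pattern_tuples k p N (s \<circ> S)" using i(2) by (simp add: pattern_tuples_def)
  moreover have "S (i (p l)) \<in> i ` ?K" if "l \<in> ?K" for l using iq[OF that] ql[OF that] by (metis imageI)
  ultimately show "i \<in> ?L" unfolding bad_tuples_def by blast
qed

text \<open>Membership forces \<open>i (q l) = S (i (p l))\<close>, and injectivity of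
  \<open>i\<close> then recovers \<open>q\<close> from \<open>i\<close>, \<open>S\<close> and
  \<open>p\<close>.\<close>

lemma full_tuples_disjoint:
  assumes q: "q permutes {1..k}" "q' permutes {1..k}"
    and i: "i \<in> pattern_tuples k (p \<circ> inv_into UNIV q) N S" "i \<in> pattern_tuples k (p \<circ> inv_into UNIV q') N S"
  shows "q = q'"
proof
  let ?K = "{1..k}"
  have iq: "S (i (p l)) = i (q l)" "q l \<in> ?K" if "l \<in> ?K" "q permutes ?K" "i \<in> pattern_tuples k (p \<circ> inv_into UNIV q) N S" for l q
  proof -
    show ql: "q l \<in> ?K" using that permutes_in_image[OF that(2)] by blast
    have "S (i ((p \<circ> inv_into UNIV q) (q l))) = i (q l)" using ql that(3) unfolding pattern_tuples_def by blast
    then show "S (i (p l)) = i (q l)" by (simp add: permutes_inverses(2)[OF that(2)])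
  qed
  fix l
  show "q l = q' l"
  proof (cases "l \<in> ?K")
    case True
    then have "i (q l) = i (q' l)" using iq(1)[OF True q(1) i(1)] iq(1)[OF True q(2) i(2)] by simp
    moreover have "inj_on i ?K" using i unfolding pattern_tuples_def by blast
    ultimately show ?thesis using iq(2)[OF True q(1) i(1)] iq(2)[OF True q(2) i(2)] by (meson inj_onD)
  next
    case False
    then show ?thesis using q by (simp add: permutes_not_in)
  qed
qed

definition pattern_count :: "nat \<Rightarrow> (nat \<Rightarrow> nat) set \<Rightarrow> nat \<Rightarrow> (nat \<Rightarrow> nat) \<Rightarrow> nat" where
  "pattern_count N C k q = card (pattern_tuples k q N (SOME s. s \<in> C))"

text \<open>For fixed \<open>q\<close>, the sums over \<open>s\<close> and over tuples following
  \<open>p \<circ> q^-1\<close> in \<open>S\<close> are exchanged. The number of \<open>s\<close>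
  that follow \<open>q\<close> on such a tuple is the same for all injective tuples, so the count
  for \<open>S\<close> factors out. The condition \<open>k \<le> N\<close> keeps
  \<open>card (inj_tuples k N)\<close> nonzero.\<close>

lemma sum_class_pattern_tuples:
  assumes C: "is_conjugacy_class N C" and S: "S permutes {1..N}" and p: "p permutes {1..k}" and N: "k \<le> N"
  shows "(\<Sum>s\<in>C. real (card (pattern_tuples k p N (s \<circ> S)))) =
     (\<Sum>s\<in>C. real (card (bad_tuples k p N S s))) +
     (\<Sum>q | q permutes {1..k}. real (card (pattern_tuples k (p \<circ> inv_into UNIV q) N S)) *
        (real (card C) * (real (pattern_count N C k q) / real (card (inj_tuples k N)))))"
proof -
  let ?Q = "{q. q permutes {1..k}}"
  let ?A = "\<lambda>q. pattern_tuples k (p \<circ> inv_into UNIV q) N S"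
  have finQ: "finite ?Q" by (rule finite_permutations) simp
  have s0: "(SOME s. s \<in> C) \<in> C" using class_nonempty[OF C] by (simp add: some_in_eq)
  have J: "card (inj_tuples k N) > 0" unfolding card_inj_tuples using N by (intro prod_pos) auto
  have 1: "card (pattern_tuples k p N (s \<circ> S)) =
      card (bad_tuples k p N S s) + (\<Sum>q\<in>?Q. card (?A q \<inter> pattern_tuples k q N s))" for s
  proof -
    have sub: "bad_tuples k p N S s \<subseteq> pattern_tuples k p N (s \<circ> S)" unfolding bad_tuples_def by blast
    have "card (pattern_tuples k p N (s \<circ> S)) =
      card (bad_tuples k p N S s) + card (pattern_tuples k p N (s \<circ> S) - bad_tuples k p N S s)"
      using card_Diff_subset[OF finite_subset[OF sub finite_pattern_tuples] sub]
        card_mono[OF finite_pattern_tuples sub] by simp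
    also have "card (pattern_tuples k p N (s \<circ> S) - bad_tuples k p N S s) =
        (\<Sum>q\<in>?Q. card (?A q \<inter> pattern_tuples k q N s))"
      unfolding full_tuples_split[OF S p] using finQ full_tuples_disjoint[of _ k _ _ p N S]
      by (intro card_UN_disjoint) (auto simp: finite_pattern_tuples)
    finally show ?thesis .
  qed
  have 2: "(\<Sum>s\<in>C. real (card (?A q \<inter> pattern_tuples k q N s))) =
      real (card (?A q)) * (real (card C) * (real (pattern_count N C k q) / real (card (inj_tuples k N))))"
    if q: "q \<in> ?Q" for q
  proof -
    have eq: "{i \<in> ?A q. i \<in> pattern_tuples k q N s} = ?A q \<inter> pattern_tuples k q N s" for s by blast
    have "(\<Sum>s\<in>C. card (?A q \<inter> pattern_tuples k q N s)) = (\<Sum>i\<in>?A q. card {s \<in> C. i \<in> pattern_tuples k q N s})"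
      unfolding eq[symmetric]
      by (rule sum_multicount_gen[OF class_finite[OF C] finite_pattern_tuples]) (intro ballI refl)
    then have "(\<Sum>s\<in>C. real (card (?A q \<inter> pattern_tuples k q N s))) =
      (\<Sum>i\<in>?A q. real (card {s \<in> C. i \<in> pattern_tuples k q N s}))" by (simp only: of_nat_sum[symmetric])
    also have "\<dots> = (\<Sum>i\<in>?A q. real (card C) * (real (pattern_count N C k q) / real (card (inj_tuples k N))))"
    proof (intro sum.cong refl)
      fix i assume "i \<in> ?A q"
      then have "i \<in> inj_tuples k N" by (simp add: pattern_tuples_def inj_tuples_def)
      from card_class_pattern[OF C _ s0 this, of q]
      have "card {s \<in> C. i \<in> pattern_tuples k q N s} * card (inj_tuples k N) = card C * pattern_count N C k q"
        using q unfolding pattern_count_def by blast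
      then have "real (card {s \<in> C. i \<in> pattern_tuples k q N s}) * real (card (inj_tuples k N)) =
          real (card C) * real (pattern_count N C k q)" by (metis of_nat_mult)
      then show "real (card {s \<in> C. i \<in> pattern_tuples k q N s}) =
          real (card C) * (real (pattern_count N C k q) / real (card (inj_tuples k N)))"
        using J by (simp add: field_simps)
    qed
    finally show ?thesis by simp
  qed
  have "(\<Sum>s\<in>C. real (card (pattern_tuples k p N (s \<circ> S)))) =
     (\<Sum>s\<in>C. real (card (bad_tuples k p N S s))) + (\<Sum>s\<in>C. \<Sum>q\<in>?Q. real (card (?A q \<inter> pattern_tuples k q N s)))"
    unfolding 1 by (simp add: sum.distrib)
  also have "(\<Sum>s\<in>C. \<Sum>q\<in>?Q. real (card (?A q \<inter> pattern_tuples k q N s))) =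
     (\<Sum>q\<in>?Q. \<Sum>s\<in>C. real (card (?A q \<inter> pattern_tuples k q N s)))" by (rule sum.swap)
  also have "\<dots> = (\<Sum>q\<in>?Q. real (card (?A q)) * (real (card C) * (real (pattern_count N C k q) / real (card (inj_tuples k N)))))"
    by (intro sum.cong refl 2)
  finally show ?thesis .
qed

text \<open>The first factor is the rate, the quotient by \<open>card (inj_tuples k N)\<close> is
  the probability that a class element follows \<open>q\<close> on a given tuple, and the powers of
  \<open>N\<close> convert the normalisation for \<open>q^-1 \<circ> p\<close> into that for
  \<open>p\<close>. The term at \<open>q = id\<close> comes from subtracting the current value in
  the generator.\<close>

definition gen_coeff :: "nat \<Rightarrow> (nat \<Rightarrow> nat) set \<Rightarrow> nat \<Rightarrow> (nat \<Rightarrow> nat) \<Rightarrow> (nat \<Rightarrow> nat) \<Rightarrow> real" where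
  "gen_coeff N C k p q = real N / real (class_moved N C) *
     (real (pattern_count N C k q) / real (card (inj_tuples k N)) *
        (real N ^ num_cycles k (inv_into UNIV q \<circ> p) / real N ^ num_cycles k p) - (if q = id then 1 else 0))"

lemma card_pattern_tuples_quotient:
  assumes p: "p permutes {1..k}" and q: "q permutes {1..k}" and N: "N > 0"
  shows "real (card (pattern_tuples k (p \<circ> inv_into UNIV q) N S)) =
    real N ^ num_cycles k (inv_into UNIV q \<circ> p) * exclusive_moment k (inv_into UNIV q \<circ> p) N S"
proof -
  have r: "inv_into UNIV q \<circ> p permutes {1..k}" by (intro permutes_compose permutes_inv p q)
  have "q \<circ> (inv_into UNIV q \<circ> p) \<circ> inv_into UNIV q = p \<circ> inv_into UNIV q"
    by (simp add: comp_assoc[symmetric] permutes_inv_o(1)[OF q])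
  then have "card (pattern_tuples k (p \<circ> inv_into UNIV q) N S) = card (pattern_tuples k (inv_into UNIV q \<circ> p) N S)"
    using card_pattern_tuples_conj[OF q r] by metis
  then show ?thesis using N by (simp add: exclusive_moment_eq)
qed

text \<open>The difference is exactly the nonnegative contribution of the bad tuples. In its bound
  \<open>card C\<close> and \<open>class_moved N C\<close> cancel against the prefactors, and the
  lost cycle factor cancels the \<open>N\<close> in the rate, which leaves a bound independent of
  \<open>S\<close> and of the class.\<close>

lemma walk_generator_exclusive_moment:
  assumes C: "is_conjugacy_class N C" and S: "S permutes {1..N}" and p: "p permutes {1..k}"
    and k: "1 \<le> k" "k \<le> N" and n: "p ^^ n = id" "n > 0" "2 * n < N" and ne: "C \<noteq> {id}"
  shows "\<bar>walk_generator N C (exclusive_moment k p N) S -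
      (\<Sum>q | q permutes {1..k}. gen_coeff N C k p q * exclusive_moment k (inv_into UNIV q \<circ> p) N S)\<bar>
    \<le> real (k * n * n) / real (N - 2 * n)"
proof -
  let ?Q = "{q. q permutes {1..k}}"
  let ?m = "real (class_moved N C)" and ?c = "real (card C)" and ?Np = "real N ^ num_cycles k p"
  let ?e = "\<lambda>q. exclusive_moment k (inv_into UNIV q \<circ> p) N S"
  let ?w = "\<lambda>q. real (pattern_count N C k q) / real (card (inj_tuples k N))"
  let ?B = "\<Sum>s\<in>C. real (card (bad_tuples k p N S s))"
  have finQ: "finite ?Q" by (rule finite_permutations) simp
  have N: "N > 0" using k by simp
  have m: "?m > 0" using class_moved_pos[OF C ne] by simp
  have c: "?c > 0" using class_card_pos[OF C] by simp
  have nc: "num_cycles k p > 0" unfolding num_cycles_def using k by (simp add: card_gt_0_iff)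
  have id: "inv_into UNIV id \<circ> p = p" by (simp add: inv_id fun_eq_iff)
  have "(\<Sum>s\<in>C. exclusive_moment k p N (s \<circ> S)) = (\<Sum>s\<in>C. real (card (pattern_tuples k p N (s \<circ> S)))) / ?Np"
    by (simp add: exclusive_moment_eq sum_divide_distrib)
  also have "\<dots> = ?B / ?Np + (\<Sum>q\<in>?Q. ?c * (?w q * (real N ^ num_cycles k (inv_into UNIV q \<circ> p) / ?Np) * ?e q))"
    unfolding sum_class_pattern_tuples[OF C S p k(2)] add_divide_distrib sum_divide_distrib
    by (intro arg_cong2[where f = "(+)"] refl sum.cong)
       (simp add: card_pattern_tuples_quotient[OF p _ N])
  finally have 1: "(\<Sum>s\<in>C. exclusive_moment k p N (s \<circ> S)) =
      ?B / ?Np + ?c * (\<Sum>q\<in>?Q. ?w q * (real N ^ num_cycles k (inv_into UNIV q \<circ> p) / ?Np) * ?e q)"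
    by (simp add: sum_distrib_left)
  have 2: "(\<Sum>q\<in>?Q. (if q = id then 1 else 0) * ?e q) = exclusive_moment k p N S"
  proof -
    have "(\<Sum>q\<in>?Q. (if q = id then 1 else 0) * ?e q) = (\<Sum>q\<in>?Q. if q = id then ?e q else 0)"
      by (intro sum.cong) auto
    also have "\<dots> = ?e id" using finQ permutes_id by (subst sum.delta) auto
    finally show ?thesis by (simp add: id)
  qed
  have "walk_generator N C (exclusive_moment k p N) S =
      real N / ?m * (1 / ?c) * ((\<Sum>s\<in>C. exclusive_moment k p N (s \<circ> S)) - ?c * exclusive_moment k p N S)"
    unfolding walk_generator_def by (simp add: sum_subtractf)
  also have "\<dots> = real N / ?m * (1 / ?c) * (?B / ?Np) + real N / ?m *
      ((\<Sum>q\<in>?Q. ?w q * (real N ^ num_cycles k (inv_into UNIV q \<circ> p) / ?Np) * ?e q) - (\<Sum>q\<in>?Q. (if q = id then 1 else 0) * ?e q))"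
    unfolding 1 2
  proof -
    have "a * (1 / ?c) * ((X + ?c * Y) - ?c * e) = a * (1 / ?c) * X + a * (Y - e)" for a X Y e :: real
      using c by (simp add: field_simps)
    then show "real N / ?m * (1 / ?c) * ((?B / ?Np + ?c * Y) - ?c * e) =
        real N / ?m * (1 / ?c) * (?B / ?Np) + real N / ?m * (Y - e)" for Y e .
  qed
  also have "\<dots> = real N / ?m * (1 / ?c) * (?B / ?Np) + (\<Sum>q\<in>?Q. gen_coeff N C k p q * ?e q)"
    unfolding gen_coeff_def sum_subtractf[symmetric] sum_distrib_left
    by (intro arg_cong2[where f = "(+)"] refl sum.cong) (simp_all add: algebra_simps)
  finally have eq: "walk_generator N C (exclusive_moment k p N) S - (\<Sum>q\<in>?Q. gen_coeff N C k p q * ?e q) =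
      real N / ?m * (1 / ?c) * (?B / ?Np)" by simp
  have "real ((\<Sum>s\<in>C. card (bad_tuples k p N S s)) * (N - 2 * n)) \<le> real (k * n * n * card C * class_moved N C * N ^ (num_cycles k p - 1))"
    using card_bad_tuples[OF C S p n(1,2)] by (rule of_nat_mono)
  then have "?B * real (N - 2 * n) \<le> real (k * n * n) * ?c * ?m * real N ^ (num_cycles k p - 1)" by simp
  then have "?B * real (N - 2 * n) * real N \<le> real (k * n * n) * ?c * ?m * real N ^ (num_cycles k p - 1) * real N"
    by (intro mult_right_mono) auto
  also have "\<dots> = real (k * n * n) * ?c * ?m * ?Np" using nc by (simp add: power_eq_if)
  finally have "?B * real (N - 2 * n) * real N \<le> real (k * n * n) * ?c * ?m * ?Np" .
  then have "real N / ?m * (1 / ?c) * (?B / ?Np) \<le> real (k * n * n) / real (N - 2 * n)"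
    using N m c n(3) by (simp add: field_simps del: of_nat_mult)
  moreover have "0 \<le> real N / ?m * (1 / ?c) * (?B / ?Np)"
    using m c by (intro mult_nonneg_nonneg divide_nonneg_nonneg sum_nonneg) auto
  ultimately show ?thesis unfolding eq by (simp only: abs_of_nonneg)
qed

section \<open>Limits of the coefficients\<close>

lemma least_power_funpow:
  assumes "permutation p"
  shows "least_power p ((p ^^ m) x) = least_power p x"
proof (induction m)
  case (Suc m)
  have b: "bij p" using assms by (rule permutation_bijective)
  have "p \<circ> p \<circ> inv_into UNIV p = p" using b by (simp add: comp_assoc bij_is_surj surj_iff[THEN iffD1])
  then have "least_power p (p y) = least_power p y" for y using least_power_conj[OF b, of p y] by simp
  then show ?case using Suc by simp
qed simp

lemma orbit_funpow:
  assumes "permutation p" "x \<in> orbit p r"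
  obtains m where "x = (p ^^ m) r"
  using assms by (auto simp: orbit_altdef)

lemma least_power_orbit:
  assumes "permutation p" "x \<in> orbit p r"
  shows "least_power p x = least_power p r"
  using orbit_funpow[OF assms] least_power_funpow[OF assms(1)] by metis

lemma card_orbit:
  assumes "permutation p"
  shows "card (orbit p r) = least_power p r"
proof -
  have "orbit p r = set (support p r)"
    unfolding support_set[OF assms] orbit_altdef_permutation[OF assms] by blast
  then show ?thesis using distinct_card[OF cycle_of_permutation[OF assms, of r]] by simp
qed

lemma funpow_inverse:
  assumes "bij s"
  shows "(inv_into UNIV s ^^ n) ((s ^^ n) x) = x" "(s ^^ n) ((inv_into UNIV s ^^ n) x) = x"
proof (induction n arbitrary: x)
  case (Suc n)
  { case 1 show ?case using Suc(1)[of "s x"] Suc(1) assms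
    by (simp add: funpow_swap1 bij_is_inj) }
  { case 2 show ?case using Suc(2) assms
    by (simp add: funpow_swap1 bij_is_surj surj_f_inv_f) }
qed simp_all

text \<open>Two exponents agree at \<open>r\<close> under \<open>q\<close> exactly when they are
  congruent modulo the period, and \<open>x\<close> has the same period under \<open>s\<close>. The
  inverse of \<open>s\<close> occurs because \<open>s (i (q l)) = i l\<close> makes a step forward
  along \<open>q\<close> a step backward along \<open>s\<close>.\<close>

lemma funpow_inverse_transfer:
  assumes q: "permutation q" and s: "permutation s"
    and eq: "(q ^^ a) r = (q ^^ b) r" and x: "least_power s x = least_power q r"
  shows "(inv_into UNIV s ^^ a) x = (inv_into UNIV s ^^ b) x"
proof -
  have *: "(inv_into UNIV s ^^ a) x = (inv_into UNIV s ^^ b) x" if ab: "a \<le> b" and eq: "(q ^^ a) r = (q ^^ b) r" for a b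
  proof -
    have "(q ^^ b) r = (q ^^ a) ((q ^^ (b - a)) r)" using ab funpow_add[of a "b - a" q] by simp
    then have "(q ^^ (b - a)) r = r" using eq inj_fn[OF bij_is_inj[OF permutation_bijective[OF q]], of a] by (metis injD)
    then have "(s ^^ (b - a)) x = x" using x by (simp add: least_power_dvd[OF q, symmetric] least_power_dvd[OF s, symmetric])
    then have "(inv_into UNIV s ^^ (b - a)) x = x" using funpow_inverse(1)[OF permutation_bijective[OF s], of "b - a" x] by simp
    then show ?thesis using ab funpow_add[of a "b - a" "inv_into UNIV s"] by simp
  qed
  show ?thesis
  proof (cases "a \<le> b")
    case True
    then show ?thesis using eq by (rule *)
  next
    case False
    then show ?thesis by (intro *[symmetric] eq[symmetric]) simp
  qed
qed

text \<open>Injectivity of the tuple is replaced by equality of periods. This weaker condition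
  decouples the cycles, so the count becomes an exact product over them.\<close>

definition periodic_tuples :: "nat \<Rightarrow> (nat \<Rightarrow> nat) \<Rightarrow> nat \<Rightarrow> (nat \<Rightarrow> nat) \<Rightarrow> (nat \<Rightarrow> nat) set" where
  "periodic_tuples k q N s = {i \<in> {1..k} \<rightarrow>\<^sub>E {1..N}.
     \<forall>l\<in>{1..k}. s (i (q l)) = i l \<and> least_power s (i l) = least_power q l}"

lemma finite_periodic_tuples: "finite (periodic_tuples k q N s)"
  unfolding periodic_tuples_def by (rule finite_subset[of _ "{1..k} \<rightarrow>\<^sub>E {1..N}"]) (auto intro: finite_PiE)

lemma tuple_funpow:
  assumes q: "q permutes {1..k}" and i: "\<forall>l\<in>{1..k}. s (i (q l)) = i l" and l: "l \<in> {1..k}"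
  shows "(s ^^ m) (i ((q ^^ m) l)) = i l"
proof (induction m)
  case (Suc m)
  have "(q ^^ m) l \<in> {1..k}" using permutes_in_image[OF permutes_funpow[OF q]] l by blast
  then have "s (i (q ((q ^^ m) l))) = i ((q ^^ m) l)" using i by blast
  then have "(s ^^ Suc m) (i ((q ^^ Suc m) l)) = (s ^^ m) (i ((q ^^ m) l))"
    by (simp only: funpow_Suc_right comp_apply funpow.simps) (simp add: funpow_swap1)
  then show ?case using Suc by simp
qed simp

text \<open>For an injective tuple, a power of \<open>s\<close> fixes \<open>i l\<close> exactly
  when the same power of \<open>q\<close> fixes \<open>l\<close>, so the two periods agree.\<close>

lemma pattern_tuples_subset_periodic:
  assumes q: "q permutes {1..k}" and s: "s permutes {1..N}"
  shows "pattern_tuples k q N s \<subseteq> periodic_tuples k q N s"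
proof
  fix i assume i: "i \<in> pattern_tuples k q N s"
  then have step: "\<forall>l\<in>{1..k}. s (i (q l)) = i l" and inj: "inj_on i {1..k}" by (auto simp: pattern_tuples_def)
  have "least_power s (i l) = least_power q l" if l: "l \<in> {1..k}" for l
  proof -
    have "(s ^^ m) (i l) = i l \<longleftrightarrow> (q ^^ m) l = l" for m
    proof -
      have ql: "(q ^^ m) l \<in> {1..k}" using permutes_in_image[OF permutes_funpow[OF q]] l by blast
      have inj_m: "inj (s ^^ m)" by (rule inj_fn[OF permutes_inj[OF s]])
      have "(s ^^ m) (i l) = i l \<longleftrightarrow> i l = i ((q ^^ m) l)"
        using tuple_funpow[OF q step l, of m] inj_eq[OF inj_m, of "i l" "i ((q ^^ m) l)"] by simp
      also have "\<dots> \<longleftrightarrow> l = (q ^^ m) l" by (rule inj_on_eq_iff[OF inj l ql])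
      finally show ?thesis by (simp only: eq_commute[of l])
    qed
    then show ?thesis unfolding least_power_def by simp
  qed
  then show "i \<in> periodic_tuples k q N s" using i unfolding pattern_tuples_def periodic_tuples_def by blast
qed

text \<open>One value of the right period may be chosen freely on each cycle. The upper bound is the
  determination of a tuple by its values on \<open>R\<close>; the lower bound spreads chosen values
  along the cycles, consistently because the periods match.\<close>

lemma card_periodic_tuples:
  assumes q: "q permutes {1..k}" and s: "s permutes {1..N}" and R: "transversal k q R"
  shows "card (periodic_tuples k q N s) = (\<Prod>r\<in>R. period_count N s (least_power q r))"
proof (rule antisym)
  define Y where "Y r = {x \<in> {1..N}. least_power s x = least_power q r}" for r
  note RD = transversalD[OF R]
  have cardY: "period_count N s (least_power q r) = card (Y r)" for r
    by (simp add: Y_def period_count_def)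
  show "card (periodic_tuples k q N s) \<le> (\<Prod>r\<in>R. period_count N s (least_power q r))"
    unfolding cardY
  proof (rule card_tuples_le_prod[OF q permutes_inj[OF s]])
    fix i assume i: "i \<in> periodic_tuples k q N s"
    have "\<forall>r\<in>R. i r \<in> Y r"
    proof
      fix r assume "r \<in> R"
      then have r: "r \<in> {1..k}" using RD(1) by blast
      then have "i r \<in> {1..N}" using i unfolding periodic_tuples_def by blast
      then show "i r \<in> Y r" using i r unfolding periodic_tuples_def Y_def by blast
    qed
    then show "i \<in> extensional {1..k} \<and> (\<forall>l\<in>{1..k}. s (i (q l)) = i l) \<and> (\<forall>r\<in>R. i r \<in> Y r)"
      using i by (auto simp: periodic_tuples_def PiE_iff)
    fix j assume "\<forall>r\<in>R. i r = j r"
    then show "\<exists>R'\<subseteq>{1..k}. {1..k} \<subseteq> (\<Union>r\<in>R'. orbit q r) \<and> (\<forall>r\<in>R'. i r = j r)"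
      using RD(1) transversal_cover[OF q R] by (intro exI[of _ R]) blast
  qed (use RD in \<open>auto simp: Y_def\<close>)
  note Q = permutation_if_permutes[OF q] and P = permutation_if_permutes[OF s]
  define rep where "rep l = (SOME r. r \<in> R \<and> l \<in> orbit q r)" for l
  define idx where "idx l = (SOME m. (q ^^ m) (rep l) = l)" for l
  define T where "T = inv_into UNIV s"
  \<comment> \<open>The exponent \<open>idx l\<close> is an arbitrary one leading from the
    representative to \<open>l\<close>. A different exponent would give the same value, by the
    transfer of congruences modulo the period.\<close>
  define F where "F x = (\<lambda>l\<in>{1..k}. (T ^^ idx l) (x (rep l)))" for x :: "nat \<Rightarrow> nat"
  have rep: "rep l \<in> R" "l \<in> orbit q (rep l)" if "l \<in> {1..k}" for l
  proof -
    have "\<exists>r. r \<in> R \<and> l \<in> orbit q r" using transversal_cover[OF q R that] by blast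
    from someI_ex[OF this] show "rep l \<in> R" "l \<in> orbit q (rep l)" unfolding rep_def by auto
  qed
  have idx: "(q ^^ idx l) (rep l) = l" if l: "l \<in> {1..k}" for l
  proof -
    obtain m where "l = (q ^^ m) (rep l)" using orbit_funpow[OF Q rep(2)[OF l]] by blast
    then show ?thesis unfolding idx_def using someI[of "\<lambda>m. (q ^^ m) (rep l) = l" m] by simp
  qed
  have rep_eq: "rep l = r" if "l \<in> {1..k}" "r \<in> R" "l \<in> orbit q r" for l r
  proof -
    have "orbit q (rep l) = orbit q r"
      using orbit_eq_if_mem[OF Q rep(2)[OF that(1)]] orbit_eq_if_mem[OF Q that(3)] by simp
    then show ?thesis using R rep(1)[OF that(1)] that(2) unfolding transversal_def by (meson inj_onD)
  qed
  have sT: "s (T y) = y" for y unfolding T_def by (rule permutes_inverses(1)[OF s])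
  have lpT: "least_power s ((T ^^ m) y) = least_power s y" for m y
  proof -
    have "(s ^^ m) ((T ^^ m) y) = y" unfolding T_def by (rule funpow_inverse(2)[OF permutes_bij[OF s]])
    then show ?thesis using least_power_funpow[OF P, of m "(T ^^ m) y"] by simp
  qed
  have T_in: "(T ^^ m) y \<in> {1..N}" if "y \<in> {1..N}" for m y
    using permutes_in_image[OF permutes_funpow[OF permutes_inv[OF s]]] that unfolding T_def by blast
  have F_in: "F x \<in> periodic_tuples k q N s" if x: "x \<in> PiE R Y" for x
  proof -
    have xr: "x r \<in> {1..N}" "least_power s (x r) = least_power q r" if "r \<in> R" for r
      using x that by (auto simp: Y_def PiE_iff)
    have "s (F x (q l)) = F x l \<and> least_power s (F x l) = least_power q l \<and> F x l \<in> {1..N}" if l: "l \<in> {1..k}" for l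
    proof -
      have ql: "q l \<in> {1..k}" using permutes_in_image[OF q] l by blast
      have "q l \<in> orbit q (rep l)" using rep(2)[OF l] by (rule orbit.step)
      then have rq: "rep (q l) = rep l" using rep_eq[OF ql rep(1)[OF l]] by simp
      have "(q ^^ idx (q l)) (rep l) = (q ^^ Suc (idx l)) (rep l)" using idx[OF ql] idx[OF l] rq by simp
      then have "(T ^^ idx (q l)) (x (rep l)) = (T ^^ Suc (idx l)) (x (rep l))"
        unfolding T_def by (rule funpow_inverse_transfer[OF Q P _ xr(2)[OF rep(1)[OF l]]])
      then have 1: "s (F x (q l)) = F x l" using l ql rq sT by (simp add: F_def)
      have "least_power s (F x l) = least_power q (rep l)"
        using l xr(2)[OF rep(1)[OF l]] lpT by (simp add: F_def)
      then have 2: "least_power s (F x l) = least_power q l" using least_power_orbit[OF Q rep(2)[OF l]] by simp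
      have "F x l \<in> {1..N}" using l T_in[OF xr(1)[OF rep(1)[OF l]]] by (simp add: F_def)
      then show ?thesis using 1 2 by simp
    qed
    then show ?thesis unfolding periodic_tuples_def by (auto simp: PiE_iff F_def)
  qed
  have F_at: "F x r = x r" if x: "x \<in> PiE R Y" and r: "r \<in> R" for x r
  proof -
    have rk: "r \<in> {1..k}" using RD(1) r by blast
    have rr: "rep r = r" by (rule rep_eq[OF rk r permutation_self_in_orbit[OF Q]])
    have "(q ^^ idx r) r = (q ^^ 0) r" using idx[OF rk] rr by simp
    moreover have "least_power s (x r) = least_power q r" using x r by (auto simp: Y_def PiE_iff)
    ultimately have "(T ^^ idx r) (x r) = (T ^^ 0) (x r)"
      unfolding T_def by (rule funpow_inverse_transfer[OF Q P])
    then show ?thesis using rk rr by (simp add: F_def)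
  qed
  have "inj_on F (PiE R Y)"
  proof (rule inj_onI)
    fix x y assume *: "x \<in> PiE R Y" "y \<in> PiE R Y" "F x = F y"
    then have "x r = y r" if "r \<in> R" for r using F_at that by metis
    then show "x = y" using *(1,2) by (intro PiE_ext) auto
  qed
  then have "card (PiE R Y) \<le> card (periodic_tuples k q N s)"
    using F_in finite_periodic_tuples by (intro card_inj_on_le) auto
  then show "(\<Prod>r\<in>R. period_count N s (least_power q r)) \<le> card (periodic_tuples k q N s)"
    unfolding cardY card_PiE[OF RD(2)] .
qed

text \<open>Within a single cycle, equality of periods already forces distinct values. A repetition
  must therefore occur between two different cycles.\<close>

lemma periodic_not_pattern:
  assumes q: "q permutes {1..k}" and s: "s permutes {1..N}"
    and i: "i \<in> periodic_tuples k q N s" "i \<notin> pattern_tuples k q N s"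
  obtains l l' where "l \<in> {1..k}" "l' \<in> {1..k}" "orbit q l \<noteq> orbit q l'" "i l = i l'"
proof -
  note Q = permutation_if_permutes[OF q] and P = permutation_if_permutes[OF s]
  have step: "\<forall>l\<in>{1..k}. s (i (q l)) = i l" and lp: "\<And>l. l \<in> {1..k} \<Longrightarrow> least_power s (i l) = least_power q l"
    using i(1) unfolding periodic_tuples_def by blast+
  have "\<not> inj_on i {1..k}" using i unfolding periodic_tuples_def pattern_tuples_def by blast
  then obtain l l' where l: "l \<in> {1..k}" "l' \<in> {1..k}" "i l = i l'" "l \<noteq> l'" unfolding inj_on_def by blast
  have "orbit q l \<noteq> orbit q l'"
  proof
    assume "orbit q l = orbit q l'"
    then have "l' \<in> orbit q l" using permutation_self_in_orbit[OF Q, of l'] by simp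
    then obtain m where m: "l' = (q ^^ m) l" using orbit_funpow[OF Q] by blast
    have "(s ^^ m) (i l) = i l" using tuple_funpow[OF q step l(1), of m] l(3) m by simp
    then have "(q ^^ m) l = l" using lp[OF l(1)] by (simp add: least_power_dvd[OF Q, symmetric] least_power_dvd[OF P, symmetric])
    then show False using l(4) m by simp
  qed
  then show ?thesis using that l by blast
qed

lemma period_count_le: "period_count N s n \<le> N"
proof -
  have "card {j \<in> {1..N}. least_power s j = n} \<le> card {1..N}" by (rule card_mono) auto
  then show ?thesis by (simp add: period_count_def)
qed

text \<open>The coincidence determines the cycle of \<open>l'\<close> from that of \<open>l\<close>,
  which removes one factor \<open>N\<close>. A nontrivial cycle among the remaining ones gives
  \<open>M\<close> in place of a second factor. If there is none, the cycle of \<open>l\<close> is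
  trivial, and equality of the two values makes the cycle of \<open>l'\<close> trivial as well,
  against \<open>q \<noteq> id\<close>; then no collision exists.\<close>

lemma card_periodic_collision:
  assumes q: "q permutes {1..k}" and s: "s permutes {1..N}" and ne: "q \<noteq> id"
    and M: "\<And>n. n \<noteq> 1 \<Longrightarrow> period_count N s n \<le> M"
    and l: "l \<in> {1..k}" "l' \<in> {1..k}" "orbit q l \<noteq> orbit q l'"
  shows "card {i \<in> periodic_tuples k q N s. i l = i l'} * N ^ 2 \<le> M * N ^ num_cycles k q"
proof -
  note Q = permutation_if_permutes[OF q]
  let ?D = "{i \<in> periodic_tuples k q N s. i l = i l'}"
  obtain R where R: "transversal k q R" "l \<in> R" using transversal_exists[OF q l(1)] by blast
  note RD = transversalD[OF R(1)]
  obtain r' where r': "r' \<in> R" "l' \<in> orbit q r'" using transversal_cover[OF q R(1) l(2)] by blast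
  have r'_ne: "r' \<noteq> l" using orbit_eq_if_mem[OF Q r'(2)] l(3) by auto
  have lp: "least_power s (i x) = least_power q x" "i x \<in> {1..N}" if "x \<in> {1..k}" "i \<in> periodic_tuples k q N s" for i x
    using that unfolding periodic_tuples_def by blast+
  show ?thesis
  proof (cases "\<exists>r\<in>R - {r'}. least_power q r \<noteq> 1")
    case True
    then obtain r2 where r2: "r2 \<in> R" "r2 \<noteq> r'" "least_power q r2 \<noteq> 1" by blast
    have "card ?D \<le> (\<Prod>r\<in>R - {r'}. card {x \<in> {1..N}. least_power s x = least_power q r})"
    proof (rule card_tuples_le_prod[OF q permutes_inj[OF s]])
      show "finite (R - {r'})" "R - {r'} \<subseteq> {1..k}" using RD by auto
      show "finite {x \<in> {1..N}. least_power s x = least_power q r}" for r by simp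
      fix i assume i: "i \<in> ?D"
      have "\<forall>r\<in>R - {r'}. i r \<in> {x \<in> {1..N}. least_power s x = least_power q r}"
        using lp RD(1) i by blast
      then show "i \<in> extensional {1..k} \<and> (\<forall>l\<in>{1..k}. s (i (q l)) = i l) \<and>
         (\<forall>r\<in>R - {r'}. i r \<in> {x \<in> {1..N}. least_power s x = least_power q r})"
        using i unfolding periodic_tuples_def by (simp add: PiE_iff)
      fix j assume j: "j \<in> ?D" and eq: "\<forall>r\<in>R - {r'}. i r = j r"
      have "i l = j l" using eq R(2) r'_ne by blast
      then have "i l' = j l'" using i j by simp
      then have "\<forall>r\<in>insert l' (R - {r'}). i r = j r" using eq by blast
      \<comment> \<open>The omitted representative \<open>r'\<close> is replaced by
        \<open>l'\<close>, which lies on the same cycle and has a value forced by the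
        coincidence.\<close>
      moreover have "{1..k} \<subseteq> (\<Union>r\<in>insert l' (R - {r'}). orbit q r)"
      proof
        fix x assume "x \<in> {1..k}"
        then obtain r where "r \<in> R" "x \<in> orbit q r" using transversal_cover[OF q R(1)] by blast
        then show "x \<in> (\<Union>r\<in>insert l' (R - {r'}). orbit q r)"
          using orbit_eq_if_mem[OF Q r'(2)] by (cases "r = r'") auto
      qed
      moreover have "insert l' (R - {r'}) \<subseteq> {1..k}" using l(2) RD(1) by blast
      ultimately show "\<exists>R'\<subseteq>{1..k}. {1..k} \<subseteq> (\<Union>r\<in>R'. orbit q r) \<and> (\<forall>r\<in>R'. i r = j r)" by metis
    qed
    also have "\<dots> = (\<Prod>r\<in>R - {r'}. period_count N s (least_power q r))" by (simp add: period_count_def)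
    also have "\<dots> = period_count N s (least_power q r2) * (\<Prod>r\<in>R - {r'} - {r2}. period_count N s (least_power q r))"
      using r2 RD(2) by (intro prod.remove) auto
    also have "\<dots> \<le> M * (\<Prod>r\<in>R - {r'} - {r2}. N)"
    proof (intro mult_le_mono M r2(3) prod_mono conjI)
      fix r show "period_count N s (least_power q r) \<le> N"
        by (rule period_count_le)
    qed simp
    also have "\<dots> = M * N ^ (num_cycles k q - 2)"
      using RD(2,3) r'(1) r2(1,2) by (simp add: card_Diff_singleton diff_diff_left numeral_2_eq_2)
    finally have "card ?D * N ^ 2 \<le> M * N ^ (num_cycles k q - 2) * N ^ 2" by simp
    also have "\<dots> = M * N ^ (num_cycles k q - 2 + 2)" by (simp only: power_add mult.assoc)
    also have "num_cycles k q - 2 + 2 = num_cycles k q"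
      using card_mono[OF RD(2), of "{r', r2}"] r' r2 RD(3) by simp
    finally show ?thesis .
  next
    case False
    have "?D = {}"
    proof (rule ccontr)
      assume "?D \<noteq> {}"
      then obtain i where i: "i \<in> periodic_tuples k q N s" "i l = i l'" by blast
      have "least_power q l = 1" using False R(2) r'_ne by blast
      moreover have "least_power q l = least_power q l'" using lp(1)[OF l(1) i(1)] lp(1)[OF l(2) i(1)] i(2) by simp
      ultimately have "least_power q r' = 1" using least_power_orbit[OF Q r'(2)] by simp
      then have R1: "least_power q r = 1" if "r \<in> R" for r using that False by blast
      have "q x = x" for x
      proof (cases "x \<in> {1..k}")
        case True
        then obtain r where "r \<in> R" "x \<in> orbit q r" using transversal_cover[OF q R(1)] by blast
        then have "least_power q x = 1" using R1 least_power_orbit[OF Q] by simp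
        then show ?thesis using least_power_eq_1[OF Q] by blast
      next
        case False
        then show ?thesis by (rule permutes_not_in[OF q])
      qed
      then show False using ne by (auto simp: fun_eq_iff)
    qed
    then show ?thesis by (simp only: card.empty mult_0)
  qed
qed

text \<open>A union bound over the at most \<open>k * k\<close> pairs of positions where a collision
  can take place.\<close>

lemma card_pattern_tuples_approx:
  assumes q: "q permutes {1..k}" and s: "s permutes {1..N}" and ne: "q \<noteq> id"
    and M: "\<And>n. n \<noteq> 1 \<Longrightarrow> period_count N s n \<le> M"
  shows "(card (periodic_tuples k q N s) - card (pattern_tuples k q N s)) * N ^ 2 \<le> k * k * (M * N ^ num_cycles k q)"
proof -
  let ?P = "periodic_tuples k q N s" and ?A = "pattern_tuples k q N s"
  define I where "I = {(l, l') \<in> {1..k} \<times> {1..k}. orbit q l \<noteq> orbit q l'}"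
  define D where "D = (\<lambda>(l, l'). {i \<in> ?P. i l = i l'})"
  have I_sub: "I \<subseteq> {1..k} \<times> {1..k}" unfolding I_def by blast
  have finI: "finite I" by (rule finite_subset[OF I_sub]) simp
  have "card I \<le> card ({1..k} \<times> {1..k})" by (rule card_mono[OF _ I_sub]) simp
  then have cardI: "card I \<le> k * k" by (simp add: card_cartesian_product)
  have "?P - ?A \<subseteq> (\<Union>x\<in>I. D x)"
  proof
    fix i assume "i \<in> ?P - ?A"
    then have i: "i \<in> ?P" "i \<notin> ?A" by auto
    obtain l l' where "l \<in> {1..k}" "l' \<in> {1..k}" "orbit q l \<noteq> orbit q l'" "i l = i l'"
      by (rule periodic_not_pattern[OF q s i])
    then have "(l, l') \<in> I" "i \<in> D (l, l')" using i by (auto simp: I_def D_def)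
    then show "i \<in> (\<Union>x\<in>I. D x)" by blast
  qed
  then have "card (?P - ?A) \<le> card (\<Union>x\<in>I. D x)"
    using finI finite_periodic_tuples by (intro card_mono) (auto simp: D_def)
  also have "\<dots> \<le> (\<Sum>x\<in>I. card (D x))" by (rule card_UN_le[OF finI])
  finally have "card (?P - ?A) * N ^ 2 \<le> (\<Sum>x\<in>I. card (D x) * N ^ 2)" by (simp add: sum_distrib_right[symmetric])
  also have "\<dots> \<le> (\<Sum>x\<in>I. M * N ^ num_cycles k q)"
    using card_periodic_collision[OF q s ne M] by (intro sum_mono) (auto simp: I_def D_def)
  also have "\<dots> \<le> k * k * (M * N ^ num_cycles k q)" using cardI by simp
  finally show ?thesis
    using card_Diff_subset[OF finite_pattern_tuples pattern_tuples_subset_periodic[OF q s]] by simp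
qed

lemma period_count_transversal:
  assumes q: "q permutes {1..k}" and R: "transversal k q R"
  shows "period_count k q n = n * card {r \<in> R. least_power q r = n}"
proof -
  note Q = permutation_if_permutes[OF q]
  have "{j \<in> {1..k}. least_power q j = n} = (\<Union>r\<in>{r \<in> R. least_power q r = n}. orbit q r)" (is "?L = ?U")
  proof (intro Set.equalityI subsetI)
    fix j assume j: "j \<in> ?L"
    then have "j \<in> {1..k}" by blast
    then obtain r where "r \<in> R" "j \<in> orbit q r" using transversal_cover[OF q R] by blast
    then show "j \<in> ?U" using least_power_orbit[OF Q, of j r] j by auto
  next
    fix j assume "j \<in> ?U"
    then obtain r where r: "r \<in> R" "least_power q r = n" "j \<in> orbit q r" by blast
    then have "j \<in> {1..k}" using permutes_orbit_subset[OF q, of r] transversalD(1)[OF R] by blast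
    then show "j \<in> ?L" using least_power_orbit[OF Q r(3)] r(2) by simp
  qed
  moreover have "card ?U = (\<Sum>r\<in>{r \<in> R. least_power q r = n}. card (orbit q r))"
  proof (rule card_UN_disjoint)
    show "finite {r \<in> R. least_power q r = n}" using transversalD(2)[OF R] by simp
    show "\<forall>r\<in>{r \<in> R. least_power q r = n}. finite (orbit q r)"
      using finite_orbit[OF permutation_self_in_orbit[OF Q]] by blast
    have "orbit q r \<inter> orbit q r' = {}" if "r \<in> R" "r' \<in> R" "r \<noteq> r'" for r r'
    proof -
      have "orbit q r \<noteq> orbit q r'" using that R unfolding transversal_def by (meson inj_onD)
      then show ?thesis using orbit_eq_if_mem[OF Q] by blast
    qed
    then show "\<forall>r\<in>{r \<in> R. least_power q r = n}. \<forall>r'\<in>{r \<in> R. least_power q r = n}. r \<noteq> r' \<longrightarrow> orbit q r \<inter> orbit q r' = {}"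
      by blast
  qed
  moreover have "\<dots> = (\<Sum>r\<in>{r \<in> R. least_power q r = n}. n)"
    by (intro sum.cong refl) (simp add: card_orbit[OF Q])
  ultimately show ?thesis unfolding period_count_def by simp
qed

text \<open>The number of points of period \<open>i\<close> divided by \<open>i\<close> is the
  number of cycles of length \<open>i\<close>, so the product over lengths becomes a product over
  cycles. In this form it can be matched factor by factor with a limit of class counts.\<close>

lemma jump_coeff_transversal:
  assumes q: "q permutes {1..k}" and R: "transversal k q R"
  defines "R2 \<equiv> {r \<in> R. least_power q r \<noteq> 1}" and "R1 \<equiv> {r \<in> R. least_power q r = 1}"
  shows "jump_coeff lam \<alpha> k q = \<alpha> ^ (card R2 - 1) * (\<Prod>r\<in>R2. lam (least_power q r)) * (1 - \<alpha>) ^ card R1"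
proof -
  note Q = permutation_if_permutes[OF q] and RD = transversalD[OF R]
  have pc1: "period_count k q 1 = card R1"
    unfolding R1_def period_count_transversal[OF q R] by simp
  have "R = R1 \<union> R2" "R1 \<inter> R2 = {}" "finite R1" "finite R2" using RD(2) unfolding R1_def R2_def by auto
  then have "num_cycles k q = card R1 + card R2" using RD(3) card_Un_disjoint by metis
  then have 1: "num_cycles k q - period_count k q 1 - 1 = card R2 - 1" using pc1 by simp
  have "least_power q r \<in> {2..k}" if "r \<in> R2" for r
  proof -
    have r: "r \<in> {1..k}" "least_power q r \<noteq> 1" using that RD(1) unfolding R2_def by auto
    have "least_power q r \<le> card {1..k}"
      using card_mono[OF _ permutes_orbit_subset[OF q r(1)]] card_orbit[OF Q] by simp
    then show ?thesis using least_power_of_permutation(2)[OF Q, of r] r(2) by simp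
  qed
  then have "(\<Prod>r\<in>R2. lam (least_power q r)) = (\<Prod>i\<in>{2..k}. \<Prod>r\<in>{r \<in> R2. least_power q r = i}. lam (least_power q r))"
    using \<open>finite R2\<close> by (intro prod.group[symmetric]) auto
  also have "\<dots> = (\<Prod>i=2..k. lam i ^ (period_count k q i div i))"
  proof (intro prod.cong refl)
    fix i assume i: "i \<in> {2..k}"
    have "{r \<in> R2. least_power q r = i} = {r \<in> R. least_power q r = i}" using i unfolding R2_def by auto
    then have "period_count k q i div i = card {r \<in> R2. least_power q r = i}"
      using period_count_transversal[OF q R, of i] i by simp
    then show "(\<Prod>r\<in>{r \<in> R2. least_power q r = i}. lam (least_power q r)) = lam i ^ (period_count k q i div i)" by simp
  qed
  finally show ?thesis unfolding jump_coeff_def 1 unfolding pc1 by simp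
qed

section \<open>Limits along a convergent sequence of classes\<close>

lemma inj_tuples_tendsto: "(\<lambda>N. real N ^ k / real (card (inj_tuples k N))) \<longlonglongrightarrow> 1"
proof -
  have "(\<lambda>N. \<Prod>j<k. real N / (real N - real j)) \<longlonglongrightarrow> (\<Prod>j<k. 1)"
  proof (intro tendsto_prod)
    fix j
    show "(\<lambda>N. real N / (real N - real j)) \<longlonglongrightarrow> 1" by real_asymp
  qed
  moreover have "eventually (\<lambda>N. (\<Prod>j<k. real N / (real N - real j)) = real N ^ k / real (card (inj_tuples k N))) sequentially"
    using eventually_ge_at_top[of k]
    by eventually_elim (auto simp: card_inj_tuples prod_dividef of_nat_diff intro!: arg_cong2[where f = "(/)"] prod.cong)
  ultimately have "(\<lambda>N. real N ^ k / real (card (inj_tuples k N))) \<longlonglongrightarrow> (\<Prod>j<k. 1)"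
    by (rule Lim_transform_eventually)
  then show ?thesis by simp
qed

lemma exclusive_moment_bounds:
  assumes "p permutes {1..k}" "S permutes {1..N}" "k \<ge> 1"
  shows "0 \<le> exclusive_moment k p N S" "exclusive_moment k p N S \<le> 1"
proof -
  show "0 \<le> exclusive_moment k p N S" by (simp add: exclusive_moment_eq)
  have "real (card (pattern_tuples k p N S)) \<le> real (N ^ num_cycles k p)"
    using card_pattern_tuples_le[OF assms(1) permutes_inj[OF assms(2)] assms(3)] by (rule of_nat_mono)
  then have le: "real (card (pattern_tuples k p N S)) \<le> real N ^ num_cycles k p" by simp
  show "exclusive_moment k p N S \<le> 1"
  proof (cases "real N ^ num_cycles k p = 0")
    \<comment> \<open>The denominator vanishes only for \<open>N = 0\<close>, where division by zero
      returns 0.\<close>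
    case True
    show ?thesis unfolding exclusive_moment_eq True by simp
  next
    case False
    then have "0 < real N ^ num_cycles k p" by (metis less_eq_real_def of_nat_0_le_iff zero_le_power)
    then show ?thesis unfolding exclusive_moment_eq using le by (simp only: divide_le_eq_1_pos)
  qed
qed

text \<open>The limiting system indexed like \<open>gen_coeff\<close>: all \<open>q\<close> occur,
  the diagonal term sits at \<open>q = id\<close>, and permutations not below \<open>p\<close> get
  coefficient 0.\<close>

definition limit_coeff :: "(nat \<Rightarrow> real) \<Rightarrow> real \<Rightarrow> nat \<Rightarrow> (nat \<Rightarrow> nat) \<Rightarrow> (nat \<Rightarrow> nat) \<Rightarrow> real" where
  "limit_coeff lam \<alpha> k p q = (if q = id then drift \<alpha> k else if perm_le k q p then jump_coeff lam \<alpha> k q else 0)"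

context
  fixes C :: "nat \<Rightarrow> (nat \<Rightarrow> nat) set" and lam :: "nat \<Rightarrow> real" and \<alpha> :: real
  assumes conj: "\<And>N. N \<ge> 2 \<Longrightarrow> is_conjugacy_class N (C N)"
    and nontrivial: "\<And>N. N \<ge> 2 \<Longrightarrow> C N \<noteq> {id}"
    and conv: "classes_converge C lam \<alpha>"
begin

lemma class_count_tendsto:
  "i \<ge> 2 \<Longrightarrow> (\<lambda>N. real (class_count N (C N) i) / real (class_moved N (C N))) \<longlonglongrightarrow> lam i"
  and class_fixed_tendsto: "(\<lambda>N. real (class_count N (C N) 1) / real N) \<longlonglongrightarrow> 1 - \<alpha>"
  using conv unfolding classes_converge_def by blast+

lemma class_fixed_count:
  assumes "N \<ge> 2"
  shows "real (class_count N (C N) 1) = real N - real (class_moved N (C N))"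
  using class_count_le[OF conj[OF assms], of 1] unfolding class_moved_def by simp

lemma class_moved_gt_0: "N \<ge> 2 \<Longrightarrow> class_moved N (C N) > 0"
  using class_moved_pos[OF conj nontrivial] by blast

lemma class_moved_tendsto: "(\<lambda>N. real (class_moved N (C N)) / real N) \<longlonglongrightarrow> \<alpha>"
proof -
  have "(\<lambda>N. 1 - real (class_count N (C N) 1) / real N) \<longlonglongrightarrow> 1 - (1 - \<alpha>)"
    by (intro tendsto_intros class_fixed_tendsto)
  moreover have "eventually (\<lambda>N. 1 - real (class_count N (C N) 1) / real N = real (class_moved N (C N)) / real N) sequentially"
    using eventually_ge_at_top[of 2] by eventually_elim (simp add: class_fixed_count diff_divide_distrib del: One_nat_def)
  ultimately have "(\<lambda>N. real (class_moved N (C N)) / real N) \<longlonglongrightarrow> 1 - (1 - \<alpha>)"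
    by (rule Lim_transform_eventually)
  then show ?thesis by simp
qed

text \<open>One nontrivial cycle \<open>r0\<close> absorbs the rate, turning
  \<open>count / N\<close> into \<open>count / class_moved\<close>. Every other nontrivial cycle is
  split as \<open>count / class_moved\<close> times \<open>class_moved / N\<close>, with limit
  \<open>lam\<close> times \<open>\<alpha>\<close>. This is where the exponent of
  \<open>\<alpha>\<close>, one less than the number of nontrivial cycles, comes from;
  \<open>\<alpha> = 0\<close> needs no separate treatment.\<close>

lemma prod_class_count_tendsto:
  assumes q: "q permutes {1..k}" and ne: "q \<noteq> id" and R: "transversal k q R"
  shows "(\<lambda>N. real N / real (class_moved N (C N)) *
      (\<Prod>r\<in>R. real (class_count N (C N) (least_power q r)) / real N)) \<longlonglongrightarrow> jump_coeff lam \<alpha> k q"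
proof -
  note Q = permutation_if_permutes[OF q] and RD = transversalD[OF R]
  let ?m = "\<lambda>N. real (class_moved N (C N))" and ?c = "\<lambda>N r. real (class_count N (C N) (least_power q r))"
  define R2 where "R2 = {r \<in> R. least_power q r \<noteq> 1}"
  define R1 where "R1 = {r \<in> R. least_power q r = 1}"
  have fin: "finite R1" "finite R2" using RD(2) unfolding R1_def R2_def by auto
  have R12: "R = R1 \<union> R2" "R1 \<inter> R2 = {}" unfolding R1_def R2_def by auto
  obtain x where x: "q x \<noteq> x" using ne by fastforce
  then have "x \<in> {1..k}" using q by (meson permutes_not_in)
  then obtain r0 where r0: "r0 \<in> R" "x \<in> orbit q r0" using transversal_cover[OF q R] by blast
  have "least_power q r0 \<noteq> 1" using least_power_orbit[OF Q r0(2)] least_power_eq_1[OF Q, of x] x by simp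
  then have r0R2: "r0 \<in> R2" using r0 unfolding R2_def by blast
  have ge2: "least_power q r \<ge> 2" if "r \<in> R2" for r
    using that least_power_of_permutation(2)[OF Q, of r] unfolding R2_def by simp
  have lim: "(\<lambda>N. (?c N r0 / ?m N) * (\<Prod>r\<in>R2 - {r0}. (?c N r / ?m N) * (?m N / real N)) *
      (\<Prod>r\<in>R1. real (class_count N (C N) 1) / real N))
    \<longlonglongrightarrow> lam (least_power q r0) * (\<Prod>r\<in>R2 - {r0}. lam (least_power q r) * \<alpha>) * (\<Prod>r\<in>R1. 1 - \<alpha>)"
    using ge2 r0R2 by (intro tendsto_intros class_count_tendsto class_moved_tendsto class_fixed_tendsto) auto
  have lim_eq: "lam (least_power q r0) * (\<Prod>r\<in>R2 - {r0}. lam (least_power q r) * \<alpha>) * (\<Prod>r\<in>R1. 1 - \<alpha>) = jump_coeff lam \<alpha> k q"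
  proof -
    have "(\<Prod>r\<in>R2. lam (least_power q r)) = lam (least_power q r0) * (\<Prod>r\<in>R2 - {r0}. lam (least_power q r))"
      using fin r0R2 by (intro prod.remove) auto
    moreover have "card (R2 - {r0}) = card R2 - 1" using fin r0R2 by simp
    ultimately show ?thesis
      unfolding jump_coeff_transversal[OF q R] R1_def[symmetric] R2_def[symmetric]
      by (simp add: prod.distrib mult_ac)
  qed
  have "eventually (\<lambda>N. (?c N r0 / ?m N) * (\<Prod>r\<in>R2 - {r0}. (?c N r / ?m N) * (?m N / real N)) *
      (\<Prod>r\<in>R1. real (class_count N (C N) 1) / real N) = real N / ?m N * (\<Prod>r\<in>R. ?c N r / real N)) sequentially"
    using eventually_ge_at_top[of 2]
  proof eventually_elim
    fix N :: nat assume N: "2 \<le> N"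
    have m: "?m N > 0" using class_moved_gt_0[OF N] by simp
    have "(\<Prod>r\<in>R. ?c N r / real N) = (\<Prod>r\<in>R1. ?c N r / real N) * (\<Prod>r\<in>R2. ?c N r / real N)"
      unfolding R12(1) using fin R12(2) by (rule prod.union_disjoint)
    moreover have "(\<Prod>r\<in>R2. ?c N r / real N) = ?c N r0 / real N * (\<Prod>r\<in>R2 - {r0}. ?c N r / real N)"
      using fin r0R2 by (intro prod.remove) auto
    moreover have "(\<Prod>r\<in>R1. ?c N r / real N) = (\<Prod>r\<in>R1. real (class_count N (C N) 1) / real N)"
      by (intro prod.cong) (auto simp: R1_def)
    moreover have "(\<Prod>r\<in>R2 - {r0}. (?c N r / ?m N) * (?m N / real N)) = (\<Prod>r\<in>R2 - {r0}. ?c N r / real N)"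
      using m by (intro prod.cong) auto
    ultimately show "(?c N r0 / ?m N) * (\<Prod>r\<in>R2 - {r0}. (?c N r / ?m N) * (?m N / real N)) *
      (\<Prod>r\<in>R1. real (class_count N (C N) 1) / real N) = real N / ?m N * (\<Prod>r\<in>R. ?c N r / real N)"
      using N m by simp
  qed
  then show ?thesis by (rule Lim_transform_eventually[OF lim[unfolded lim_eq]])
qed

text \<open>Pattern tuples may be replaced by periodic ones: after multiplication by the rate the
  difference is at most \<open>k * k / N\<close>, because the collision bound contains the factor
  \<open>class_moved\<close>.\<close>

lemma pattern_count_tendsto:
  assumes q: "q permutes {1..k}" and ne: "q \<noteq> id"
  shows "(\<lambda>N. real N / real (class_moved N (C N)) * (real (pattern_count N (C N) k q) / real N ^ num_cycles k q))
    \<longlonglongrightarrow> jump_coeff lam \<alpha> k q"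
proof -
  obtain x where "q x \<noteq> x" using ne by fastforce
  then have "x \<in> {1..k}" using q by (meson permutes_not_in)
  then obtain R where R: "transversal k q R" using transversal_exists[OF q] by blast
  note RD = transversalD[OF R]
  let ?m = "\<lambda>N. real (class_moved N (C N))"
  let ?a = "\<lambda>N. real N / ?m N * (\<Prod>r\<in>R. real (class_count N (C N) (least_power q r)) / real N)"
  let ?b = "\<lambda>N. real N / ?m N * (real (pattern_count N (C N) k q) / real N ^ num_cycles k q)"
  have bound: "norm (?a N - ?b N) \<le> real (k * k) * (1 / real N)" if N: "2 \<le> N" for N
  proof -
    define s where "s = (SOME s. s \<in> C N)"
    have sC: "s \<in> C N" unfolding s_def using class_nonempty[OF conj[OF N]] by (simp add: some_in_eq)
    have s: "s permutes {1..N}" by (rule class_permutes[OF conj[OF N] sC])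
    have M: "period_count N s n \<le> class_moved N (C N)" if "n \<noteq> 1" for n
      using class_count_le_moved[OF conj[OF N] that] class_count_eq[OF conj[OF N] sC] by simp
    let ?P = "card (periodic_tuples k q N s)" and ?A = "card (pattern_tuples k q N s)" and ?n = "num_cycles k q"
    have AP: "?A \<le> ?P" by (intro card_mono finite_periodic_tuples pattern_tuples_subset_periodic q s)
    have a: "?a N = real N / ?m N * (real ?P / real N ^ ?n)"
      using RD(3) by (simp add: card_periodic_tuples[OF q s R] prod_dividef class_count_eq[OF conj[OF N] sC])
    have "?a N - ?b N = real N / ?m N * ((real ?P - real ?A) / real N ^ ?n)"
      unfolding a pattern_count_def s_def[symmetric] by (simp add: algebra_simps diff_divide_distrib)
    moreover have "real ((?P - ?A) * N ^ 2) \<le> real (k * k * (class_moved N (C N) * N ^ ?n))"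
      using card_pattern_tuples_approx[OF q s ne M] by (rule of_nat_mono)
    then have "(real ?P - real ?A) * real N ^ 2 \<le> real (k * k) * (?m N * real N ^ ?n)" using AP by (simp add: of_nat_diff)
    then have "real N / ?m N * ((real ?P - real ?A) / real N ^ ?n) \<le> real (k * k) * (1 / real N)"
      using N class_moved_gt_0[OF N] by (simp add: field_simps power2_eq_square)
    moreover have "0 \<le> real N / ?m N * ((real ?P - real ?A) / real N ^ ?n)" using AP by simp
    ultimately show ?thesis by (simp only: real_norm_def abs_of_nonneg)
  qed
  have "(\<lambda>N. real (k * k) * (1 / real N)) \<longlonglongrightarrow> real (k * k) * 0"
    by (intro tendsto_intros lim_1_over_n)
  then have lim0: "(\<lambda>N. real (k * k) * (1 / real N)) \<longlonglongrightarrow> 0" by simp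
  have "eventually (\<lambda>N. norm (?a N - ?b N) \<le> real (k * k) * (1 / real N)) sequentially"
    by (rule eventually_sequentiallyI[of 2]) (rule bound)
  then have "(\<lambda>N. ?a N - ?b N) \<longlonglongrightarrow> 0" by (rule Lim_null_comparison[OF _ lim0])
  from tendsto_diff[OF prod_class_count_tendsto[OF q ne R] this] show ?thesis by simp
qed

text \<open>Following the identity pattern means having fixed points as values, so the count is a
  falling factorial of the number of fixed points.\<close>

lemma pattern_count_id:
  assumes N: "N \<ge> 2"
  shows "pattern_count N (C N) k id = (\<Prod>j<k. class_count N (C N) 1 - j)"
proof -
  define s where "s = (SOME s. s \<in> C N)"
  have sC: "s \<in> C N" unfolding s_def using class_nonempty[OF conj[OF N]] by (simp add: some_in_eq)
  have P: "permutation s" using class_permutes[OF conj[OF N] sC] by (rule permutation_if_permutes)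
  let ?F = "{x \<in> {1..N}. least_power s x = 1}"
  have "pattern_tuples k id N s = {i \<in> {1..k} \<rightarrow>\<^sub>E ?F. inj_on i {1..k}}"
    unfolding pattern_tuples_def least_power_eq_1[OF P] by (auto simp: PiE_iff)
  then have "card (pattern_tuples k id N s) = (\<Prod>j<k. card ?F - j)"
    using card_inj_on_subset_funcset[of "{1..k}" ?F "{1..k}"] by (simp add: atLeast0LessThan)
  moreover have "card ?F = class_count N (C N) 1"
    unfolding class_count_eq[OF conj[OF N] sC] period_count_def ..
  ultimately show ?thesis unfolding pattern_count_def s_def by simp
qed

text \<open>For \<open>\<alpha> = 0\<close> the product \<open>d k N\<close> tends to 1 while the
  rate diverges, so the limit of \<open>d k N\<close> alone says nothing. Peeling off one factor at
  a time turns the expression into a geometric sum \<open>- \<Sum> (1 - \<alpha>) ^ j\<close>, which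
  covers both branches of \<open>drift\<close> at once.\<close>

lemma id_coeff_tendsto:
  "(\<lambda>N. real N / real (class_moved N (C N)) *
     (real (pattern_count N (C N) k id) / real (card (inj_tuples k N)) - 1)) \<longlonglongrightarrow> drift \<alpha> k"
proof -
  let ?m = "\<lambda>N. real (class_moved N (C N))" and ?F = "\<lambda>N. real (class_count N (C N) 1)"
  define d where "d k N = (\<Prod>j<k. (?F N - real j) / (real N - real j))" for k N
  have sub_tendsto: "(\<lambda>N. (?F N - real j) / (real N - real j)) \<longlonglongrightarrow> 1 - \<alpha>" for j
  proof -
    have "(\<lambda>N. (?F N / real N) * (real N / (real N - real j)) - real j / (real N - real j)) \<longlonglongrightarrow> (1 - \<alpha>) * 1 - 0"
    proof (intro tendsto_intros class_fixed_tendsto)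
      show "(\<lambda>N. real N / (real N - real j)) \<longlonglongrightarrow> 1" by real_asymp
      show "(\<lambda>N. real j / (real N - real j)) \<longlonglongrightarrow> 0" by real_asymp
    qed
    moreover have "eventually (\<lambda>N. (?F N / real N) * (real N / (real N - real j)) - real j / (real N - real j) =
        (?F N - real j) / (real N - real j)) sequentially"
      using eventually_gt_at_top[of "max 0 j"] by eventually_elim (auto simp: diff_divide_distrib)
    ultimately have "(\<lambda>N. (?F N - real j) / (real N - real j)) \<longlonglongrightarrow> (1 - \<alpha>) * 1 - 0"
      by (rule Lim_transform_eventually)
    then show ?thesis by simp
  qed
  have d_tendsto: "d k \<longlonglongrightarrow> (1 - \<alpha>) ^ k" for k
    unfolding d_def using tendsto_prod[of "{..<k}" "\<lambda>j N. (?F N - real j) / (real N - real j)" "\<lambda>j. 1 - \<alpha>"] sub_tendsto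
    by simp
  have main: "(\<lambda>N. real N / ?m N * (d k N - 1)) \<longlonglongrightarrow> - (\<Sum>j<k. (1 - \<alpha>) ^ j)" for k
  proof (induction k)
    case 0
    show ?case by (simp add: d_def)
  next
    case (Suc k)
    have "(\<lambda>N. real N / ?m N * (d k N - 1) - d k N * (real N / (real N - real k))) \<longlonglongrightarrow> - (\<Sum>j<k. (1 - \<alpha>) ^ j) - (1 - \<alpha>) ^ k * 1"
    proof (intro tendsto_intros Suc d_tendsto)
      show "(\<lambda>N. real N / (real N - real k)) \<longlonglongrightarrow> 1" by real_asymp
    qed
    moreover have "eventually (\<lambda>N. real N / ?m N * (d k N - 1) - d k N * (real N / (real N - real k)) =
        real N / ?m N * (d (Suc k) N - 1)) sequentially"
      using eventually_gt_at_top[of "max 2 k"]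
    proof eventually_elim
      fix N assume N: "max 2 k < N"
      then have N2: "2 \<le> N" by simp
      have m: "?m N > 0" using class_moved_gt_0[OF N2] by simp
      \<comment> \<open>The new factor is \<open>(F - k) / (N - k)\<close>, where
        \<open>F = N - class_moved\<close> is the number of fixed points. Multiplied by the rate,
        its deviation from 1 becomes \<open>N / (N - k)\<close>, free of
        \<open>class_moved\<close>.\<close>
      have d: "d (Suc k) N = d k N * (1 - ?m N / (real N - real k))"
        unfolding d_def class_fixed_count[OF N2] using N by (simp add: field_simps)
      show "real N / ?m N * (d k N - 1) - d k N * (real N / (real N - real k)) = real N / ?m N * (d (Suc k) N - 1)"
        unfolding d using m N by (simp add: field_simps)
    qed
    ultimately have "(\<lambda>N. real N / ?m N * (d (Suc k) N - 1)) \<longlonglongrightarrow> - (\<Sum>j<k. (1 - \<alpha>) ^ j) - (1 - \<alpha>) ^ k * 1"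
      by (rule Lim_transform_eventually)
    then show ?case by simp
  qed
  have drift: "- (\<Sum>j<k. (1 - \<alpha>) ^ j) = drift \<alpha> k"
    unfolding drift_def using geometric_sum[of "1 - \<alpha>" k] by (auto simp: field_simps)
  have "eventually (\<lambda>N. real N / ?m N * (d k N - 1) =
      real N / ?m N * (real (pattern_count N (C N) k id) / real (card (inj_tuples k N)) - 1)) sequentially"
    using eventually_ge_at_top[of "max 2 k"]
  proof eventually_elim
    fix N assume N: "max 2 k \<le> N"
    have N2: "2 \<le> N" using N by simp
    \<comment> \<open>The number of fixed points can stay below \<open>k\<close>. Then both products
      contain a zero factor, so truncated and real subtraction still agree on the whole
      product.\<close>
    have fall: "real (\<Prod>j<k. n - j) = (\<Prod>j<k. real n - real j)" for n
    proof (cases "k \<le> n")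
      case True
      then show ?thesis by (auto simp: of_nat_diff intro!: prod.cong)
    next
      case False
      then have "n \<in> {..<k}" by simp
      then have "(\<Prod>j<k. n - j) = 0" "(\<Prod>j<k. real n - real j) = 0"
        by (intro prod_zero bexI[of _ n]; simp)+
      then show ?thesis by (simp only: of_nat_0)
    qed
    have "d k N = real (pattern_count N (C N) k id) / real (card (inj_tuples k N))"
      unfolding d_def card_inj_tuples pattern_count_id[OF N2] by (simp only: fall prod_dividef)
    then show "real N / ?m N * (d k N - 1) =
      real N / ?m N * (real (pattern_count N (C N) k id) / real (card (inj_tuples k N)) - 1)" by simp
  qed
  then show ?thesis by (rule Lim_transform_eventually[OF main[of k, unfolded drift]])
qed

text \<open>For \<open>q \<noteq> id\<close> the powers of \<open>N\<close> balance up to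
  \<open>(1 / N) ^ e\<close>, where \<open>e\<close> is the defect in the triangle inequality for
  cycle counts. It is zero exactly for \<open>q\<close> below \<open>p\<close>, so the limit of this
  power is the indicator of the order, by \<open>0 ^ 0 = 1\<close>.\<close>

lemma gen_coeff_tendsto:
  assumes p: "p permutes {1..k}" and q: "q permutes {1..k}"
  shows "(\<lambda>N. gen_coeff N (C N) k p q) \<longlonglongrightarrow> limit_coeff lam \<alpha> k p q"
proof (cases "q = id")
  case True
  have *: "inv_into UNIV id \<circ> p = p" by (simp add: inv_id fun_eq_iff)
  have "eventually (\<lambda>N. real N / real (class_moved N (C N)) *
     (real (pattern_count N (C N) k id) / real (card (inj_tuples k N)) - 1) = gen_coeff N (C N) k p q) sequentially"
    using eventually_gt_at_top[of 0] unfolding gen_coeff_def True * by eventually_elim simp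
  then have "(\<lambda>N. gen_coeff N (C N) k p q) \<longlonglongrightarrow> drift \<alpha> k"
    by (rule Lim_transform_eventually[OF id_coeff_tendsto])
  then show ?thesis by (simp add: limit_coeff_def True)
next
  case False
  let ?n = "num_cycles k q + num_cycles k (inv_into UNIV q \<circ> p)"
  define e where "e = k + num_cycles k p - ?n"
  have le: "?n \<le> k + num_cycles k p" by (rule num_cycles_quotient(1)[OF q p])
  have "(\<lambda>N. (1 / real N) ^ e) \<longlonglongrightarrow> 0 ^ e" by (intro tendsto_intros lim_1_over_n)
  moreover have "0 ^ e = (if perm_le k q p then 1 else 0 :: real)"
    unfolding num_cycles_quotient(2)[OF q p] e_def using le by (auto simp: power_0_left)
  ultimately have pw: "(\<lambda>N. (1 / real N) ^ e) \<longlonglongrightarrow> (if perm_le k q p then 1 else 0)" by simp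
  have "(\<lambda>N. real N / real (class_moved N (C N)) * (real (pattern_count N (C N) k q) / real N ^ num_cycles k q) *
      (real N ^ k / real (card (inj_tuples k N))) * (1 / real N) ^ e)
    \<longlonglongrightarrow> jump_coeff lam \<alpha> k q * 1 * (if perm_le k q p then 1 else 0)"
    by (intro tendsto_mult[OF tendsto_mult] pattern_count_tendsto inj_tuples_tendsto pw q False)
  moreover have "eventually (\<lambda>N. real N / real (class_moved N (C N)) * (real (pattern_count N (C N) k q) / real N ^ num_cycles k q) *
      (real N ^ k / real (card (inj_tuples k N))) * (1 / real N) ^ e = gen_coeff N (C N) k p q) sequentially"
    using eventually_gt_at_top[of 0]
  proof eventually_elim
    fix N :: nat assume N: "0 < N"
    have "real N ^ e * (real N ^ num_cycles k q * real N ^ num_cycles k (inv_into UNIV q \<circ> p)) = real N ^ k * real N ^ num_cycles k p"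
      unfolding power_add[symmetric] using le by (simp add: e_def)
    then have "real N ^ k / (real N ^ num_cycles k q * real N ^ e) = real N ^ num_cycles k (inv_into UNIV q \<circ> p) / real N ^ num_cycles k p"
      using N by (simp add: field_simps)
    note frac = this
    have "W * (P / A) * (B / J) * (1 / X) = W * (P / J * (B / (A * X)))" for W P A B J X :: real
      by (simp add: mult_ac)
    from this[of "real N / real (class_moved N (C N))" "real (pattern_count N (C N) k q)" "real N ^ num_cycles k q"
      "real N ^ k" "real (card (inj_tuples k N))" "real N ^ e"]
    show "real N / real (class_moved N (C N)) * (real (pattern_count N (C N) k q) / real N ^ num_cycles k q) *
      (real N ^ k / real (card (inj_tuples k N))) * (1 / real N) ^ e = gen_coeff N (C N) k p q"
      unfolding gen_coeff_def power_one_over frac by (simp only: False if_False diff_0_right)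
  qed
  ultimately have "(\<lambda>N. gen_coeff N (C N) k p q) \<longlonglongrightarrow> jump_coeff lam \<alpha> k q * 1 * (if perm_le k q p then 1 else 0)"
    by (rule Lim_transform_eventually)
  then show ?thesis using False by (cases "perm_le k q p") (simp_all add: limit_coeff_def)
qed

lemma walk_generator_limit:
  assumes p: "p permutes {1..k}" and k: "k \<ge> 1"
  shows "\<exists>\<epsilon> N0. \<epsilon> \<longlonglongrightarrow> 0 \<and> N0 \<ge> 2 \<and> (\<forall>N\<ge>N0. \<forall>S. S permutes {1..N} \<longrightarrow>
      \<bar>walk_generator N (C N) (exclusive_moment k p N) S -
       (\<Sum>q | q permutes {1..k}. limit_coeff lam \<alpha> k p q * exclusive_moment k (inv_into UNIV q \<circ> p) N S)\<bar> \<le> \<epsilon> N)"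
proof -
  let ?Q = "{q. q permutes {1..k}}"
  \<comment> \<open>This exponent depends on \<open>p\<close> alone, so the bound for the bad tuples
    still tends to 0 as \<open>N\<close> grows.\<close>
  obtain n where n: "p ^^ n = id" "n > 0"
    using permutation_is_nilpotent[OF permutation_if_permutes[OF p]] by blast
  define \<epsilon> where "\<epsilon> N = real (k * n * n) / real (N - 2 * n) + (\<Sum>q\<in>?Q. \<bar>gen_coeff N (C N) k p q - limit_coeff lam \<alpha> k p q\<bar>)" for N
  have "(\<lambda>N. \<Sum>q\<in>?Q. \<bar>gen_coeff N (C N) k p q - limit_coeff lam \<alpha> k p q\<bar>) \<longlonglongrightarrow> (\<Sum>q\<in>?Q. \<bar>limit_coeff lam \<alpha> k p q - limit_coeff lam \<alpha> k p q\<bar>)"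
    by (intro tendsto_intros gen_coeff_tendsto p) auto
  moreover have "(\<lambda>N. real (k * n * n) / real (N - 2 * n)) \<longlonglongrightarrow> 0"
  proof -
    have "filterlim (\<lambda>N. N - 2 * n) at_top sequentially" by (rule filterlim_minus_const_nat_at_top)
    then have "filterlim (\<lambda>N. real (N - 2 * n)) at_top sequentially"
      by (rule filterlim_compose[OF filterlim_real_sequentially])
    then show ?thesis by (rule real_tendsto_divide_at_top[OF tendsto_const])
  qed
  ultimately have "\<epsilon> \<longlonglongrightarrow> 0 + (\<Sum>q\<in>?Q. \<bar>limit_coeff lam \<alpha> k p q - limit_coeff lam \<alpha> k p q\<bar>)"
    unfolding \<epsilon>_def by (intro tendsto_add)
  then have lim: "\<epsilon> \<longlonglongrightarrow> 0" by simp
  have bound: "\<bar>walk_generator N (C N) (exclusive_moment k p N) S -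
       (\<Sum>q\<in>?Q. limit_coeff lam \<alpha> k p q * exclusive_moment k (inv_into UNIV q \<circ> p) N S)\<bar> \<le> \<epsilon> N"
    if N: "N \<ge> 2 * n + k + 2" and S: "S permutes {1..N}" for N S
  proof -
    have N2: "N \<ge> 2" using N by simp
    let ?e = "\<lambda>q. exclusive_moment k (inv_into UNIV q \<circ> p) N S"
    let ?g = "\<Sum>q\<in>?Q. gen_coeff N (C N) k p q * ?e q" and ?l = "\<Sum>q\<in>?Q. limit_coeff lam \<alpha> k p q * ?e q"
    have "\<bar>walk_generator N (C N) (exclusive_moment k p N) S - ?g\<bar> \<le> real (k * n * n) / real (N - 2 * n)"
      using N by (intro walk_generator_exclusive_moment[OF conj[OF N2] S p k _ n _ nontrivial[OF N2]]) auto
    moreover have "\<bar>?g - ?l\<bar> \<le> (\<Sum>q\<in>?Q. \<bar>gen_coeff N (C N) k p q - limit_coeff lam \<alpha> k p q\<bar>)"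
    proof -
      have eq: "?g - ?l = (\<Sum>q\<in>?Q. (gen_coeff N (C N) k p q - limit_coeff lam \<alpha> k p q) * ?e q)"
        by (simp add: sum_subtractf left_diff_distrib)
      have "\<bar>?g - ?l\<bar> \<le> (\<Sum>q\<in>?Q. \<bar>(gen_coeff N (C N) k p q - limit_coeff lam \<alpha> k p q) * ?e q\<bar>)"
        unfolding eq by (rule sum_abs)
      also have "\<dots> \<le> (\<Sum>q\<in>?Q. \<bar>gen_coeff N (C N) k p q - limit_coeff lam \<alpha> k p q\<bar>)"
      proof (rule sum_mono)
        fix q assume "q \<in> ?Q"
        then have q: "q permutes {1..k}" by simp
        note e = exclusive_moment_bounds[OF permutes_compose[OF p permutes_inv[OF q]] S k]
        have "\<bar>(gen_coeff N (C N) k p q - limit_coeff lam \<alpha> k p q) * ?e q\<bar> = \<bar>gen_coeff N (C N) k p q - limit_coeff lam \<alpha> k p q\<bar> * ?e q"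
          unfolding abs_mult abs_of_nonneg[OF e(1)] ..
        also have "\<dots> \<le> \<bar>gen_coeff N (C N) k p q - limit_coeff lam \<alpha> k p q\<bar> * 1"
          by (intro mult_left_mono e(2)) simp
        finally
        show "\<bar>(gen_coeff N (C N) k p q - limit_coeff lam \<alpha> k p q) * ?e q\<bar> \<le> \<bar>gen_coeff N (C N) k p q - limit_coeff lam \<alpha> k p q\<bar>"
          by simp
      qed
      finally show ?thesis .
    qed
    moreover have "\<bar>a - l\<bar> \<le> x + y" if "\<bar>a - g\<bar> \<le> x" "\<bar>g - l\<bar> \<le> y" for a g l x y :: real
      using that by linarith
    ultimately show ?thesis unfolding \<epsilon>_def by blast
  qed
  show ?thesis
    using lim bound by (intro exI[of _ \<epsilon>] exI[of _ "2 * n + k + 2"] conjI allI impI) simp_all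
qed

end

section \<open>Expectations of finite Markov processes\<close>

lemma finite_permutation_group: "finite {p. p permutes {1..N::nat}}"
  by (rule finite_permutations) simp

lemma expectation_bind_finite:
  fixes p :: "'s pmf" and f :: "'s \<Rightarrow> real"
  assumes E: "finite E" and p: "set_pmf p \<subseteq> E" and q: "\<And>x. x \<in> E \<Longrightarrow> set_pmf (q x) \<subseteq> E"
  shows "measure_pmf.expectation (bind_pmf p q) f =
    measure_pmf.expectation p (\<lambda>x. measure_pmf.expectation (q x) f)"
proof -
  have fin: "finite (set_pmf p)" by (rule finite_subset[OF p E])
  have "measure_pmf.expectation (bind_pmf p q) f = (\<Sum>a\<in>set_pmf p. pmf p a *\<^sub>R measure_pmf.expectation (q a) f)"
    using finite_subset[OF q E] p fin by (intro pmf_expectation_bind) auto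
  also have "\<dots> = measure_pmf.expectation p (\<lambda>x. measure_pmf.expectation (q x) f)"
    by (rule integral_measure_pmf[OF fin, symmetric]) simp
  finally show ?thesis .
qed

context
  fixes E :: "'s set" and P :: "real \<Rightarrow> 's \<Rightarrow> 's pmf" and H :: "('s \<Rightarrow> real) \<Rightarrow> 's \<Rightarrow> real"
  assumes E: "finite E" and sg: "markov_semigroup E P" and gen: "has_generator E P H"
begin

lemma semigroup_support: "t \<ge> 0 \<Longrightarrow> x \<in> E \<Longrightarrow> set_pmf (P t x) \<subseteq> E"
  and semigroup_add: "s \<ge> 0 \<Longrightarrow> t \<ge> 0 \<Longrightarrow> x \<in> E \<Longrightarrow> P (s + t) x = bind_pmf (P s x) (P t)"
  and semigroup_0: "x \<in> E \<Longrightarrow> P 0 x = return_pmf x"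
  using sg unfolding markov_semigroup_def by blast+

lemma integrable_semigroup:
  fixes f :: "'s \<Rightarrow> real"
  shows "t \<ge> 0 \<Longrightarrow> x \<in> E \<Longrightarrow> integrable (measure_pmf (P t x)) f"
  using integrable_measure_pmf_finite[OF finite_subset[OF semigroup_support E]] .

lemma abs_expectation_le:
  fixes f :: "'s \<Rightarrow> real"
  assumes "t \<ge> 0" "x \<in> E" "\<And>y. y \<in> E \<Longrightarrow> \<bar>f y\<bar> \<le> B"
  shows "\<bar>measure_pmf.expectation (P t x) f\<bar> \<le> B"
proof -
  have "\<bar>measure_pmf.expectation (P t x) f\<bar> \<le> measure_pmf.expectation (P t x) (\<lambda>y. \<bar>f y\<bar>)"
    using integral_norm_bound[of "P t x" f] by simp
  also have "\<dots> \<le> measure_pmf.expectation (P t x) (\<lambda>y. B)"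
    using semigroup_support[OF assms(1,2)] assms
    by (intro integral_mono_AE integrable_semigroup) (auto simp: AE_measure_pmf_iff)
  finally show ?thesis by simp
qed

text \<open>The semigroup law conditions on the state at time \<open>s\<close>, which turns an
  increment at any time into an average of increments from time 0. An error bound uniform in the
  state is thereby uniform in \<open>s\<close>.\<close>

lemma expectation_step:
  fixes f :: "'s \<Rightarrow> real"
  assumes "s \<ge> 0" "h \<ge> 0" "x \<in> E"
  shows "measure_pmf.expectation (P (s + h) x) f - measure_pmf.expectation (P s x) f - h * measure_pmf.expectation (P s x) g =
    measure_pmf.expectation (P s x) (\<lambda>y. measure_pmf.expectation (P h y) f - f y - h * g y)"
  unfolding semigroup_add[OF assms]
  by (subst expectation_bind_finite[OF E semigroup_support[OF assms(1,3)] semigroup_support[OF assms(2)]])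
     (simp_all add: integrable_semigroup assms)

lemma generator_uniform:
  fixes f :: "'s \<Rightarrow> real"
  assumes "e > 0"
  shows "eventually (\<lambda>h. \<forall>y\<in>E. \<bar>measure_pmf.expectation (P h y) f - f y - h * H f y\<bar> \<le> e * h) (at_right 0)"
proof -
  have "eventually (\<lambda>h. \<bar>measure_pmf.expectation (P h y) f - f y - h * H f y\<bar> \<le> e * h) (at_right 0)" if "y \<in> E" for y
  proof -
    have "((\<lambda>t. (measure_pmf.expectation (P t y) f - f y) / t) \<longlongrightarrow> H f y) (at_right 0)"
      using gen that unfolding has_generator_def by blast
    from tendstoD[OF this assms] have "eventually (\<lambda>h. dist ((measure_pmf.expectation (P h y) f - f y) / h) (H f y) < e) (at_right 0)" .
    moreover have "eventually (\<lambda>h::real. h > 0) (at_right 0)" by (rule eventually_at_right_less)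
    ultimately show ?thesis
    proof eventually_elim
      case (elim h)
      have "measure_pmf.expectation (P h y) f - f y - h * H f y = h * ((measure_pmf.expectation (P h y) f - f y) / h - H f y)"
        using elim(2) by (simp add: field_simps)
      then have "\<bar>measure_pmf.expectation (P h y) f - f y - h * H f y\<bar> = h * \<bar>(measure_pmf.expectation (P h y) f - f y) / h - H f y\<bar>"
        using elim(2) by (simp only: abs_mult abs_of_pos)
      also have "\<dots> \<le> h * e" using elim by (intro mult_left_mono) (auto simp: dist_real_def)
      finally show ?case by (simp add: mult.commute)
    qed
  qed
  then show ?thesis using E by (simp add: eventually_ball_finite)
qed

text \<open>The point is that \<open>d\<close> does not depend on \<open>s\<close>: for the
  derivative from the left the base point moves with \<open>h\<close>.\<close>

lemma expectation_step_bound: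
  fixes f :: "'s \<Rightarrow> real"
  assumes "x \<in> E" "e > 0"
  shows "\<exists>d>0. \<forall>s\<ge>0. \<forall>h. 0 < h \<and> h < d \<longrightarrow>
    \<bar>measure_pmf.expectation (P (s + h) x) f - measure_pmf.expectation (P s x) f
      - h * measure_pmf.expectation (P s x) (H f)\<bar> \<le> e * h"
proof -
  obtain d where d: "d > 0" "\<And>h. 0 < h \<Longrightarrow> h < d \<Longrightarrow> \<forall>y\<in>E. \<bar>measure_pmf.expectation (P h y) f - f y - h * H f y\<bar> \<le> e * h"
    using generator_uniform[OF assms(2), of f] unfolding eventually_at_right_field by auto
  show ?thesis
  proof (intro exI[of _ d] conjI d(1) allI impI, elim conjE)
    fix s h :: real assume *: "0 \<le> s" "0 < h" "h < d"
    then show "\<bar>measure_pmf.expectation (P (s + h) x) f - measure_pmf.expectation (P s x) f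
      - h * measure_pmf.expectation (P s x) (H f)\<bar> \<le> e * h"
      unfolding expectation_step[OF *(1) less_imp_le[OF *(2)] assms(1)]
      using d(2)[OF *(2,3)] by (intro abs_expectation_le assms(1)) auto
  qed
qed

text \<open>On a finite state space \<open>H f\<close> is bounded, so expectations change at bounded
  speed. Applied to \<open>H f\<close> itself, this controls how the candidate derivative varies in
  time.\<close>

lemma expectation_lipschitz:
  fixes f :: "'s \<Rightarrow> real"
  assumes x: "x \<in> E"
  shows "\<exists>d>0. \<exists>B\<ge>0. \<forall>s\<ge>0. \<forall>h. 0 < h \<and> h < d \<longrightarrow>
    \<bar>measure_pmf.expectation (P (s + h) x) f - measure_pmf.expectation (P s x) f\<bar> \<le> B * h"
proof -
  define B where "B = (\<Sum>y\<in>E. \<bar>H f y\<bar>)"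
  have B: "\<bar>H f y\<bar> \<le> B" if "y \<in> E" for y
    unfolding B_def using member_le_sum[OF that, of "\<lambda>y. \<bar>H f y\<bar>"] E by simp
  have B0: "B \<ge> 0" unfolding B_def by (simp add: sum_nonneg)
  have "\<exists>d>0. \<forall>s\<ge>0. \<forall>h. 0 < h \<and> h < d \<longrightarrow>
    \<bar>measure_pmf.expectation (P (s + h) x) f - measure_pmf.expectation (P s x) f
      - h * measure_pmf.expectation (P s x) (H f)\<bar> \<le> 1 * h"
    by (rule expectation_step_bound[OF x]) simp
  then obtain d where d: "d > 0" and step: "\<forall>s\<ge>0. \<forall>h. 0 < h \<and> h < d \<longrightarrow>
    \<bar>measure_pmf.expectation (P (s + h) x) f - measure_pmf.expectation (P s x) f
      - h * measure_pmf.expectation (P s x) (H f)\<bar> \<le> 1 * h" by blast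
  show ?thesis
  proof (rule exI[of _ d], intro conjI d, rule exI[of _ "B + 1"], intro conjI allI impI, goal_cases)
    case 1
    then show ?case using B0 by simp
  next
    case (2 s h)
    have "\<bar>measure_pmf.expectation (P s x) (H f)\<bar> \<le> B" using 2 by (intro abs_expectation_le x B) auto
    then have "\<bar>h * measure_pmf.expectation (P s x) (H f)\<bar> \<le> B * h"
      using 2 by (simp add: abs_mult mult.commute mult_right_mono)
    moreover have "\<bar>measure_pmf.expectation (P (s + h) x) f - measure_pmf.expectation (P s x) f
      - h * measure_pmf.expectation (P s x) (H f)\<bar> \<le> h" using step 2 by simp
    ultimately show ?case unfolding distrib_right by linarith
  qed
qed

text \<open>The generator only provides increments to the right. For \<open>y < t\<close> the
  difference quotient is based at \<open>y\<close> and approximates the value of the derivative at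
  \<open>y\<close>; the Lipschitz bound for \<open>H f\<close> then moves it to
  \<open>t\<close>.\<close>

lemma expectation_has_derivative:
  fixes f :: "'s \<Rightarrow> real"
  assumes x: "x \<in> E" and t: "t \<ge> 0"
  shows "((\<lambda>t. measure_pmf.expectation (P t x) f) has_real_derivative measure_pmf.expectation (P t x) (H f)) (at t within {0..})"
proof -
  define u where "u f t = measure_pmf.expectation (P t x) f" for f :: "'s \<Rightarrow> real" and t
  have "((\<lambda>y. (u f y - u f t) / (y - t)) \<longlongrightarrow> u (H f) t) (at t within {0..})"
  proof (rule tendstoI)
    fix e :: real assume e: "e > 0"
    obtain d where d: "d > 0" and step: "\<forall>s\<ge>0. \<forall>h. 0 < h \<and> h < d \<longrightarrow> \<bar>u f (s + h) - u f s - h * u (H f) s\<bar> \<le> e / 2 * h"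
      using expectation_step_bound[OF x half_gt_zero[OF e], of f] unfolding u_def by blast
    obtain d' B where d': "d' > 0" "B \<ge> 0" and lip: "\<forall>s\<ge>0. \<forall>h. 0 < h \<and> h < d' \<longrightarrow> \<bar>u (H f) (s + h) - u (H f) s\<bar> \<le> B * h"
      using expectation_lipschitz[OF x, of "H f"] unfolding u_def by blast
    \<comment> \<open>The third bound makes the Lipschitz error less than \<open>e / 2\<close>;
      \<open>B + 1\<close> avoids division by zero.\<close>
    define D where "D = min (min d d') (e / (2 * (B + 1)))"
    have D: "D > 0" "D \<le> d" "D \<le> d'" unfolding D_def using d d' e by auto
    have BD: "B * h < e / 2" if "0 < h" "h < D" for h
    proof -
      have "h < e / (2 * (B + 1))" using that unfolding D_def by simp
      then have "(B + 1) * h < e / 2" using d'(2) by (simp add: field_simps)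
      then show ?thesis using that(1) by (simp add: algebra_simps)
    qed
    show "eventually (\<lambda>y. dist ((u f y - u f t) / (y - t)) (u (H f) t) < e) (at t within {0..})"
      unfolding eventually_at
    proof (intro exI[of _ D] conjI D(1) ballI impI, elim conjE)
      fix y assume y: "y \<in> {0..}" "y \<noteq> t" "dist y t < D"
      have close: "\<bar>(u f (s + h) - u f s) / h - u (H f) s\<bar> \<le> e / 2" if "s \<ge> 0" "0 < h" "h < D" for s h
      proof -
        have "\<bar>u f (s + h) - u f s - h * u (H f) s\<bar> \<le> e / 2 * h" using step that D by simp
        moreover have "(u f (s + h) - u f s) / h - u (H f) s = (u f (s + h) - u f s - h * u (H f) s) / h"
          using that by (simp add: field_simps)
        ultimately show ?thesis using that by (simp add: abs_divide pos_divide_le_eq)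
      qed
      show "dist ((u f y - u f t) / (y - t)) (u (H f) t) < e"
      proof (cases "y > t")
        case True
        then show ?thesis using close[of t "y - t"] t y(3) e by (auto simp: dist_real_def)
      next
        case False
        then have h: "0 < t - y" "t - y < D" "y \<ge> 0" using y by (auto simp: dist_real_def)
        have "\<bar>u (H f) t - u (H f) y\<bar> \<le> B * (t - y)" using lip[rule_format, of y "t - y"] h D by simp
        then have "\<bar>u (H f) t - u (H f) y\<bar> < e / 2" using BD[OF h(1,2)] by linarith
        moreover have "\<bar>(u f t - u f y) / (t - y) - u (H f) y\<bar> \<le> e / 2" using close[of y "t - y"] h by simp
        moreover have "(u f y - u f t) / (y - t) = (u f t - u f y) / (t - y)"
          by (metis minus_diff_eq minus_divide_divide)
        ultimately show ?thesis by (simp only: dist_real_def)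
      qed
    qed
  qed
  then show ?thesis unfolding has_field_derivative_iff u_def .
qed

end

text \<open>The Markov property at time 0, integrated: conditioning does not change the mean, and
  the right-hand side is almost surely constant because the initial state is. This replaces the
  process by its semigroup, so only finite averages remain.\<close>

lemma markov_process_expectation:
  fixes X :: "real \<Rightarrow> 'a \<Rightarrow> 's"
  assumes mp: "markov_process M E X H" and E: "finite E" and x0: "x0 \<in> E"
    and X0: "AE \<omega> in M. X 0 \<omega> = x0"
  shows "\<exists>P. markov_semigroup E P \<and> has_generator E P H \<and>
    (\<forall>t\<ge>0. \<forall>f :: 's \<Rightarrow> real. integral\<^sup>L M (\<lambda>\<omega>. f (X t \<omega>)) = measure_pmf.expectation (P t x0) f)"
proof -
  interpret prob_space M using mp unfolding markov_process_def by blast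
  have X: "X t \<in> measurable M (count_space E)" if "t \<ge> 0" for t
    using mp that unfolding markov_process_def by blast
  obtain P where P: "markov_semigroup E P" "has_generator E P H"
    "\<And>s t f. s \<ge> 0 \<Longrightarrow> t \<ge> 0 \<Longrightarrow> AE \<omega> in M.
       real_cond_exp M (natural_filtration M E X s) (\<lambda>\<omega>'. f (X (s + t) \<omega>')) \<omega> = measure_pmf.expectation (P t (X s \<omega>)) f"
    using mp unfolding markov_process_def by blast
  let ?F = "natural_filtration M E X 0"
  have sub: "subalgebra M ?F"
    unfolding subalgebra_def natural_filtration_def
  proof (intro conjI)
    let ?G = "{X u -` A \<inter> space M | u A. 0 \<le> u \<and> u \<le> 0 \<and> A \<subseteq> E}"
    have G: "?G \<subseteq> sets M" using measurable_sets[OF X] by auto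
    have "sets (sigma (space M) ?G) = sigma_sets (space M) ?G" by (rule sets_measure_of) blast
    then show "sets (sigma (space M) ?G) \<subseteq> sets M" using sets.sigma_sets_subset[OF G] by simp
  qed (simp add: space_measure_of_conv)
  have "finite_measure_subalgebra M ?F" by (unfold_locales) (rule sub)
  then interpret F: finite_measure_subalgebra M ?F .
  have "integral\<^sup>L M (\<lambda>\<omega>. f (X t \<omega>)) = measure_pmf.expectation (P t x0) f" if t: "t \<ge> 0" for t and f :: "'s \<Rightarrow> real"
  proof -
    have meas: "(\<lambda>\<omega>. f (X t \<omega>)) \<in> borel_measurable M"
      by (rule measurable_compose[OF X[OF t]]) simp
    have "\<exists>B. \<forall>y\<in>E. \<bar>f y\<bar> \<le> B" using E by (intro exI[of _ "\<Sum>y\<in>E. \<bar>f y\<bar>"]) (auto intro: member_le_sum)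
    then obtain B where B: "\<And>y. y \<in> E \<Longrightarrow> \<bar>f y\<bar> \<le> B" by blast
    have int: "integrable M (\<lambda>\<omega>. f (X t \<omega>))"
      using measurable_space[OF X[OF t]] B meas by (intro integrable_const_bound[of _ B]) auto
    have "integral\<^sup>L M (\<lambda>\<omega>. f (X t \<omega>)) = integral\<^sup>L M (real_cond_exp M ?F (\<lambda>\<omega>. f (X t \<omega>)))"
      by (rule F.real_cond_exp_int(2)[OF int, symmetric])
    also have "\<dots> = integral\<^sup>L M (\<lambda>\<omega>. measure_pmf.expectation (P t x0) f)"
    proof (rule integral_cong_AE)
      have "AE \<omega> in M. real_cond_exp M ?F (\<lambda>\<omega>'. f (X (0 + t) \<omega>')) \<omega> = measure_pmf.expectation (P t (X 0 \<omega>)) f"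
        by (rule P(3)) (use t in auto)
      then show "AE \<omega> in M. real_cond_exp M ?F (\<lambda>\<omega>. f (X t \<omega>)) \<omega> = measure_pmf.expectation (P t x0) f"
        using X0 by eventually_elim simp
    qed (use borel_measurable_cond_exp2 in auto)
    finally show ?thesis by (simp add: prob_space)
  qed
  then show ?thesis using P(1,2) by blast
qed

section \<open>Linear systems of differential equations\<close>

text \<open>The vectors \<open>A\<^sup>n y\<^sub>0\<close>, which are the Taylor coefficients of the solution up to factorials.\<close>

primrec system_coeff :: "'i set \<Rightarrow> ('i \<Rightarrow> 'i \<Rightarrow> real) \<Rightarrow> ('i \<Rightarrow> real) \<Rightarrow> nat \<Rightarrow> 'i \<Rightarrow> real" where
  "system_coeff I A y0 0 i = y0 i"
| "system_coeff I A y0 (Suc n) i = (\<Sum>j\<in>I. A i j * system_coeff I A y0 n j)"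

text \<open>The exponential series. The coefficients grow at most like \<open>B * K ^ n\<close>, so
  the series converges for all \<open>t\<close>, and termwise differentiation shifts the index,
  which amounts to applying \<open>A\<close>.\<close>

lemma linear_system_exists:
  fixes A :: "'i \<Rightarrow> 'i \<Rightarrow> real"
  assumes I: "finite I"
  shows "\<exists>y. (\<forall>i\<in>I. \<forall>t. (y i has_real_derivative (\<Sum>j\<in>I. A i j * y j t)) (at t)) \<and> (\<forall>i\<in>I. y i 0 = y0 i)"
proof -
  define b where "b = system_coeff I A y0"
  define K where "K = (\<Sum>i\<in>I. \<Sum>j\<in>I. \<bar>A i j\<bar>)"
  define B where "B = (\<Sum>j\<in>I. \<bar>y0 j\<bar>)"
  have row: "(\<Sum>j\<in>I. \<bar>A i j\<bar>) \<le> K" if "i \<in> I" for i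
    unfolding K_def by (rule member_le_sum[OF that]) (auto intro: sum_nonneg I)
  have K0: "K \<ge> 0" unfolding K_def by (intro sum_nonneg) auto
  have B0: "B \<ge> 0" unfolding B_def by (intro sum_nonneg) auto
  have b_bound: "\<forall>i\<in>I. \<bar>b n i\<bar> \<le> B * K ^ n" for n
  proof (induction n)
    case 0
    have "\<bar>y0 i\<bar> \<le> B" if "i \<in> I" for i unfolding B_def by (rule member_le_sum[OF that]) (auto intro: I)
    then show ?case by (simp add: b_def)
  next
    case (Suc n)
    show ?case
    proof
      fix i assume i: "i \<in> I"
      have "\<bar>b (Suc n) i\<bar> \<le> (\<Sum>j\<in>I. \<bar>A i j * b n j\<bar>)" by (simp add: b_def sum_abs)
      also have "\<dots> \<le> (\<Sum>j\<in>I. \<bar>A i j\<bar> * (B * K ^ n))"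
        using Suc by (intro sum_mono) (simp add: abs_mult mult_left_mono)
      also have "\<dots> = (\<Sum>j\<in>I. \<bar>A i j\<bar>) * (B * K ^ n)" by (rule sum_distrib_right[symmetric])
      also have "\<dots> \<le> K * (B * K ^ n)" using K0 B0 by (intro mult_right_mono row i) auto
      finally show "\<bar>b (Suc n) i\<bar> \<le> B * K ^ Suc n" by (simp add: mult_ac)
    qed
  qed
  define y where "y i t = (\<Sum>n. b n i / fact n * t ^ n)" for i and t :: real
  have summ: "summable (\<lambda>n. b n i / fact n * t ^ n)" if i: "i \<in> I" for i and t :: real
  proof (rule summable_comparison_test')
    have "summable (\<lambda>n. B * (inverse (fact n) * (K * \<bar>t\<bar>) ^ n))"
      by (intro summable_mult summable_exp)
    then show "summable (\<lambda>n. B * K ^ n / fact n * \<bar>t\<bar> ^ n)"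
      by (simp add: power_mult_distrib field_simps)
    fix n :: nat
    have "\<bar>b n i\<bar> / fact n * \<bar>t\<bar> ^ n \<le> B * K ^ n / fact n * \<bar>t\<bar> ^ n"
      using b_bound i by (intro mult_right_mono divide_right_mono) auto
    then show "norm (b n i / fact n * t ^ n) \<le> B * K ^ n / fact n * \<bar>t\<bar> ^ n"
      by (simp add: abs_mult power_abs)
  qed
  have "(y i has_real_derivative (\<Sum>j\<in>I. A i j * y j t)) (at t)" if i: "i \<in> I" for i t
  proof -
    have "(y i has_real_derivative (\<Sum>n. diffs (\<lambda>n. b n i / fact n) n * t ^ n)) (at t)"
      unfolding y_def by (rule termdiffs_strong_converges_everywhere) (rule summ[OF i])
    moreover have "(\<Sum>n. diffs (\<lambda>n. b n i / fact n) n * t ^ n) = (\<Sum>n. \<Sum>j\<in>I. A i j * (b n j / fact n * t ^ n))"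
      by (intro suminf_cong)
         (simp add: diffs_def b_def sum_divide_distrib sum_distrib_right sum_distrib_left mult_ac del: of_nat_Suc)
    moreover have "\<dots> = (\<Sum>j\<in>I. \<Sum>n. A i j * (b n j / fact n * t ^ n))"
      by (rule suminf_sum) (rule summable_mult, rule summ)
    moreover have "\<dots> = (\<Sum>j\<in>I. A i j * y j t)"
      unfolding y_def by (intro sum.cong refl suminf_mult summ)
    ultimately show ?thesis by simp
  qed
  moreover have "y i 0 = y0 i" for i
    unfolding y_def by (subst powser_zero) (simp add: b_def)
  ultimately show ?thesis by blast
qed

text \<open>Gronwall's inequality for the sum of the squares of the components.\<close>

lemma linear_system_stability:
  fixes A :: "'i \<Rightarrow> 'i \<Rightarrow> real" and T :: real
  assumes I: "finite I" and T: "T \<ge> 0"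
  obtains K where "K \<ge> 0"
    "\<And>y h \<epsilon> i. (\<And>i t. i \<in> I \<Longrightarrow> t \<ge> 0 \<Longrightarrow>
        (y i has_real_derivative (\<Sum>j\<in>I. A i j * y j t) + h i t) (at t within {0..})) \<Longrightarrow>
      (\<And>i. i \<in> I \<Longrightarrow> y i 0 = 0) \<Longrightarrow> (\<And>i t. i \<in> I \<Longrightarrow> t \<ge> 0 \<Longrightarrow> \<bar>h i t\<bar> \<le> \<epsilon>) \<Longrightarrow> i \<in> I \<Longrightarrow>
      \<bar>y i T\<bar> \<le> K * \<epsilon>"
proof -
  define a where "a = (\<Sum>i\<in>I. \<Sum>j\<in>I. \<bar>A i j\<bar>)"
  define n where "n = real (card I)"
  \<comment> \<open>The cross terms, each bounded by
    \<open>a * ((y i t)\<^sup>2 + (y j t)\<^sup>2)\<close>, sum to \<open>2 * n * a\<close> times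
    the energy. The additional 1 comes from splitting the product of \<open>y i t\<close> with the
    forcing term.\<close>
  define L where "L = 2 * n * a + 1"
  define K where "K = sqrt (exp (L * T) * n * T)"
  have entry: "\<bar>A i j\<bar> \<le> a" if "i \<in> I" "j \<in> I" for i j
  proof -
    have "\<bar>A i j\<bar> \<le> (\<Sum>j\<in>I. \<bar>A i j\<bar>)" by (rule member_le_sum[OF that(2)]) (auto intro: I)
    also have "\<dots> \<le> a" unfolding a_def by (rule member_le_sum[OF that(1)]) (auto intro: sum_nonneg I)
    finally show ?thesis .
  qed
  have n0: "n \<ge> 0" unfolding n_def by simp
  have K0: "K \<ge> 0" unfolding K_def using n0 T by simp
  have a0: "a \<ge> 0" unfolding a_def by (intro sum_nonneg) auto
  have "\<bar>y i T\<bar> \<le> K * \<epsilon>"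
    if der: "\<And>i t. i \<in> I \<Longrightarrow> t \<ge> 0 \<Longrightarrow> (y i has_real_derivative (\<Sum>j\<in>I. A i j * y j t) + h i t) (at t within {0..})"
      and y0: "\<And>i. i \<in> I \<Longrightarrow> y i 0 = 0" and h: "\<And>i t. i \<in> I \<Longrightarrow> t \<ge> 0 \<Longrightarrow> \<bar>h i t\<bar> \<le> \<epsilon>" and i: "i \<in> I"
    for y h :: "'i \<Rightarrow> real \<Rightarrow> real" and \<epsilon> i
  proof -
    have e0: "\<epsilon> \<ge> 0" using h[OF i, of 0] by simp
    define V where "V t = (\<Sum>i\<in>I. (y i t)\<^sup>2)" for t
    define V' where "V' t = (\<Sum>i\<in>I. 2 * y i t * ((\<Sum>j\<in>I. A i j * y j t) + h i t))" for t
    \<comment> \<open>The integrating factor removes the linear growth, and the subtracted line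
      removes the forcing, since \<open>exp (- L * t) \<le> 1\<close>. What remains is nonincreasing
      and starts at 0.\<close>
    define W where "W t = exp (- L * t) * V t - n * \<epsilon>\<^sup>2 * t" for t
    have V'_le: "V' t \<le> L * V t + n * \<epsilon>\<^sup>2" if t: "t \<ge> 0" for t
    proof -
      have "2 * y i t * ((\<Sum>j\<in>I. A i j * y j t) + h i t) \<le> (\<Sum>j\<in>I. a * ((y i t)\<^sup>2 + (y j t)\<^sup>2)) + ((y i t)\<^sup>2 + \<epsilon>\<^sup>2)"
        if i: "i \<in> I" for i
      proof -
        have young: "2 * (u * v) \<le> u\<^sup>2 + v\<^sup>2" "- (2 * (u * v)) \<le> u\<^sup>2 + v\<^sup>2" for u v :: real
          using zero_le_power2[of "u - v"] zero_le_power2[of "u + v"] by (simp_all add: power2_eq_square algebra_simps)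
        have "2 * y i t * (A i j * y j t) \<le> a * ((y i t)\<^sup>2 + (y j t)\<^sup>2)" if j: "j \<in> I" for j
        proof -
          have "2 * y i t * (A i j * y j t) \<le> \<bar>A i j\<bar> * \<bar>2 * (y i t * y j t)\<bar>"
            by (metis (no_types, opaque_lifting) abs_ge_self abs_mult mult.assoc mult.left_commute)
          also have "\<dots> \<le> a * ((y i t)\<^sup>2 + (y j t)\<^sup>2)"
            using young[of "y i t" "y j t"] by (intro mult_mono entry i j a0) (auto simp: abs_le_iff)
          finally show ?thesis .
        qed
        then have "(\<Sum>j\<in>I. 2 * y i t * (A i j * y j t)) \<le> (\<Sum>j\<in>I. a * ((y i t)\<^sup>2 + (y j t)\<^sup>2))" by (rule sum_mono)
        moreover have "(h i t)\<^sup>2 \<le> \<epsilon>\<^sup>2" using power_mono[OF h[OF i t], of 2] by simp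
        then have "2 * y i t * h i t \<le> (y i t)\<^sup>2 + \<epsilon>\<^sup>2" using young(1)[of "y i t" "h i t"] by simp
        ultimately show ?thesis by (simp add: distrib_left sum_distrib_left)
      qed
      then have "V' t \<le> (\<Sum>i\<in>I. (\<Sum>j\<in>I. a * ((y i t)\<^sup>2 + (y j t)\<^sup>2)) + ((y i t)\<^sup>2 + \<epsilon>\<^sup>2))"
        unfolding V'_def by (rule sum_mono)
      also have "\<dots> = L * V t + n * \<epsilon>\<^sup>2"
        unfolding V_def L_def n_def
        by (simp add: sum.distrib sum_distrib_left[symmetric] distrib_left algebra_simps)
      finally show ?thesis .
    qed
    have V_der: "(V has_real_derivative V' t) (at t within {0..})" if "t \<ge> 0" for t
      unfolding V_def V'_def
      by (rule DERIV_sum, rule derivative_eq_intros, rule der, assumption, rule that) (simp add: mult_ac)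
    have W_der: "(W has_real_derivative exp (- L * t) * (V' t - L * V t) - n * \<epsilon>\<^sup>2) (at t within {0..})" if "t \<ge> 0" for t
      unfolding W_def
      by (rule derivative_eq_intros V_der that refl | simp add: algebra_simps)+
    have "W T \<le> W 0"
    proof (rule DERIV_nonpos_imp_decreasing_open[OF T])
      show "continuous_on {0..T} W"
      proof (rule DERIV_continuous_on)
        fix t assume "t \<in> {0..T}"
        then show "(W has_real_derivative exp (- L * t) * (V' t - L * V t) - n * \<epsilon>\<^sup>2) (at t within {0..T})"
          by (intro DERIV_subset[OF W_der]) auto
      qed
      fix t assume t: "0 < t" "t < T"
      have "at t within {0..} = at t" using t by (intro at_within_interior) (simp add: interior_real_atLeast)
      then have "(W has_real_derivative exp (- L * t) * (V' t - L * V t) - n * \<epsilon>\<^sup>2) (at t)" using W_der[of t] t by simp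
      moreover have "exp (- L * t) * (V' t - L * V t) - n * \<epsilon>\<^sup>2 \<le> 0"
      proof -
        have "0 \<le> L * t" using t n0 a0 unfolding L_def by simp
        then have e1: "exp (- L * t) \<le> 1" by simp
        have "exp (- L * t) * (V' t - L * V t) \<le> exp (- L * t) * (n * \<epsilon>\<^sup>2)"
          using V'_le[of t] t by (intro mult_left_mono) auto
        also have "\<dots> \<le> 1 * (n * \<epsilon>\<^sup>2)" using n0 by (intro mult_right_mono e1) auto
        finally show ?thesis by simp
      qed
      ultimately show "\<exists>y. (W has_real_derivative y) (at t) \<and> y \<le> 0" by blast
    qed
    then have "exp (- L * T) * V T \<le> n * \<epsilon>\<^sup>2 * T" unfolding W_def V_def using y0 by simp
    then have "exp (L * T) * (exp (- L * T) * V T) \<le> exp (L * T) * (n * \<epsilon>\<^sup>2 * T)" by (intro mult_left_mono) auto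
    moreover have "exp (L * T) * (exp (- L * T) * V T) = V T" by (simp add: exp_minus)
    moreover have "exp (L * T) * (n * \<epsilon>\<^sup>2 * T) = exp (L * T) * n * T * \<epsilon>\<^sup>2" by (simp only: mult_ac)
    ultimately have V: "V T \<le> exp (L * T) * n * T * \<epsilon>\<^sup>2" by linarith
    have "(y i T)\<^sup>2 \<le> V T" unfolding V_def by (rule member_le_sum[OF i]) (auto intro: I)
    also have "\<dots> \<le> (K * \<epsilon>)\<^sup>2" using V n0 T unfolding K_def by (simp add: power_mult_distrib)
    finally have "\<bar>y i T\<bar> \<le> \<bar>K * \<epsilon>\<bar>" by (simp only: abs_le_square_iff)
    then show ?thesis using e0 K0 by simp
  qed
  moreover note K0
  ultimately show ?thesis using that by blast
qed

section \<open>Spectra of permutation matrices\<close>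

text \<open>Both exponents lead to the same point of the cycle, hence are congruent modulo its
  length. This handles the passage from the last index of a cycle back to index 0.\<close>

lemma power_cong_least_power:
  fixes z :: "'b::field"
  assumes p: "permutation p" and eq: "(p ^^ a) r = (p ^^ b) r" and z: "z ^ least_power p r = 1"
  shows "z ^ a = z ^ b"
proof -
  have *: "z ^ a = z ^ b" if ab: "a \<le> b" and eq: "(p ^^ a) r = (p ^^ b) r" for a b
  proof -
    have "(p ^^ a) ((p ^^ (b - a)) r) = (p ^^ a) r" using ab eq funpow_add[of a "b - a" p] by simp
    then have "(p ^^ (b - a)) r = r" using inj_eq[OF inj_fn[OF bij_is_inj[OF permutation_bijective[OF p]], of a]] by simp
    then obtain c where "b - a = least_power p r * c" using least_power_dvd[OF p] by (metis dvd_def)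
    then have "z ^ (b - a) = 1" using z by (simp add: power_mult)
    then show ?thesis using ab power_add[of z a "b - a"] by simp
  qed
  show ?thesis
  proof (cases "a \<le> b")
    case True
    then show ?thesis using eq by (rule *)
  next
    case False
    then show ?thesis by (intro *[symmetric] eq[symmetric]) simp
  qed
qed

text \<open>The least point of a cycle serves as its base point. A point is then coded by its base
  point together with its distance from it along the cycle.\<close>

definition orbit_min :: "(nat \<Rightarrow> nat) \<Rightarrow> nat \<Rightarrow> nat" where
  "orbit_min p j = Min (orbit p j)"

definition orbit_index :: "(nat \<Rightarrow> nat) \<Rightarrow> nat \<Rightarrow> nat" where
  "orbit_index p j = (LEAST m. (p ^^ m) (orbit_min p j) = j)"

context
  fixes p :: "nat \<Rightarrow> nat"
  assumes p: "permutation p"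
begin

lemma orbit_min_in: "orbit_min p j \<in> orbit p j"
  unfolding orbit_min_def using finite_orbit[OF permutation_self_in_orbit[OF p]] orbit_nonempty by (rule Min_in)

lemma orbit_orbit_min: "orbit p (orbit_min p j) = orbit p j"
  using orbit_eq_if_mem[OF p orbit_min_in] .

lemma orbit_min_eq_iff: "orbit_min p i = orbit_min p j \<longleftrightarrow> i \<in> orbit p j"
proof
  assume "orbit_min p i = orbit_min p j"
  then have "orbit p i = orbit p j" using orbit_orbit_min by metis
  then show "i \<in> orbit p j" using permutation_self_in_orbit[OF p, of i] by simp
next
  assume "i \<in> orbit p j"
  then have "orbit p i = orbit p j" by (rule orbit_eq_if_mem[OF p])
  then show "orbit_min p i = orbit_min p j" by (simp add: orbit_min_def)
qed

lemma least_power_orbit_min: "least_power p (orbit_min p j) = least_power p j"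
  by (rule least_power_orbit[OF p orbit_min_in])

lemma funpow_orbit_index: "(p ^^ orbit_index p j) (orbit_min p j) = j"
  and orbit_index_less: "orbit_index p j < least_power p j"
proof -
  let ?r = "orbit_min p j" and ?l = "least_power p j"
  have "j \<in> orbit p ?r" using orbit_orbit_min permutation_self_in_orbit[OF p, of j] by simp
  moreover have "orbit p ?r = {(p ^^ m) ?r | m. m < ?l}"
    using least_power_of_permutation[OF p, of ?r] unfolding least_power_orbit_min by (rule orbit_altdef_bounded)
  ultimately obtain m where m: "m < ?l" "(p ^^ m) ?r = j" by auto
  show "(p ^^ orbit_index p j) ?r = j"
    unfolding orbit_index_def by (rule LeastI[of "\<lambda>m. (p ^^ m) ?r = j", OF m(2)])
  have "orbit_index p j \<le> m" unfolding orbit_index_def using m(2) by (rule Least_le)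
  then show "orbit_index p j < ?l" using m(1) by simp
qed

lemma orbit_index_inj: "orbit_min p i = orbit_min p j \<Longrightarrow> orbit_index p i = orbit_index p j \<Longrightarrow> i = j"
proof -
  assume eq: "orbit_min p i = orbit_min p j" "orbit_index p i = orbit_index p j"
  have "i = (p ^^ orbit_index p i) (orbit_min p i)" by (rule funpow_orbit_index[symmetric])
  also have "\<dots> = (p ^^ orbit_index p j) (orbit_min p j)" unfolding eq ..
  also have "\<dots> = j" by (rule funpow_orbit_index)
  finally show "i = j" .
qed

lemma bij_betw_orbit_index: "bij_betw (orbit_index p) (orbit p j) {..<least_power p j}"
proof -
  have lp: "least_power p i = least_power p j" if "i \<in> orbit p j" for i using least_power_orbit[OF p that] .
  have inj: "inj_on (orbit_index p) (orbit p j)"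
  proof (rule inj_onI)
    fix x y assume xy: "x \<in> orbit p j" "y \<in> orbit p j" "orbit_index p x = orbit_index p y"
    have "orbit_min p x = orbit_min p y"
      using iffD2[OF orbit_min_eq_iff xy(1)] iffD2[OF orbit_min_eq_iff xy(2)] by (rule trans[OF _ sym])
    then show "x = y" using xy(3) by (rule orbit_index_inj)
  qed
  have "orbit_index p i < least_power p j" if "i \<in> orbit p j" for i
    using orbit_index_less[of i] lp[OF that] by simp
  then have sub: "orbit_index p ` orbit p j \<subseteq> {..<least_power p j}" by auto
  have "card (orbit_index p ` orbit p j) = card {..<least_power p j}"
    using card_image[OF inj] card_orbit[OF p, of j] by simp
  then have "orbit_index p ` orbit p j = {..<least_power p j}" using sub by (intro card_subset_eq) auto
  then show ?thesis using inj by (simp add: bij_betw_def)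
qed

end

definition unit_root :: "nat \<Rightarrow> complex" where
  "unit_root n = cis (2 * pi / real n)"

lemma unit_root_power: "unit_root n ^ e = cis (2 * pi * real e / real n)"
  unfolding unit_root_def Complex.DeMoivre by (simp add: mult_ac)

lemma unit_root_power_self: "n > 0 \<Longrightarrow> unit_root n ^ n = 1"
  unfolding unit_root_power by simp

lemma unit_root_cnj: "cnj (unit_root n) * unit_root n = 1" "unit_root n * cnj (unit_root n) = 1"
  by (simp_all add: unit_root_def cis_cnj cis_mult)

text \<open>Orthogonality of the characters of the cyclic group of order \<open>n\<close>, by the
  geometric sum.\<close>

lemma sum_unit_root:
  assumes ab: "a < n" "b < n"
  shows "(\<Sum>e<n. (cnj (unit_root n) ^ a * unit_root n ^ b) ^ e) = (if a = b then of_nat n else 0)"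
proof (cases "a = b")
  case True
  then have "cnj (unit_root n) ^ a * unit_root n ^ b = 1"
    by (simp add: power_mult_distrib[symmetric] unit_root_cnj)
  then show ?thesis using True by simp
next
  case False
  let ?v = "cnj (unit_root n) ^ a * unit_root n ^ b"
  have n: "n > 0" using ab by simp
  have "?v \<noteq> 1"
  proof
    assume "?v = 1"
    then have "unit_root n ^ a * ?v = unit_root n ^ a" by simp
    moreover have "unit_root n ^ a * ?v = unit_root n ^ b"
      by (simp add: mult.assoc[symmetric] power_mult_distrib[symmetric] unit_root_cnj)
    ultimately have "cis (2 * pi * real a / real n) = cis (2 * pi * real b / real n)" by (simp add: unit_root_power)
    then show False
      using bij_betw_imp_inj_on[OF Complex.bij_betw_roots_unity[OF n]] ab False by (auto dest: inj_onD)
  qed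
  moreover have "?v ^ n = (cnj (unit_root n) ^ n) ^ a * (unit_root n ^ n) ^ b"
    by (simp add: power_mult_distrib power_mult[symmetric] mult.commute)
  then have "?v ^ n = 1" using unit_root_power_self[OF n] by (simp add: complex_cnj_power[symmetric] del: complex_cnj_power)
  ultimately show ?thesis using False by (simp add: geometric_sum)
qed

text \<open>A discrete Fourier transform on each cycle diagonalises the permutation matrix.\<close>

definition perm_eigenvalue :: "(nat \<Rightarrow> nat) \<Rightarrow> nat \<Rightarrow> complex" where
  "perm_eigenvalue p j = unit_root (least_power p j) ^ orbit_index p j"

definition fourier_entry :: "(nat \<Rightarrow> nat) \<Rightarrow> nat \<Rightarrow> nat \<Rightarrow> complex" where
  "fourier_entry p i j = (if orbit_min p i = orbit_min p j
     then cnj (unit_root (least_power p j)) ^ (orbit_index p i * orbit_index p j) else 0)"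

definition fourier_inverse_entry :: "(nat \<Rightarrow> nat) \<Rightarrow> nat \<Rightarrow> nat \<Rightarrow> complex" where
  "fourier_inverse_entry p i j = (if orbit_min p i = orbit_min p j
     then unit_root (least_power p j) ^ (orbit_index p i * orbit_index p j) / of_nat (least_power p j) else 0)"

text \<open>This is the eigenvector equation for column \<open>j\<close>. One step along the cycle
  multiplies the entry by the conjugate of the eigenvalue, and the jump of the index at the end of
  the cycle is invisible because the base of the power is a root of unity of order dividing the
  length.\<close>

lemma fourier_entry_step:
  assumes p: "permutation p"
  shows "fourier_entry p (p i) j * perm_eigenvalue p j = fourier_entry p i j"
proof -
  have pi: "orbit_min p (p i) = orbit_min p i"
    using orbit_min_eq_iff[OF p] orbit.base[of p i] by blast
  show ?thesis
  proof (cases "orbit_min p i = orbit_min p j")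
    case True
    define n where "n = least_power p j"
    have n: "n > 0" unfolding n_def by (rule least_power_of_permutation(2)[OF p])
    have lr: "least_power p (orbit_min p i) = n" unfolding n_def True by (rule least_power_orbit_min[OF p])
    define z where "z = cnj (unit_root n) ^ orbit_index p j"
    have z1: "z ^ n = 1"
    proof -
      have "z ^ n = (cnj (unit_root n ^ n)) ^ orbit_index p j"
        unfolding z_def by (simp add: power_mult[symmetric] mult.commute)
      then show ?thesis by (simp add: unit_root_power_self[OF n])
    qed
    have "(p ^^ orbit_index p (p i)) (orbit_min p i) = (p ^^ Suc (orbit_index p i)) (orbit_min p i)"
      using funpow_orbit_index[OF p, of "p i"] funpow_orbit_index[OF p, of i] unfolding pi by simp
    then have "z ^ orbit_index p (p i) = z ^ Suc (orbit_index p i)"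
      using z1 unfolding lr[symmetric] by (rule power_cong_least_power[OF p])
    then have "z ^ orbit_index p (p i) * unit_root n ^ orbit_index p j = z ^ orbit_index p i * (z * unit_root n ^ orbit_index p j)"
      by simp
    also have "z * unit_root n ^ orbit_index p j = 1"
      unfolding z_def by (simp add: power_mult_distrib[symmetric] unit_root_cnj)
    finally show ?thesis
      using True pi by (simp add: fourier_entry_def perm_eigenvalue_def n_def[symmetric] z_def power_mult[symmetric] mult.commute)
  next
    case False
    then show ?thesis using pi by (simp add: fourier_entry_def)
  qed
qed

text \<open>Only indices on the cycle of \<open>j\<close> contribute; numbering that cycle by
  \<open>orbit_index\<close> turns the sum into the orthogonality relation.\<close>

lemma fourier_inverse:
  assumes p: "p permutes {1..N}" and i: "i \<in> {1..N}" and j: "j \<in> {1..N}"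
  shows "(\<Sum>m\<in>{1..N}. fourier_entry p i m * fourier_inverse_entry p m j) = (if i = j then 1 else 0)"
proof -
  note P = permutation_if_permutes[OF p]
  define n where "n = least_power p j"
  have n: "n > 0" unfolding n_def by (rule least_power_of_permutation(2)[OF P])
  show ?thesis
  proof (cases "orbit_min p i = orbit_min p j")
    case True
    have sub: "orbit p j \<subseteq> {1..N}" by (rule permutes_orbit_subset[OF p j])
    have "i \<in> orbit p j" using True orbit_min_eq_iff[OF P] by blast
    then have ni: "least_power p i = n" unfolding n_def by (rule least_power_orbit[OF P])
    have lt: "orbit_index p i < n" "orbit_index p j < n"
      using orbit_index_less[OF P, of i] orbit_index_less[OF P, of j] ni n_def by simp_all
    have "(\<Sum>m\<in>{1..N}. fourier_entry p i m * fourier_inverse_entry p m j) =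
      (\<Sum>m\<in>orbit p j. fourier_entry p i m * fourier_inverse_entry p m j)"
      using orbit_min_eq_iff[OF P, of _ j] sub
      by (intro sum.mono_neutral_right) (auto simp: fourier_inverse_entry_def)
    also have "\<dots> = (\<Sum>m\<in>orbit p j. (cnj (unit_root n) ^ orbit_index p i * unit_root n ^ orbit_index p j) ^ orbit_index p m / of_nat n)"
    proof (rule sum.cong[OF refl])
      fix m assume m: "m \<in> orbit p j"
      have mm: "orbit_min p m = orbit_min p j" using m orbit_min_eq_iff[OF P] by blast
      have nm: "least_power p m = n" unfolding n_def by (rule least_power_orbit[OF P m])
      show "fourier_entry p i m * fourier_inverse_entry p m j =
        (cnj (unit_root n) ^ orbit_index p i * unit_root n ^ orbit_index p j) ^ orbit_index p m / of_nat n"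
        unfolding fourier_entry_def fourier_inverse_entry_def nm n_def[symmetric] True mm
        by (simp add: power_mult_distrib power_mult[symmetric] mult.commute)
    qed
    also have "\<dots> = (\<Sum>e<n. (cnj (unit_root n) ^ orbit_index p i * unit_root n ^ orbit_index p j) ^ e / of_nat n)"
      using bij_betw_orbit_index[OF P, of j] unfolding n_def by (rule sum.reindex_bij_betw)
    also have "\<dots> = (if orbit_index p i = orbit_index p j then of_nat n else 0) / of_nat n"
      unfolding sum_divide_distrib[symmetric] sum_unit_root[OF lt] ..
    also have "\<dots> = (if i = j then 1 else 0)" using orbit_index_inj[OF P True] n by auto
    finally show ?thesis .
  next
    case False
    have "(\<Sum>m\<in>{1..N}. fourier_entry p i m * fourier_inverse_entry p m j) = 0"
      using False by (intro sum.neutral) (auto simp: fourier_entry_def fourier_inverse_entry_def)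
    then show ?thesis using False by (metis (full_types))
  qed
qed

lemma char_poly_perm_matrix:
  assumes p: "p permutes {1..N}"
  shows "char_poly (perm_matrix N p) = (\<Prod>i\<leftarrow>[0..<N]. [:- perm_eigenvalue p (Suc i), 1:])"
proof -
  note P = permutation_if_permutes[OF p]
  define A where "A = perm_matrix N p"
  define Q where "Q = mat N N (\<lambda>(i, j). fourier_entry p (Suc i) (Suc j))"
  define Q' where "Q' = mat N N (\<lambda>(i, j). fourier_inverse_entry p (Suc i) (Suc j))"
  define B where "B = mat N N (\<lambda>(i, j). if i = j then perm_eigenvalue p (Suc i) else 0)"
  have carr: "A \<in> carrier_mat N N" "Q \<in> carrier_mat N N" "Q' \<in> carrier_mat N N" "B \<in> carrier_mat N N"
    by (auto simp: A_def perm_matrix_def Q_def Q'_def B_def)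
  have sum_shift: "(\<Sum>m = 0..<N. g (Suc m)) = (\<Sum>m\<in>{1..N}. g m)" for g :: "nat \<Rightarrow> complex"
    using sum.shift_bounds_Suc_ivl[of g 0 N] by (simp add: atLeastLessThanSuc_atLeastAtMost)
  have QQ': "Q * Q' = 1\<^sub>m N"
  proof (rule eq_matI)
    fix i j assume "i < dim_row (1\<^sub>m N)" "j < dim_col (1\<^sub>m N)"
    then have ij: "i < N" "j < N" by auto
    then have "(Q * Q') $$ (i, j) = (\<Sum>m = 0..<N. fourier_entry p (Suc i) (Suc m) * fourier_inverse_entry p (Suc m) (Suc j))"
      by (simp add: Q_def Q'_def scalar_prod_def)
    also have "\<dots> = (\<Sum>m\<in>{1..N}. fourier_entry p (Suc i) m * fourier_inverse_entry p m (Suc j))"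
      by (rule sum_shift)
    also have "\<dots> = (if Suc i = Suc j then 1 else 0)" using ij by (intro fourier_inverse[OF p]) auto
    finally show "(Q * Q') $$ (i, j) = 1\<^sub>m N $$ (i, j)" using ij by simp
  qed (use carr in auto)
  then have Q'Q: "Q' * Q = 1\<^sub>m N" using carr by (intro mat_mult_left_right_inverse[of Q N Q'])
  have AQ: "A * Q = Q * B"
  proof (rule eq_matI)
    fix i j assume "i < dim_row (Q * B)" "j < dim_col (Q * B)"
    then have ij: "i < N" "j < N" using carr by auto
    \<comment> \<open>Row \<open>i\<close> of the permutation matrix has a single 1, in the column
      of the preimage of \<open>Suc i\<close> under \<open>p\<close>.\<close>
    have "Suc i \<in> p ` {1..N}" using permutes_image[OF p] ij by simp
    then obtain K where K: "K \<in> {1..N}" "p K = Suc i" by auto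
    have "(A * Q) $$ (i, j) = (\<Sum>m = 0..<N. (if p (Suc m) = Suc i then 1 else 0) * fourier_entry p (Suc m) (Suc j))"
      using ij by (simp add: A_def perm_matrix_def Q_def scalar_prod_def)
    also have "\<dots> = (\<Sum>m\<in>{1..N}. (if p m = Suc i then 1 else 0) * fourier_entry p m (Suc j))"
      by (rule sum_shift)
    also have "\<dots> = (\<Sum>m\<in>{1..N}. if m = K then fourier_entry p m (Suc j) else 0)"
      unfolding K(2)[symmetric] inj_eq[OF permutes_inj[OF p]] by (intro sum.cong) auto
    also have "\<dots> = fourier_entry p K (Suc j)" using K(1) by (simp add: sum.delta del: One_nat_def)
    also have "\<dots> = fourier_entry p (Suc i) (Suc j) * perm_eigenvalue p (Suc j)"
      using fourier_entry_step[OF P, of K "Suc j"] K(2) by simp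
    also have "\<dots> = (\<Sum>m = 0..<N. if m = j then fourier_entry p (Suc i) (Suc m) * perm_eigenvalue p (Suc j) else 0)"
      using ij by (simp add: sum.delta)
    also have "\<dots> = (\<Sum>m = 0..<N. fourier_entry p (Suc i) (Suc m) * (if m = j then perm_eigenvalue p (Suc m) else 0))"
      by (intro sum.cong) auto
    also have "\<dots> = (Q * B) $$ (i, j)"
      using ij by (simp add: Q_def B_def scalar_prod_def)
    finally show "(A * Q) $$ (i, j) = (Q * B) $$ (i, j)" .
  qed (use carr in auto)
  have "A = A * (Q * Q')" using carr QQ' by simp
  also have "\<dots> = (A * Q) * Q'" by (rule assoc_mult_mat[OF carr(1,2,3), symmetric])
  also have "\<dots> = Q * B * Q'" unfolding AQ ..
  finally have "A = Q * B * Q'" .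
  then have "similar_mat A B" using carr QQ' Q'Q by (intro similar_matI[of A B Q Q' N]) auto
  then have "char_poly A = char_poly B" by (rule char_poly_similar)
  also have "\<dots> = (\<Prod>a\<leftarrow>diag_mat B. [:- a, 1:])"
    by (rule char_poly_upper_triangular[OF carr(4)]) (auto simp: upper_triangular_def B_def)
  also have "diag_mat B = map (\<lambda>i. perm_eigenvalue p (Suc i)) [0..<N]"
    by (auto simp: diag_mat_def B_def)
  finally show ?thesis unfolding A_def by (simp add: comp_def)
qed

lemma eigenvalue_distribution_perm_matrix:
  assumes p: "p permutes {1..N}" and N: "N > 0"
  shows "eigenvalue_distribution (perm_matrix N p) = map_pmf (perm_eigenvalue p) (pmf_of_set {1..N})"
proof -
  have "proots (\<Prod>i\<leftarrow>xs. [:- perm_eigenvalue p (Suc i), 1:]) = mset (map (\<lambda>i. perm_eigenvalue p (Suc i)) xs)" for xs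
  proof (induction xs)
    case (Cons a xs)
    have "q \<noteq> 0" if "q \<in> set (map (\<lambda>i. [:- perm_eigenvalue p (Suc i), 1:]) xs)" for q
      using that by auto
    then have nz: "(\<Prod>i\<leftarrow>xs. [:- perm_eigenvalue p (Suc i), 1:]) \<noteq> 0"
      unfolding prod_list_zero_iff by blast
    have "proots (\<Prod>i\<leftarrow>a # xs. [:- perm_eigenvalue p (Suc i), 1:]) =
      proots ([:- perm_eigenvalue p (Suc a), 1:] * (\<Prod>i\<leftarrow>xs. [:- perm_eigenvalue p (Suc i), 1:]))" by simp
    also have "\<dots> = {#perm_eigenvalue p (Suc a)#} + proots (\<Prod>i\<leftarrow>xs. [:- perm_eigenvalue p (Suc i), 1:])"
      by (subst proots_mult[OF _ nz]) (simp_all del: mult_pCons_left)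
    finally show ?case using Cons by simp
  qed simp
  then have "proots (char_poly (perm_matrix N p)) = image_mset (\<lambda>i. perm_eigenvalue p (Suc i)) (mset [0..<N])"
    unfolding char_poly_perm_matrix[OF p] by simp
  also have "\<dots> = image_mset (perm_eigenvalue p) (image_mset Suc (mset_set {0..<N}))"
    by (simp add: multiset.map_comp comp_def)
  also have "image_mset Suc (mset_set {0..<N}) = mset_set {1..N}"
    by (subst image_mset_mset_set) (auto simp: image_Suc_atLeastLessThan atLeastLessThanSuc_atLeastAtMost)
  finally show ?thesis
    unfolding eigenvalue_distribution_def using N by (subst map_pmf_of_set) auto
qed

definition root_average :: "(complex \<Rightarrow> real) \<Rightarrow> nat \<Rightarrow> real" where
  "root_average f n = (\<Sum>e<n. f (unit_root n ^ e)) / real n"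

text \<open>Along a cycle of length \<open>n\<close> the eigenvalues run once through all
  \<open>n\<close>-th roots of unity. Each value of \<open>f\<close> may therefore be replaced by
  its average over these roots, which depends only on the period, and the points are then grouped by
  period.\<close>

lemma expectation_eigenvalue_distribution:
  assumes p: "p permutes {1..N}" and N: "N > 0"
  shows "measure_pmf.expectation (eigenvalue_distribution (perm_matrix N p)) f =
    (\<Sum>n=1..N. real (period_count N p n) / real N * root_average f n)"
proof -
  note P = permutation_if_permutes[OF p]
  let ?K = "{1..N}" and ?l = "least_power p"
  have orbs: "{i \<in> ?K. orbit_min p i = orbit_min p j} = orbit p j" if "j \<in> ?K" for j
    using orbit_min_eq_iff[OF P] permutes_orbit_subset[OF p that] by blast
  have group: "(\<Sum>j\<in>?K. h j) = (\<Sum>r\<in>orbit_min p ` ?K. \<Sum>j\<in>{i \<in> ?K. orbit_min p i = r}. h j)" for h :: "nat \<Rightarrow> real"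
    by (rule sum.group[symmetric]) auto
  have "(\<Sum>j\<in>?K. f (perm_eigenvalue p j)) = (\<Sum>j\<in>?K. root_average f (?l j))"
    unfolding group
  proof (rule sum.cong[OF refl])
    fix r assume "r \<in> orbit_min p ` ?K"
    then obtain j where j: "j \<in> ?K" "r = orbit_min p j" by blast
    have l: "?l i = ?l j" if "i \<in> orbit p j" for i using least_power_orbit[OF P that] .
    have "(\<Sum>i\<in>orbit p j. f (perm_eigenvalue p i)) = (\<Sum>i\<in>orbit p j. f (unit_root (?l j) ^ orbit_index p i))"
      by (intro sum.cong refl) (simp add: perm_eigenvalue_def l)
    also have "\<dots> = (\<Sum>e<?l j. f (unit_root (?l j) ^ e))"
      by (rule sum.reindex_bij_betw[OF bij_betw_orbit_index[OF P]])
    also have "\<dots> = real (card (orbit p j)) * root_average f (?l j)"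
      using least_power_of_permutation(2)[OF P, of j] by (simp add: root_average_def card_orbit[OF P])
    also have "\<dots> = (\<Sum>i\<in>orbit p j. root_average f (?l i))" by (simp add: l)
    finally show "(\<Sum>i\<in>{i \<in> ?K. orbit_min p i = r}. f (perm_eigenvalue p i)) =
      (\<Sum>i\<in>{i \<in> ?K. orbit_min p i = r}. root_average f (?l i))"
      unfolding j(2) orbs[OF j(1)] .
  qed
  also have "\<dots> = (\<Sum>n=1..N. \<Sum>j\<in>{j \<in> ?K. ?l j = n}. root_average f (?l j))"
  proof (rule sum.group[symmetric])
    show "?l ` ?K \<subseteq> {1..N}"
    proof
      fix n assume "n \<in> ?l ` ?K"
      then obtain j where j: "j \<in> ?K" "n = ?l j" by blast
      have "?l j \<le> N" using card_mono[OF _ permutes_orbit_subset[OF p j(1)]] card_orbit[OF P] by simp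
      then show "n \<in> {1..N}" using least_power_of_permutation(2)[OF P, of j] j(2) by simp
    qed
  qed auto
  also have "\<dots> = (\<Sum>n=1..N. real (period_count N p n) * root_average f n)"
    by (intro sum.cong refl) (simp add: period_count_def)
  finally have "(\<Sum>j\<in>?K. f (perm_eigenvalue p j)) = (\<Sum>n=1..N. real (period_count N p n) * root_average f n)" .
  moreover have "measure_pmf.expectation (eigenvalue_distribution (perm_matrix N p)) f = (\<Sum>j\<in>?K. f (perm_eigenvalue p j)) / real N"
    unfolding eigenvalue_distribution_perm_matrix[OF p N] integral_map_pmf
    using N by (subst integral_pmf_of_set) auto
  ultimately show ?thesis by (simp add: sum_divide_distrib del: One_nat_def)
qed

section \<open>Mixtures on the circle\<close>

lemma riemann_sum_bound:
  fixes h :: "real \<Rightarrow> real"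
  assumes h: "continuous_on {0..b} h" and d: "d \<ge> 0" and m: "real m * d \<le> b"
    and osc: "\<And>x y. 0 \<le> x \<Longrightarrow> x \<le> y \<Longrightarrow> y \<le> b \<Longrightarrow> y \<le> x + d \<Longrightarrow> \<bar>h y - h x\<bar> \<le> e"
  shows "\<bar>integral {0..real m * d} h - (\<Sum>i<m. d * h (real i * d))\<bar> \<le> e * (real m * d)"
  using m
proof (induction m)
  case (Suc m)
  let ?x = "real m * d" and ?y = "real (Suc m) * d"
  have xy: "0 \<le> ?x" "?x \<le> ?y" "?y \<le> b" "?y - ?x = d" using d Suc.prems by (simp_all add: algebra_simps)
  have cont: "continuous_on {?x..?y} h" using xy by (intro continuous_on_subset[OF h]) auto
  have int: "h integrable_on {0..?y}" using xy by (intro integrable_continuous_real continuous_on_subset[OF h]) auto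
  have split: "integral {0..?y} h = integral {0..?x} h + integral {?x..?y} h"
    using Henstock_Kurzweil_Integration.integral_combine[OF xy(1,2) int] by simp
  have "integral {?x..?y} (\<lambda>t. h t - h ?x) = integral {?x..?y} h - integral {?x..?y} (\<lambda>t. h ?x)"
    by (intro Henstock_Kurzweil_Integration.integral_diff integrable_continuous_real cont continuous_on_const)
  also have "integral {?x..?y} (\<lambda>t. h ?x) = d * h ?x" using xy by simp
  finally have eq: "integral {?x..?y} h - d * h ?x = integral {?x..?y} (\<lambda>t. h t - h ?x)" by simp
  have "norm (integral {?x..?y} (\<lambda>t. h t - h ?x)) \<le> e * (?y - ?x)"
  proof (rule integral_bound[OF xy(2)])
    show "continuous_on {?x..?y} (\<lambda>t. h t - h ?x)" by (intro continuous_on_diff cont continuous_on_const)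
    fix t assume "t \<in> {?x..?y}"
    then show "norm (h t - h ?x) \<le> e" using osc[of ?x t] xy by simp
  qed
  then have "\<bar>integral {?x..?y} h - d * h ?x\<bar> \<le> e * d" unfolding eq xy(4) by simp
  moreover have "\<bar>integral {0..?x} h - (\<Sum>i<m. d * h (real i * d))\<bar> \<le> e * ?x"
    using xy Suc.prems by (intro Suc.IH) linarith
  moreover have "e * ?y = e * ?x + e * d" by (simp add: algebra_simps)
  moreover have "(\<Sum>i<Suc m. d * h (real i * d)) = (\<Sum>i<m. d * h (real i * d)) + d * h ?x" by simp
  ultimately show ?case unfolding split by linarith
qed simp

lemma riemann_sum_tendsto:
  fixes h :: "real \<Rightarrow> real"
  assumes h: "continuous_on {0..b} h" and b: "b > 0"
  shows "(\<lambda>n. \<Sum>i<n. b / real n * h (real i * (b / real n))) \<longlonglongrightarrow> integral {0..b} h"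
proof (rule tendstoI)
  fix r :: real assume r: "r > 0"
  have "uniformly_continuous_on {0..b} h" using h by (rule compact_uniformly_continuous) simp
  \<comment> \<open>The oscillation bound is multiplied by the length \<open>b\<close> of the
    interval, so the total error is at most \<open>r / 2\<close>.\<close>
  moreover have "r / (2 * b) > 0" using r b by simp
  ultimately obtain \<delta> where \<delta>: "\<delta> > 0"
    "\<And>x y. x \<in> {0..b} \<Longrightarrow> y \<in> {0..b} \<Longrightarrow> dist y x < \<delta> \<Longrightarrow> dist (h y) (h x) < r / (2 * b)"
    unfolding uniformly_continuous_on_def by metis
  have "(\<lambda>n. b / real n) \<longlonglongrightarrow> 0" by (rule lim_const_over_n)
  then have "eventually (\<lambda>n. b / real n < \<delta>) sequentially" using \<delta>(1) by (rule order_tendstoD(2))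
  moreover have "eventually (\<lambda>n::nat. n > 0) sequentially" by (rule eventually_gt_at_top)
  ultimately show "eventually (\<lambda>n. dist (\<Sum>i<n. b / real n * h (real i * (b / real n))) (integral {0..b} h) < r) sequentially"
  proof eventually_elim
    fix n :: nat assume n: "b / real n < \<delta>" "n > 0"
    have nb: "real n * (b / real n) = b" using n by simp
    have "\<bar>integral {0..real n * (b / real n)} h - (\<Sum>i<n. b / real n * h (real i * (b / real n)))\<bar> \<le> r / (2 * b) * (real n * (b / real n))"
    proof (rule riemann_sum_bound[OF h])
      fix x y :: real assume xy: "0 \<le> x" "x \<le> y" "y \<le> b" "y \<le> x + b / real n"
      then have "dist (h y) (h x) < r / (2 * b)" using n by (intro \<delta>(2)) (auto simp: dist_real_def)
      then show "\<bar>h y - h x\<bar> \<le> r / (2 * b)" by (simp add: dist_real_def)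
    qed (use b nb in auto)
    then have "\<bar>integral {0..b} h - (\<Sum>i<n. b / real n * h (real i * (b / real n)))\<bar> \<le> r / (2 * b) * b" unfolding nb .
    also have "\<dots> < r" using r b by simp
    finally show "dist (\<Sum>i<n. b / real n * h (real i * (b / real n))) (integral {0..b} h) < r"
      by (simp add: dist_real_def abs_minus_commute)
  qed
qed

lemma prob_space_uniform_interval: "prob_space (uniform_measure lborel {0..2 * pi})"
  by (rule prob_space_uniform_measure) simp_all

lemma cis_measurable: "cis \<in> measurable borel borel"
  by (intro borel_measurable_continuous_onI continuous_intros)

lemma prob_space_uniform_circle: "prob_space uniform_circle"
  unfolding uniform_circle_def
  by (rule prob_space.prob_space_distr[OF prob_space_uniform_interval]) (use cis_measurable in simp)

lemma sets_uniform_circle [simp]: "sets uniform_circle = sets borel"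
  by (simp add: uniform_circle_def)

lemma integral_uniform_circle:
  fixes f :: "complex \<Rightarrow> real"
  assumes f: "continuous_on UNIV f"
  shows "integral\<^sup>L uniform_circle f = integral {0..2 * pi} (\<lambda>t. f (cis t)) / (2 * pi)"
proof -
  have fb: "f \<in> borel_measurable borel" using f by (rule borel_measurable_continuous_onI)
  have cont: "continuous_on {0..2 * pi} (\<lambda>t. f (cis t))"
    by (rule continuous_on_compose2[OF f]) (auto intro: continuous_intros)
  have "integral\<^sup>L uniform_circle f = integral\<^sup>L (uniform_measure lborel {0..2 * pi}) (\<lambda>t. f (cis t))"
    unfolding uniform_circle_def using fb cis_measurable by (intro integral_distr) auto
  also have "\<dots> = integral\<^sup>L (density lborel (\<lambda>t. ennreal (indicator {0..2 * pi} t / (2 * pi)))) (\<lambda>t. f (cis t))"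
  proof -
    have "uniform_measure lborel {0..2 * pi} = density lborel (\<lambda>t. ennreal (indicator {0..2 * pi} t / (2 * pi)))"
      unfolding uniform_measure_def
      by (intro density_cong) (auto simp: divide_ennreal[symmetric] split: split_indicator)
    then show ?thesis by simp
  qed
  also have "\<dots> = integral\<^sup>L lborel (\<lambda>t. (indicator {0..2 * pi} t / (2 * pi)) *\<^sub>R f (cis t))"
    using measurable_compose[OF cis_measurable fb] by (intro integral_density) auto
  also have "\<dots> = (LINT t:{0..2 * pi}|lborel. f (cis t)) / (2 * pi)"
    unfolding set_lebesgue_integral_def by (simp add: integral_divide_zero[symmetric] del: integral_divide_zero)
  also have "(LINT t:{0..2 * pi}|lborel. f (cis t)) = integral {0..2 * pi} (\<lambda>t. f (cis t))"
    by (rule set_borel_integral_eq_integral(2)[OF borel_integrable_atLeastAtMost'[OF cont]])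
  finally show ?thesis .
qed

text \<open>An average over the \<open>n\<close>-th roots of unity is a left Riemann sum of step
  \<open>2 * pi / n\<close> for the integral over the circle.\<close>

lemma root_average_tendsto:
  assumes f: "continuous_on UNIV f"
  shows "root_average f \<longlonglongrightarrow> integral\<^sup>L uniform_circle f"
proof -
  have cont: "continuous_on {0..2 * pi} (\<lambda>t. f (cis t))"
    by (rule continuous_on_compose2[OF f]) (auto intro: continuous_intros)
  have "(\<lambda>n. (\<Sum>i<n. 2 * pi / real n * f (cis (real i * (2 * pi / real n)))) / (2 * pi)) \<longlonglongrightarrow> integral {0..2 * pi} (\<lambda>t. f (cis t)) / (2 * pi)"
    by (intro tendsto_divide tendsto_const riemann_sum_tendsto[OF cont]) auto
  moreover have "(\<Sum>i<n. 2 * pi / real n * f (cis (real i * (2 * pi / real n)))) / (2 * pi) = root_average f n" for n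
  proof -
    have "cis (real i * (2 * pi / real n)) = unit_root n ^ i" for i unfolding unit_root_power by (simp add: mult_ac)
    then show ?thesis by (simp only: sum_distrib_left[symmetric] root_average_def) simp
  qed
  ultimately show ?thesis unfolding integral_uniform_circle[OF f] by simp
qed

text \<open>The construction \<open>measure_of\<close> keeps its set function only if that function
  is countably additive. Exhibiting a measure which agrees with it on the Borel sets settles this
  and identifies the result.\<close>

lemma measure_of_eq_borel:
  fixes M :: "'b::topological_space measure"
  assumes "sets M = sets borel" and "\<And>B. B \<in> sets borel \<Longrightarrow> g B = emeasure M B"
  shows "measure_of UNIV (sets borel) g = M"
proof -
  have "space M = UNIV" using sets_eq_imp_space_eq[OF assms(1)] by simp
  moreover have "measure_of UNIV (sets borel) g = measure_of UNIV (sets borel) (emeasure M)"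
  proof (rule measure_of_eq)
    fix B :: "'b set" assume "B \<in> sigma_sets UNIV (sets borel)"
    then have "B \<in> sets borel" using sets.sigma_sets_eq[of "borel :: 'b measure"] by simp
    then show "g B = emeasure M B" by (rule assms(2))
  qed simp
  ultimately show ?thesis using measure_of_of_measure[of M] assms(1) by simp
qed

text \<open>The index 0 stands for infinity: the weak limit of the uniform measures on the \<open>n\<close>-th roots of unity.\<close>

definition root_measure :: "nat \<Rightarrow> complex measure" where
  "root_measure n = (if n = 0 then uniform_circle
     else distr (measure_pmf (pmf_of_set {..<n})) borel (\<lambda>e. unit_root n ^ e))"

lemma sets_root_measure [simp]: "sets (root_measure n) = sets borel"
  by (simp add: root_measure_def)

lemma prob_space_root_measure: "prob_space (root_measure n)"
  unfolding root_measure_def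
  by (auto intro!: prob_space_uniform_circle prob_space.prob_space_distr measure_pmf.prob_space_axioms)

lemma emeasure_root_measure:
  assumes "B \<in> sets borel"
  shows "emeasure (root_measure (Suc n)) B = (\<Sum>k<Suc n. indicator B (cis (2 * real k * pi / real (Suc n)))) / ennreal (real (Suc n))"
proof -
  have "emeasure (root_measure (Suc n)) B = (\<integral>\<^sup>+e. indicator B (unit_root (Suc n) ^ e) \<partial>measure_pmf (pmf_of_set {..<Suc n}))"
    unfolding root_measure_def using assms
    by (simp add: nn_integral_indicator[symmetric] nn_integral_distr del: nn_integral_indicator)
  also have "\<dots> = (\<Sum>k<Suc n. indicator B (unit_root (Suc n) ^ k)) / ennreal (real (card {..<Suc n}))"
    by (subst nn_integral_pmf_of_set)
       (auto simp: ennreal_of_nat_eq_real_of_nat simp del: of_nat_Suc sum.lessThan_Suc)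
  also have "\<dots> = (\<Sum>k<Suc n. indicator B (cis (2 * real k * pi / real (Suc n)))) / ennreal (real (Suc n))"
    unfolding unit_root_power by (simp add: mult_ac del: sum.lessThan_Suc of_nat_Suc)
  finally show ?thesis .
qed

lemma integral_root_measure:
  fixes f :: "complex \<Rightarrow> real"
  assumes f: "f \<in> borel_measurable borel"
  shows "integral\<^sup>L (root_measure (Suc n)) f = root_average f (Suc n)"
proof -
  have "integral\<^sup>L (root_measure (Suc n)) f = measure_pmf.expectation (pmf_of_set {..<Suc n}) (\<lambda>e. f (unit_root (Suc n) ^ e))"
    unfolding root_measure_def using f by (simp add: integral_distr)
  also have "\<dots> = (\<Sum>e<Suc n. f (unit_root (Suc n) ^ e)) / real (card {..<Suc n})"
    by (subst integral_pmf_of_set) auto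
  finally show ?thesis by (simp add: root_average_def)
qed

lemma measurable_root_measure: "root_measure \<in> measurable (measure_pmf q) (subprob_algebra borel)"
proof -
  have "root_measure n \<in> space (subprob_algebra borel)" for n
    using prob_space_imp_subprob_space[OF prob_space_root_measure] by (simp add: space_subprob_algebra)
  then show ?thesis by (simp add: measurable_pmf_measure1)
qed

context
  fixes m :: "nat \<Rightarrow> real" and minf :: real
  assumes nonneg: "\<And>n. n \<ge> 1 \<Longrightarrow> 0 \<le> m n" and summable_m: "summable (\<lambda>n. m (Suc n))"
    and minf: "minf = 1 - (\<Sum>n. m (Suc n))" "0 \<le> minf"
begin

text \<open>The weights, with \<open>minf\<close> placed at index 0, sum to 1 and form a
  distribution on the indices; the mixture is the law obtained by drawing an index and then a point
  from the corresponding measure.\<close>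

lemma circle_mixture_bind:
  obtains q :: "nat pmf" where "circle_mixture m minf = measure_pmf q \<bind> root_measure"
    and "pmf q 0 = minf" "\<And>n. pmf q (Suc n) = m (Suc n)"
proof -
  define w where "w n = (if n = 0 then minf else m n)" for n
  have w0: "0 \<le> w n" for n using nonneg[of n] minf(2) by (simp add: w_def)
  have "(\<lambda>n. w (Suc n)) sums (\<Sum>n. m (Suc n))" unfolding w_def using summable_sums[OF summable_m] by simp
  then have "w sums ((\<Sum>n. m (Suc n)) + w 0)" by (rule sums_Suc)
  then have w1: "w sums 1" by (simp add: w_def minf(1))
  have prob: "(\<integral>\<^sup>+n. ennreal (w n) \<partial>count_space UNIV) = 1"
    unfolding nn_integral_count_space_nat
    using suminf_ennreal_eq[OF w0 w1] by simp
  define q where "q = embed_pmf w"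
  have pq: "pmf q n = w n" for n unfolding q_def by (rule pmf_embed_pmf[OF w0 prob])
  have "circle_mixture m minf = measure_pmf q \<bind> root_measure"
    unfolding circle_mixture_def
  proof (rule measure_of_eq_borel)
    show "sets (measure_pmf q \<bind> root_measure) = sets borel"
      by (rule sets_bind_measurable[OF measurable_root_measure]) simp
    fix B :: "complex set" assume B: "B \<in> sets borel"
    have "emeasure (measure_pmf q \<bind> root_measure) B = (\<integral>\<^sup>+n. emeasure (root_measure n) B \<partial>measure_pmf q)"
      by (rule emeasure_bind[OF _ measurable_root_measure B]) simp
    also have "\<dots> = (\<Sum>n. ennreal (w n) * emeasure (root_measure n) B)"
      unfolding nn_integral_measure_pmf nn_integral_count_space_nat pq ..
    also have "\<dots> = (\<Sum>n. ennreal (w (Suc n)) * emeasure (root_measure (Suc n)) B) + ennreal (w 0) * emeasure (root_measure 0) B"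
    proof -
      have "(\<lambda>n. ennreal (w (Suc n)) * emeasure (root_measure (Suc n)) B) sums
        (\<Sum>n. ennreal (w (Suc n)) * emeasure (root_measure (Suc n)) B)" by (intro summable_sums summableI)
      from sums_unique[OF sums_Suc[OF this]] show ?thesis by simp
    qed
    also have "(\<Sum>n. ennreal (w (Suc n)) * emeasure (root_measure (Suc n)) B) =
        (\<Sum>n. \<Sum>k<Suc n. ennreal (m (Suc n) / real (Suc n)) * indicator B (cis (2 * real k * pi / real (Suc n))))"
    proof (rule suminf_cong)
      fix n
      have "ennreal (w (Suc n)) * ((\<Sum>k<Suc n. indicator B (cis (2 * real k * pi / real (Suc n)))) / ennreal (real (Suc n)))
        = ennreal (m (Suc n)) / ennreal (real (Suc n)) * (\<Sum>k<Suc n. indicator B (cis (2 * real k * pi / real (Suc n))))"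
        unfolding w_def by (simp add: divide_ennreal_def mult_ac del: sum.lessThan_Suc of_nat_Suc)
      also have "ennreal (m (Suc n)) / ennreal (real (Suc n)) = ennreal (m (Suc n) / real (Suc n))"
        using nonneg[of "Suc n"] by (intro divide_ennreal) auto
      finally show "ennreal (w (Suc n)) * emeasure (root_measure (Suc n)) B =
        (\<Sum>k<Suc n. ennreal (m (Suc n) / real (Suc n)) * indicator B (cis (2 * real k * pi / real (Suc n))))"
        unfolding emeasure_root_measure[OF B] sum_distrib_left .
    qed
    finally show "(\<Sum>n. \<Sum>k<Suc n. ennreal (m (Suc n) / real (Suc n)) * indicator B (cis (2 * real k * pi / real (Suc n))))
        + ennreal minf * emeasure uniform_circle B = emeasure (measure_pmf q \<bind> root_measure) B"
      by (simp only: w_def root_measure_def[of 0] if_True simp_thms)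
  qed
  then show ?thesis using that[of q] pq by (simp add: w_def)
qed

text \<open>Each statement holds for every component and passes through the random index. For
  integrals, boundedness of \<open>f\<close> makes the resulting series absolutely convergent, and
  its term at index 0 is the uniform part.\<close>

lemma circle_mixture_facts:
  shows "prob_space (circle_mixture m minf)" "measure (circle_mixture m minf) (sphere 0 1) = 1"
    and "\<And>f. continuous_on UNIV f \<Longrightarrow> bounded (range f) \<Longrightarrow>
      integral\<^sup>L (circle_mixture m minf) f = minf * integral\<^sup>L uniform_circle f + (\<Sum>n. m (Suc n) * root_average f (Suc n))"
proof -
  obtain q where q: "circle_mixture m minf = measure_pmf q \<bind> root_measure"
    and q0: "pmf q 0 = minf" and qS: "\<And>n. pmf q (Suc n) = m (Suc n)" using circle_mixture_bind by blast
  show "prob_space (circle_mixture m minf)"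
    unfolding q
    by (rule prob_space.prob_space_bind[OF measure_pmf.prob_space_axioms _ measurable_root_measure])
       (simp add: prob_space_root_measure)
  have one: "emeasure (root_measure n) (sphere 0 1) = 1" for n
  proof (cases "n = 0")
    case True
    interpret U: prob_space "uniform_measure lborel {0..2 * pi}" by (rule prob_space_uniform_interval)
    have "emeasure (root_measure 0) (sphere 0 1) = emeasure (uniform_measure lborel {0..2 * pi}) (cis -` sphere 0 1 \<inter> space lborel)"
      unfolding root_measure_def uniform_circle_def using cis_measurable by (simp add: emeasure_distr)
    also have "cis -` sphere 0 1 \<inter> space lborel = space (uniform_measure lborel {0..2 * pi})" by (auto simp: dist_norm)
    finally show ?thesis using True U.emeasure_space_1 by simp
  next
    case False
    have "emeasure (root_measure n) (sphere 0 1) = emeasure (measure_pmf (pmf_of_set {..<n})) ((\<lambda>e. unit_root n ^ e) -` sphere 0 1)"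
      unfolding root_measure_def using False by (simp add: emeasure_distr)
    also have "(\<lambda>e. unit_root n ^ e) -` sphere 0 1 = UNIV" by (auto simp: unit_root_power dist_norm)
    finally show ?thesis by simp
  qed
  have "emeasure (circle_mixture m minf) (sphere 0 1) = (\<integral>\<^sup>+n. emeasure (root_measure n) (sphere 0 1) \<partial>measure_pmf q)"
    unfolding q by (rule emeasure_bind[OF _ measurable_root_measure]) auto
  then have "emeasure (circle_mixture m minf) (sphere 0 1) = 1" by (simp add: one)
  then show "measure (circle_mixture m minf) (sphere 0 1) = 1" by (simp add: measure_def)
  fix f :: "complex \<Rightarrow> real" assume f: "continuous_on UNIV f" and bd: "bounded (range f)"
  have fb: "f \<in> borel_measurable borel" using f by (rule borel_measurable_continuous_onI)
  obtain B where B: "\<And>x. \<bar>f x\<bar> \<le> B" using bd unfolding bounded_iff by auto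
  have B0: "0 \<le> B" using B[of 0] by linarith
  have "integral\<^sup>L (circle_mixture m minf) f = measure_pmf.expectation q (\<lambda>n. integral\<^sup>L (root_measure n) f)"
    unfolding q
    by (rule integral_bind[OF fb B measurable_root_measure, where B' = 1])
       (auto simp: prob_space.emeasure_space_1[OF prob_space_root_measure] intro: measure_pmf.finite_measure_axioms)
  moreover have "measure_pmf.expectation q (\<lambda>n. integral\<^sup>L (root_measure n) f) = (\<Sum>n. pmf q n * integral\<^sup>L (root_measure n) f)"
    and summ: "summable (\<lambda>n. pmf q n * integral\<^sup>L (root_measure n) f)"
  proof -
    have bound: "\<bar>integral\<^sup>L (root_measure n) f\<bar> \<le> B" for n
    proof -
      interpret R: prob_space "root_measure n" by (rule prob_space_root_measure)
      have "norm (integral\<^sup>L (root_measure n) f) \<le> (\<integral>x. norm (f x) \<partial>root_measure n)" by (rule integral_norm_bound)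
      also have "\<dots> \<le> (\<integral>x. B \<partial>root_measure n)"
        using fb B B0 by (intro integral_mono R.integrable_const_bound[of _ B] AE_I2) (auto cong: measurable_cong_sets)
      finally show ?thesis by (simp add: R.prob_space)
    qed
    have "summable (pmf q)" using summable_m unfolding qS[symmetric] by (simp add: summable_Suc_iff)
    then have "summable (\<lambda>n. B * pmf q n)" by (rule summable_mult)
    then have sn: "summable (\<lambda>n. norm (pmf q n * integral\<^sup>L (root_measure n) f))"
    proof (rule summable_comparison_test'[where N = 0])
      show "norm (norm (pmf q n * integral\<^sup>L (root_measure n) f)) \<le> B * pmf q n" for n
        using mult_left_mono[OF bound[of n] pmf_nonneg[of q n]] by (simp add: abs_mult mult.commute)
    qed
    then show "summable (\<lambda>n. pmf q n * integral\<^sup>L (root_measure n) f)" by (rule summable_norm_cancel)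
    have "measure_pmf.expectation q (\<lambda>n. integral\<^sup>L (root_measure n) f) =
      integral\<^sup>L (count_space UNIV) (\<lambda>n. pmf q n *\<^sub>R integral\<^sup>L (root_measure n) f)"
      unfolding measure_pmf_eq_density by (intro integral_density) auto
    also have "\<dots> = (\<Sum>n. pmf q n * integral\<^sup>L (root_measure n) f)"
      using sn by (subst integral_count_space_nat) (auto simp: integrable_count_space_nat_iff)
    finally show "measure_pmf.expectation q (\<lambda>n. integral\<^sup>L (root_measure n) f) = (\<Sum>n. pmf q n * integral\<^sup>L (root_measure n) f)" .
  qed
  ultimately have eq: "integral\<^sup>L (circle_mixture m minf) f = (\<Sum>n. pmf q n * integral\<^sup>L (root_measure n) f)" by simp
  show "integral\<^sup>L (circle_mixture m minf) f = minf * integral\<^sup>L uniform_circle f + (\<Sum>n. m (Suc n) * root_average f (Suc n))"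
    using eq suminf_split_head[OF summ] by (simp add: q0 qS integral_root_measure[OF fb] root_measure_def[of 0])
qed

end

section \<open>Passage to the limit\<close>

lemma cycle_upt:
  assumes n: "n \<ge> 1"
  defines "c \<equiv> cycle_of_list [1..<Suc n]"
  shows "c permutes {1..n}" "least_power c 1 = n" "num_cycles n c = 1" "\<And>l. l \<in> {1..n} \<Longrightarrow> orbit c l = {1..n}"
proof -
  have set: "set [1..<Suc n] = {1..n}" by auto
  show c: "c permutes {1..n}" using cycle_permutes[of "[1..<Suc n]"] unfolding c_def set .
  note P = permutation_if_permutes[OF c]
  \<comment> \<open>A cyclic permutation built from a list acts on that list by rotation, so the
    powers applied to its head can be read off from the rotated list.\<close>
  have pow: "(c ^^ j) 1 = Suc (j mod n)" for j
  proof -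
    have "map (c ^^ j) [1..<Suc n] ! 0 = rotate j [1..<Suc n] ! 0"
      unfolding c_def by (subst cyclic_rotation) simp_all
    moreover have "map (c ^^ j) [1..<Suc n] ! 0 = (c ^^ j) 1" using n by (subst nth_map) (simp_all del: upt_Suc)
    moreover have "rotate j [1..<Suc n] ! 0 = [1..<Suc n] ! (j mod n)" using n by (subst nth_rotate) simp_all
    moreover have "[1..<Suc n] ! (j mod n) = Suc (j mod n)" using n by (subst nth_upt) simp_all
    ultimately show ?thesis by simp
  qed
  have orb1: "orbit c 1 = {1..n}"
  proof (intro Set.equalityI subsetI)
    fix x assume "x \<in> orbit c 1"
    then obtain j where "x = (c ^^ j) 1" using orbit_funpow[OF P] by blast
    then show "x \<in> {1..n}" using pow[of j] n mod_less_divisor[of n j] by (simp add: Suc_le_eq)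
  next
    fix x assume x: "x \<in> {1..n}"
    then have "(x - 1) mod n = x - 1" by (intro mod_less) auto
    then have "x = (c ^^ (x - 1)) 1" using pow[of "x - 1"] x by simp
    then show "x \<in> orbit c 1" unfolding orbit_altdef_permutation[OF P] by blast
  qed
  show "least_power c 1 = n" using card_orbit[OF P, of 1] unfolding orb1 by simp
  show orb: "orbit c l = {1..n}" if "l \<in> {1..n}" for l
    using orbit_eq_if_mem[OF P, of l 1] that unfolding orb1 by simp
  have "orbit c ` {1..n} = {{1..n}}" using orb n by force
  then show "num_cycles n c = 1" by (simp add: num_cycles_def)
qed

text \<open>With only one cycle there is no room for a collision between cycles, so periodic and
  pattern tuples coincide. They are parametrised by their value at position 1, a point of period
  \<open>n\<close>.\<close>

lemma exclusive_moment_cycle: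
  assumes n: "n \<ge> 1" and S: "S permutes {1..N}"
  shows "exclusive_moment n (cycle_of_list [1..<Suc n]) N S = real (period_count N S n) / real N"
proof -
  note c = cycle_upt[OF n]
  let ?c = "cycle_of_list [1..<Suc n]"
  have R: "transversal n ?c {1}" unfolding transversal_def using n c(4) by (auto simp: image_iff)
  have "pattern_tuples n ?c N S = periodic_tuples n ?c N S"
  proof (intro Set.equalityI subsetI)
    fix i assume i: "i \<in> periodic_tuples n ?c N S"
    show "i \<in> pattern_tuples n ?c N S"
    proof (rule ccontr)
      assume "i \<notin> pattern_tuples n ?c N S"
      then obtain l l' where "l \<in> {1..n}" "l' \<in> {1..n}" "orbit ?c l \<noteq> orbit ?c l'"
        using periodic_not_pattern[OF c(1) S i] by blast
      then show False using c(4) by simp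
    qed
  qed (use pattern_tuples_subset_periodic[OF c(1) S] in blast)
  then have "card (pattern_tuples n ?c N S) = period_count N S n"
    using card_periodic_tuples[OF c(1) S R] c(2) by simp
  then show ?thesis unfolding exclusive_moment_eq c(3) by (simp only: power_one_right)
qed

text \<open>The spectral formula tested on the constant function 1.\<close>

lemma sum_period_count:
  assumes p: "p permutes {1..N}" and N: "N > 0"
  shows "(\<Sum>n=1..N. real (period_count N p n) / real N) = 1"
proof -
  have "(\<Sum>n=1..N. real (period_count N p n) / real N) = (\<Sum>n=1..N. real (period_count N p n) / real N * root_average (\<lambda>_. 1) n)"
    by (intro sum.cong refl) (simp add: root_average_def)
  also have "\<dots> = 1" unfolding expectation_eigenvalue_distribution[OF p N, symmetric] by simp
  finally show ?thesis .
qed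

text \<open>The mean distribution is the composition of the law of the random permutation with the
  kernel sending a permutation to its spectrum. Integration is then done first over the spectrum,
  where the dependence on \<open>f\<close> reduces to root averages.\<close>

lemma integral_mean_eigenvalue_distribution:
  fixes f :: "complex \<Rightarrow> real"
  assumes M: "prob_space M" and X: "X \<in> measurable M (count_space {p. p permutes {1..N}})" and N: "N > 0"
    and f: "continuous_on UNIV f" and bd: "bounded (range f)"
  shows "integral\<^sup>L (mean_eigenvalue_distribution M (\<lambda>\<omega>. perm_matrix N (X \<omega>))) f =
    (\<Sum>n=1..N. (\<integral>\<omega>. real (period_count N (X \<omega>) n) / real N \<partial>M) * root_average f n)"
proof -
  interpret prob_space M by (rule M)
  let ?E = "{p. p permutes {1..N}}"
  define K where "K p = distr (measure_pmf (eigenvalue_distribution (perm_matrix N p))) borel (\<lambda>x. x)" for p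
  have prob_K: "prob_space (K p)" for p
    unfolding K_def by (intro prob_space.prob_space_distr measure_pmf.prob_space_axioms) simp
  have sets_K: "sets (K p) = sets borel" for p by (simp add: K_def)
  have K: "K \<in> measurable (count_space ?E) (subprob_algebra borel)"
    using prob_space_imp_subprob_space[OF prob_K] sets_K by (auto simp: space_subprob_algebra)
  note KX = measurable_compose[OF X K]
  have XE: "X \<omega> permutes {1..N}" if "\<omega> \<in> space M" for \<omega> using measurable_space[OF X that] by simp
  have eq: "mean_eigenvalue_distribution M (\<lambda>\<omega>. perm_matrix N (X \<omega>)) = M \<bind> (\<lambda>\<omega>. K (X \<omega>))"
    unfolding mean_eigenvalue_distribution_def
  proof (rule measure_of_eq_borel)
    show "sets (M \<bind> (\<lambda>\<omega>. K (X \<omega>))) = sets borel" by (rule sets_bind_measurable[OF KX not_empty])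
    fix B :: "complex set" assume B: "B \<in> sets borel"
    have "emeasure (M \<bind> (\<lambda>\<omega>. K (X \<omega>))) B = (\<integral>\<^sup>+\<omega>. emeasure (K (X \<omega>)) B \<partial>M)"
      by (rule emeasure_bind[OF not_empty KX B])
    then show "(\<integral>\<^sup>+\<omega>. emeasure (measure_pmf (eigenvalue_distribution (perm_matrix N (X \<omega>)))) B \<partial>M) =
        emeasure (M \<bind> (\<lambda>\<omega>. K (X \<omega>))) B"
      using B by (simp add: K_def emeasure_distr)
  qed
  have fb: "f \<in> borel_measurable borel" using f by (rule borel_measurable_continuous_onI)
  obtain B where B: "\<And>x. \<bar>f x\<bar> \<le> B" using bd unfolding bounded_iff by auto
  have "integral\<^sup>L (mean_eigenvalue_distribution M (\<lambda>\<omega>. perm_matrix N (X \<omega>))) f = (\<integral>\<omega>. integral\<^sup>L (K (X \<omega>)) f \<partial>M)"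
    unfolding eq
    by (rule integral_bind[OF fb B KX finite_measure_axioms, where B' = 1])
       (auto simp: prob_space.emeasure_space_1[OF prob_K])
  also have "\<dots> = (\<integral>\<omega>. (\<Sum>n=1..N. real (period_count N (X \<omega>) n) / real N * root_average f n) \<partial>M)"
  proof (rule Bochner_Integration.integral_cong[OF refl])
    fix \<omega> assume "\<omega> \<in> space M"
    have "integral\<^sup>L (K (X \<omega>)) f = measure_pmf.expectation (eigenvalue_distribution (perm_matrix N (X \<omega>))) f"
      unfolding K_def using fb by (simp add: integral_distr)
    then show "integral\<^sup>L (K (X \<omega>)) f = (\<Sum>n=1..N. real (period_count N (X \<omega>) n) / real N * root_average f n)"
      using expectation_eigenvalue_distribution[OF XE[OF \<open>\<omega> \<in> space M\<close>] N] by simp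
  qed
  also have "\<dots> = (\<Sum>n=1..N. (\<integral>\<omega>. real (period_count N (X \<omega>) n) / real N * root_average f n \<partial>M))"
  proof (rule Bochner_Integration.integral_sum)
    fix n
    have "(\<lambda>\<omega>. real (period_count N (X \<omega>) n) / real N) \<in> borel_measurable M"
      by (rule measurable_compose[OF X]) simp
    then have "integrable M (\<lambda>\<omega>. real (period_count N (X \<omega>) n) / real N)"
      using N period_count_le by (intro integrable_const_bound[where B = 1]) auto
    then show "integrable M (\<lambda>\<omega>. real (period_count N (X \<omega>) n) / real N * root_average f n)"
      by (rule integrable_mult_left)
  qed
  finally show ?thesis by simp
qed

text \<open>Finite partial sums pass to the limit, so total mass at most 1 is retained; equality may
  fail because mass can move to ever larger indices.\<close>

lemma subprobability_limit:
  fixes a :: "nat \<Rightarrow> nat \<Rightarrow> real"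
  assumes nonneg: "\<And>N n. N \<ge> 2 \<Longrightarrow> 0 \<le> a N n" and total: "\<And>N. N \<ge> 2 \<Longrightarrow> (\<Sum>n=1..N. a N n) = 1"
    and lim: "\<And>n. n \<ge> 1 \<Longrightarrow> (\<lambda>N. a N n) \<longlonglongrightarrow> m n"
  shows "n \<ge> 1 \<Longrightarrow> 0 \<le> m n" and "summable (\<lambda>n. m (Suc n))" and "(\<Sum>n. m (Suc n)) \<le> 1"
proof -
  show m0: "0 \<le> m n" if "n \<ge> 1" for n
    using nonneg by (intro LIMSEQ_le_const[OF lim[OF that]]) auto
  have part: "(\<Sum>n<K. m (Suc n)) \<le> 1" for K
  proof (rule LIMSEQ_le_const2)
    show "(\<lambda>N. \<Sum>n<K. a N (Suc n)) \<longlonglongrightarrow> (\<Sum>n<K. m (Suc n))" by (intro tendsto_sum lim) simp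
    have "(\<Sum>n<K. a N (Suc n)) \<le> 1" if N: "N \<ge> max 2 K" for N
    proof -
      have "(\<Sum>n<K. a N (Suc n)) = (\<Sum>n\<in>Suc ` {..<K}. a N n)" by (simp add: sum.reindex)
      also have "\<dots> \<le> (\<Sum>n=1..N. a N n)" using N nonneg by (intro sum_mono2) auto
      finally show ?thesis using total N by simp
    qed
    then show "\<exists>N. \<forall>n\<ge>N. (\<Sum>i<K. a n (Suc i)) \<le> 1" by blast
  qed
  show sm: "summable (\<lambda>n. m (Suc n))" by (rule summableI_nonneg_bounded[OF _ part]) (simp add: m0)
  show "(\<Sum>n. m (Suc n)) \<le> 1" by (rule suminf_le_const[OF sm part])
qed

text \<open>Escaping mass only sees values of \<open>F\<close> close to \<open>L\<close>. After
  subtraction of \<open>L\<close> the tail beyond a large index \<open>K\<close> is uniformly small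
  for all \<open>N\<close> and for the limit, while finitely many terms converge individually; total
  mass 1 puts \<open>L\<close> back.\<close>

lemma weighted_average_tendsto:
  fixes a :: "nat \<Rightarrow> nat \<Rightarrow> real"
  assumes nonneg: "\<And>N n. N \<ge> 2 \<Longrightarrow> 0 \<le> a N n" and total: "\<And>N. N \<ge> 2 \<Longrightarrow> (\<Sum>n=1..N. a N n) = 1"
    and lim: "\<And>n. n \<ge> 1 \<Longrightarrow> (\<lambda>N. a N n) \<longlonglongrightarrow> m n" and F: "F \<longlonglongrightarrow> L"
  shows "(\<lambda>N. \<Sum>n=1..N. a N n * F n) \<longlonglongrightarrow> (1 - (\<Sum>n. m (Suc n))) * L + (\<Sum>n. m (Suc n) * F (Suc n))"
proof -
  note facts = subprobability_limit[of a m, OF nonneg total lim]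
  have m0: "0 \<le> m (Suc n)" for n using facts(1)[of "Suc n"] by simp
  have sm: "summable (\<lambda>n. m (Suc n))" using facts(2) by simp
  have sm1: "(\<Sum>n. m (Suc n)) \<le> 1" using facts(3) by simp
  define G where "G n = F n - L" for n
  have G: "G \<longlonglongrightarrow> 0" unfolding G_def using tendsto_diff[OF F tendsto_const[of L]] by simp
  obtain B where B: "\<And>n. \<bar>F n\<bar> \<le> B"
    using Bseq_bdd_above convergent_imp_Bseq[OF convergentI[OF F]] unfolding Bseq_def by auto
  have sF: "summable (\<lambda>n. m (Suc n) * F (Suc n))"
  proof (rule summable_comparison_test'[where N = 0])
    show "summable (\<lambda>n. B * m (Suc n))" by (rule summable_mult[OF sm])
    show "norm (m (Suc n) * F (Suc n)) \<le> B * m (Suc n)" for n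
      using mult_left_mono[OF B[of "Suc n"] m0[of n]] m0[of n] by (simp add: abs_mult mult.commute)
  qed
  have sG: "summable (\<lambda>n. m (Suc n) * G (Suc n))"
    unfolding G_def right_diff_distrib by (intro summable_diff sF summable_mult2 sm)
  have "(\<lambda>N. \<Sum>n=1..N. a N n * G n) \<longlonglongrightarrow> (\<Sum>n. m (Suc n) * G (Suc n))"
  proof (rule tendstoI)
    fix e :: real assume e: "e > 0"
    then have "eventually (\<lambda>n. \<bar>G n\<bar> < e / 3) sequentially" using tendstoD[OF G, of "e / 3"] by (simp add: dist_real_def)
    then obtain K where K: "\<And>n. n \<ge> K \<Longrightarrow> \<bar>G n\<bar> < e / 3" unfolding eventually_sequentially by blast
    have "(\<lambda>N. \<Sum>n<K. a N (Suc n) * G (Suc n)) \<longlonglongrightarrow> (\<Sum>n<K. m (Suc n) * G (Suc n))"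
      by (intro tendsto_sum tendsto_mult lim tendsto_const) simp
    from tendstoD[OF this, of "e / 3"] e
    have "eventually (\<lambda>N. \<bar>(\<Sum>n<K. a N (Suc n) * G (Suc n)) - (\<Sum>n<K. m (Suc n) * G (Suc n))\<bar> < e / 3) sequentially"
      by (simp add: dist_real_def)
    moreover have "eventually (\<lambda>N. N \<ge> max 2 K) sequentially" by (rule eventually_ge_at_top)
    ultimately show "eventually (\<lambda>N. dist (\<Sum>n=1..N. a N n * G n) (\<Sum>n. m (Suc n) * G (Suc n)) < e) sequentially"
    proof eventually_elim
      case (elim N)
      have N2: "N \<ge> 2" using elim(2) by simp
      have "{1..N} = Suc ` {..<K} \<union> {Suc K..N}" using elim(2) by (auto simp: image_iff) (metis Suc_pred' not_less_eq_eq lessThan_iff less_Suc_eq_le not_le)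
      then have split: "(\<Sum>n=1..N. a N n * G n) = (\<Sum>n<K. a N (Suc n) * G (Suc n)) + (\<Sum>n=Suc K..N. a N n * G n)"
        by (simp only:) (subst sum.union_disjoint, auto simp: sum.reindex)
      have "\<bar>\<Sum>n=Suc K..N. a N n * G n\<bar> \<le> (\<Sum>n=Suc K..N. a N n * (e / 3))"
      proof (rule order_trans[OF sum_abs sum_mono])
        fix n assume "n \<in> {Suc K..N}"
        then have "\<bar>G n\<bar> \<le> e / 3" using K[of n] by simp
        then show "\<bar>a N n * G n\<bar> \<le> a N n * (e / 3)"
          using nonneg[OF N2, of n] by (simp only: abs_mult abs_of_nonneg mult_left_mono)
      qed
      also have "\<dots> = (\<Sum>n=Suc K..N. a N n) * (e / 3)" by (rule sum_distrib_right[symmetric])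
      also have "\<dots> \<le> 1 * (e / 3)"
      proof (rule mult_right_mono)
        have "(\<Sum>n=Suc K..N. a N n) \<le> (\<Sum>n=1..N. a N n)" using nonneg[OF N2] by (intro sum_mono2) auto
        then show "(\<Sum>n=Suc K..N. a N n) \<le> 1" using total[OF N2] by simp
      qed (use e in simp)
      finally have 1: "\<bar>\<Sum>n=Suc K..N. a N n * G n\<bar> \<le> e / 3" by simp
      have tail: "(\<Sum>n. m (Suc n) * G (Suc n)) = (\<Sum>n. m (Suc (n + K)) * G (Suc (n + K))) + (\<Sum>n<K. m (Suc n) * G (Suc n))"
        by (rule suminf_split_initial_segment[OF sG])
      have s1: "summable (\<lambda>n. m (Suc (n + K)))" using sm by (subst summable_iff_shift)
      have s2: "summable (\<lambda>n. m (Suc (n + K)) * (e / 3))" by (rule summable_mult2[OF s1])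
      have le: "norm (m (Suc (n + K)) * G (Suc (n + K))) \<le> m (Suc (n + K)) * (e / 3)" for n
        using mult_left_mono[OF less_imp_le[OF K[of "Suc (n + K)"]] m0[of "n + K"]] m0[of "n + K"]
        by (simp add: abs_mult)
      have "norm (\<Sum>n. m (Suc (n + K)) * G (Suc (n + K))) \<le> (\<Sum>n. m (Suc (n + K)) * (e / 3))"
        by (rule norm_suminf_le[OF le s2])
      also have "\<dots> = (\<Sum>n. m (Suc (n + K))) * (e / 3)" by (rule suminf_mult2[OF s1, symmetric])
      also have "\<dots> \<le> 1 * (e / 3)"
      proof (rule mult_right_mono)
        have "(\<Sum>n. m (Suc n)) = (\<Sum>n. m (Suc (n + K))) + (\<Sum>n<K. m (Suc n))"
          by (rule suminf_split_initial_segment[OF sm])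
        then show "(\<Sum>n. m (Suc (n + K))) \<le> 1" using sm1 sum_nonneg[of "{..<K}" "\<lambda>n. m (Suc n)"] m0 by simp
      qed (use e in simp)
      finally have 2: "\<bar>\<Sum>n. m (Suc (n + K)) * G (Suc (n + K))\<bar> \<le> e / 3" by simp
      show ?case unfolding split tail dist_real_def using 1 2 elim(1) by linarith
    qed
  qed
  then have "(\<lambda>N. L + (\<Sum>n=1..N. a N n * G n)) \<longlonglongrightarrow> L + (\<Sum>n. m (Suc n) * G (Suc n))" by (intro tendsto_intros)
  moreover have "eventually (\<lambda>N. L + (\<Sum>n=1..N. a N n * G n) = (\<Sum>n=1..N. a N n * F n)) sequentially"
    using eventually_ge_at_top[of 2]
  proof eventually_elim
    case (elim N)
    have "(\<Sum>n=1..N. a N n * G n) = (\<Sum>n=1..N. a N n * F n) - (\<Sum>n=1..N. a N n) * L"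
      unfolding G_def right_diff_distrib sum_subtractf sum_distrib_right ..
    then show ?case using total[OF elim] by simp
  qed
  ultimately have "(\<lambda>N. \<Sum>n=1..N. a N n * F n) \<longlonglongrightarrow> L + (\<Sum>n. m (Suc n) * G (Suc n))"
    by (rule Lim_transform_eventually)
  moreover have G_eq: "(\<Sum>n. m (Suc n) * G (Suc n)) = (\<Sum>n. m (Suc n) * F (Suc n)) - (\<Sum>n. m (Suc n)) * L"
    unfolding G_def right_diff_distrib suminf_mult2[OF sm]
    by (rule suminf_diff[symmetric, OF sF summable_mult2[OF sm]])
  have "L + (\<Sum>n. m (Suc n) * G (Suc n)) = (1 - (\<Sum>n. m (Suc n))) * L + (\<Sum>n. m (Suc n) * F (Suc n))"
    unfolding G_eq by (simp add: left_diff_distrib)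
  ultimately show ?thesis by (simp only:)
qed

text \<open>The stability estimate requires zero initial values, whereas here they merely converge.
  Subtracting the constant initial difference \<open>d N\<close> restores this, at the price of the
  extra forcing \<open>A\<close> applied to \<open>d N\<close>, which also tends to 0.\<close>

lemma linear_system_limit:
  fixes A :: "'i \<Rightarrow> 'i \<Rightarrow> real" and y :: "nat \<Rightarrow> 'i \<Rightarrow> real \<Rightarrow> real"
  assumes I: "finite I" and T: "T \<ge> 0" and i: "i \<in> I"
    and y: "\<And>N i t. N \<ge> start \<Longrightarrow> i \<in> I \<Longrightarrow> t \<ge> 0 \<Longrightarrow>
        (y N i has_real_derivative (\<Sum>j\<in>I. A i j * y N j t) + h N i t) (at t within {0..})"
    and h: "\<And>N i t. N \<ge> start \<Longrightarrow> i \<in> I \<Longrightarrow> t \<ge> 0 \<Longrightarrow> \<bar>h N i t\<bar> \<le> \<epsilon> N" and \<epsilon>: "\<epsilon> \<longlonglongrightarrow> 0"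
    and z: "\<And>i t. i \<in> I \<Longrightarrow> t \<ge> 0 \<Longrightarrow> (z i has_real_derivative (\<Sum>j\<in>I. A i j * z j t)) (at t within {0..})"
    and init: "\<And>i. i \<in> I \<Longrightarrow> (\<lambda>N. y N i 0) \<longlonglongrightarrow> z i 0"
  shows "(\<lambda>N. y N i T) \<longlonglongrightarrow> z i T"
proof -
  obtain K where K: "K \<ge> 0"
    "\<And>y h \<epsilon> i. (\<And>i t. i \<in> I \<Longrightarrow> t \<ge> 0 \<Longrightarrow>
        (y i has_real_derivative (\<Sum>j\<in>I. A i j * y j t) + h i t) (at t within {0..})) \<Longrightarrow>
      (\<And>i. i \<in> I \<Longrightarrow> y i 0 = 0) \<Longrightarrow> (\<And>i t. i \<in> I \<Longrightarrow> t \<ge> 0 \<Longrightarrow> \<bar>h i t\<bar> \<le> \<epsilon>) \<Longrightarrow> i \<in> I \<Longrightarrow> \<bar>y i T\<bar> \<le> K * \<epsilon>"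
    by (rule linear_system_stability[OF I T, of A]) blast
  define d where "d N i = y N i 0 - z i 0" for N i
  define w where "w N i t = y N i t - z i t - d N i" for N i t
  define g where "g N i t = h N i t + (\<Sum>j\<in>I. A i j * d N j)" for N i t
  define e where "e N = \<epsilon> N + (\<Sum>i\<in>I. \<bar>\<Sum>j\<in>I. A i j * d N j\<bar>)" for N
  have d: "(\<lambda>N. d N i) \<longlonglongrightarrow> 0" if "i \<in> I" for i
    unfolding d_def using tendsto_diff[OF init[OF that] tendsto_const[of "z i 0"]] by simp
  have "(\<lambda>N. \<epsilon> N + (\<Sum>i\<in>I. \<bar>\<Sum>j\<in>I. A i j * d N j\<bar>)) \<longlonglongrightarrow> 0 + (\<Sum>i\<in>I. \<bar>\<Sum>j\<in>I. A i j * 0\<bar>)"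
    by (intro tendsto_intros \<epsilon> d)
  then have e: "e \<longlonglongrightarrow> 0" unfolding e_def by simp
  have "\<bar>w N i T\<bar> \<le> K * e N" if N: "N \<ge> start" for N
  proof (rule K(2)[where h = "g N"])
    fix i t assume it: "i \<in> I" "(t::real) \<ge> 0"
    have "(w N i has_real_derivative ((\<Sum>j\<in>I. A i j * y N j t) + h N i t) - (\<Sum>j\<in>I. A i j * z j t) - 0) (at t within {0..})"
      unfolding w_def by (intro DERIV_diff y z N it DERIV_const)
    also have "((\<Sum>j\<in>I. A i j * y N j t) + h N i t) - (\<Sum>j\<in>I. A i j * z j t) - 0 = (\<Sum>j\<in>I. A i j * w N j t) + g N i t"
      unfolding w_def g_def by (simp add: right_diff_distrib sum_subtractf)
    finally show "(w N i has_real_derivative (\<Sum>j\<in>I. A i j * w N j t) + g N i t) (at t within {0..})" .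
    have "\<bar>\<Sum>j\<in>I. A i j * d N j\<bar> \<le> (\<Sum>i\<in>I. \<bar>\<Sum>j\<in>I. A i j * d N j\<bar>)"
      by (rule member_le_sum[OF it(1), of "\<lambda>i. \<bar>\<Sum>j\<in>I. A i j * d N j\<bar>"]) (auto intro: I)
    then show "\<bar>g N i t\<bar> \<le> e N" unfolding g_def e_def using h[OF N it] by linarith
  qed (simp_all add: w_def d_def i)
  then have "eventually (\<lambda>N. norm (w N i T) \<le> K * e N) sequentially"
    by (intro eventually_sequentiallyI[of start]) simp
  moreover have "(\<lambda>N. K * e N) \<longlonglongrightarrow> 0" using tendsto_mult[OF tendsto_const e, of K] by simp
  ultimately have "(\<lambda>N. w N i T) \<longlonglongrightarrow> 0" by (rule Lim_null_comparison)
  from tendsto_add[OF tendsto_add[OF this d[OF i]] tendsto_const[of "z i T"]]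
  show ?thesis by (simp add: w_def)
qed

section \<open>The limiting system in matrix form and the convergence of expected moments\<close>

definition system_matrix :: "(nat \<Rightarrow> real) \<Rightarrow> real \<Rightarrow> nat \<Rightarrow> (nat \<Rightarrow> nat) \<Rightarrow> (nat \<Rightarrow> nat) \<Rightarrow> real" where
  "system_matrix lam \<alpha> k p r = (\<Sum>q\<in>{q \<in> {q. q permutes {1..k}}. inv_into UNIV q \<circ> p = r}. limit_coeff lam \<alpha> k p q)"

text \<open>The sum over \<open>q\<close> is regrouped by the target \<open>q^-1 \<circ> p\<close>.
  Summing over all preimages in \<open>system_matrix\<close> makes the regrouping formal, although
  \<open>p \<circ> r^-1\<close> is the only one.\<close>

lemma system_matrix_sum:
  assumes p: "p permutes {1..k}"
  shows "(\<Sum>r | r permutes {1..k}. system_matrix lam \<alpha> k p r * f r) =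
    (\<Sum>q | q permutes {1..k}. limit_coeff lam \<alpha> k p q * f (inv_into UNIV q \<circ> p))"
proof -
  let ?I = "{q. q permutes {1..k}}"
  have "(\<Sum>q\<in>?I. limit_coeff lam \<alpha> k p q * f (inv_into UNIV q \<circ> p)) =
    (\<Sum>r\<in>?I. \<Sum>q\<in>{q \<in> ?I. inv_into UNIV q \<circ> p = r}. limit_coeff lam \<alpha> k p q * f (inv_into UNIV q \<circ> p))"
    using permutes_compose[OF p permutes_inv]
    by (intro sum.group[symmetric] finite_permutation_group) blast
  also have "\<dots> = (\<Sum>r\<in>?I. system_matrix lam \<alpha> k p r * f r)"
    unfolding system_matrix_def sum_distrib_right by (intro sum.cong refl) auto
  finally show ?thesis ..
qed

lemma limit_coeff_sum:
  assumes p: "p permutes {1..k}"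
  shows "(\<Sum>q | q permutes {1..k}. limit_coeff lam \<alpha> k p q * f (inv_into UNIV q \<circ> p)) =
    drift \<alpha> k * f p +
    (\<Sum>q | q permutes {1..k} \<and> q \<noteq> id \<and> perm_le k q p. jump_coeff lam \<alpha> k q * f (inv_into UNIV q \<circ> p))"
proof -
  let ?I = "{q. q permutes {1..k}}"
  have fin: "finite ?I" by (rule finite_permutation_group)
  have "inv_into UNIV id \<circ> p = p" by (simp add: inv_id fun_eq_iff)
  then have id: "limit_coeff lam \<alpha> k p id * f (inv_into UNIV id \<circ> p) = drift \<alpha> k * f p"
    by (simp add: limit_coeff_def)
  have "(\<Sum>q\<in>?I - {id}. limit_coeff lam \<alpha> k p q * f (inv_into UNIV q \<circ> p)) =
    (\<Sum>q | q permutes {1..k} \<and> q \<noteq> id \<and> perm_le k q p. limit_coeff lam \<alpha> k p q * f (inv_into UNIV q \<circ> p))"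
    using fin by (intro sum.mono_neutral_right) (auto simp: limit_coeff_def)
  also have "\<dots> = (\<Sum>q | q permutes {1..k} \<and> q \<noteq> id \<and> perm_le k q p. jump_coeff lam \<alpha> k q * f (inv_into UNIV q \<circ> p))"
    by (intro sum.cong refl) (auto simp: limit_coeff_def)
  finally show ?thesis
    using sum.remove[OF fin, of id "\<lambda>q. limit_coeff lam \<alpha> k p q * f (inv_into UNIV q \<circ> p)"] id permutes_id by simp
qed

text \<open>The infinite system decouples over \<open>k\<close> into finite linear ones, so
  existence, uniqueness and stability can be treated for each \<open>k\<close> separately.\<close>

lemma moment_system_iff:
  "moment_system lam \<alpha> m \<longleftrightarrow> (\<forall>k\<ge>1. \<forall>p. p permutes {1..k} \<longrightarrow>
     (\<forall>t\<ge>0. (m k p has_real_derivative (\<Sum>r | r permutes {1..k}. system_matrix lam \<alpha> k p r * m k r t)) (at t within {0..})) \<and>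
     m k p 0 = (if p = id then 1 else 0))"
  unfolding moment_system_def
  by (simp only: system_matrix_sum limit_coeff_sum[where f = "\<lambda>r. m _ r _"] cong: imp_cong)

lemma moment_system_exists: "\<exists>m. moment_system lam \<alpha> m"
proof -
  have "\<exists>y. (\<forall>p\<in>{p. p permutes {1..k}}. \<forall>t. (y p has_real_derivative (\<Sum>r | r permutes {1..k}. system_matrix lam \<alpha> k p r * y r t)) (at t)) \<and>
      (\<forall>p\<in>{p. p permutes {1..k}}. y p 0 = (if p = id then 1 else 0))" for k
    by (rule linear_system_exists[OF finite_permutation_group])
  then obtain m where m: "\<And>k. (\<forall>p\<in>{p. p permutes {1..k}}. \<forall>t. (m k p has_real_derivative (\<Sum>r | r permutes {1..k}. system_matrix lam \<alpha> k p r * m k r t)) (at t)) \<and>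
      (\<forall>p\<in>{p. p permutes {1..k}}. m k p 0 = (if p = id then 1 else 0))"
    by metis
  have "moment_system lam \<alpha> m"
    unfolding moment_system_iff using m by (blast intro: has_field_derivative_at_within)
  then show ?thesis by blast
qed

text \<open>The limit statement applied to the constant sequence \<open>m'\<close> with zero
  forcing: it converges to \<open>m\<close>, and a constant sequence equals its limit.\<close>

lemma moment_system_unique:
  assumes m: "moment_system lam \<alpha> m" and m': "moment_system lam \<alpha> m'"
    and k: "k \<ge> 1" and p: "p permutes {1..k}" and t: "t \<ge> 0"
  shows "m' k p t = m k p t"
proof -
  have "(\<lambda>N::nat. m' k p t) \<longlonglongrightarrow> m k p t"
  proof (rule linear_system_limit[OF finite_permutation_group t, where y = "\<lambda>N. m' k" and z = "m k" and A = "system_matrix lam \<alpha> k" and h = "\<lambda>N i t. 0" and \<epsilon> = "\<lambda>N. 0" and start = 0])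
    show "p \<in> {p. p permutes {1..k}}" using p by simp
    show "(m' k i has_real_derivative (\<Sum>j | j permutes {1..k}. system_matrix lam \<alpha> k i j * m' k j t) + 0) (at t within {0..})"
      if "i \<in> {p. p permutes {1..k}}" "t \<ge> 0" for N :: nat and i t
      using m' k that unfolding moment_system_iff by simp
    show "(m k i has_real_derivative (\<Sum>j | j permutes {1..k}. system_matrix lam \<alpha> k i j * m k j t)) (at t within {0..})"
      if "i \<in> {p. p permutes {1..k}}" "t \<ge> 0" for i t
      using m k that unfolding moment_system_iff by simp
    show "(\<lambda>N. m' k i 0) \<longlonglongrightarrow> m k i 0" if "i \<in> {p. p permutes {1..k}}" for i
      using m m' k that unfolding moment_system_iff by simp
  qed simp_all
  then show ?thesis by (simp add: LIMSEQ_const_iff)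
qed

text \<open>If \<open>p\<close> moves \<open>l\<close>, the relation for the identity forces equal
  values at \<open>l\<close> and \<open>p l\<close>, against injectivity, so no tuple remains. For
  \<open>p = id\<close> every injective tuple counts, and their number is asymptotic to
  \<open>N ^ k\<close>.\<close>

lemma exclusive_moment_id_tendsto:
  assumes p: "p permutes {1..k}"
  shows "(\<lambda>N. exclusive_moment k p N id) \<longlonglongrightarrow> (if p = id then 1 else 0)"
proof (cases "p = id")
  case True
  have "pattern_tuples k id N id = inj_tuples k N" for N by (auto simp: pattern_tuples_def inj_tuples_def)
  then have "exclusive_moment k p N id = inverse (real N ^ k / real (card (inj_tuples k N)))" for N
    unfolding True by (simp add: exclusive_moment_eq num_cycles_id)
  moreover have "(\<lambda>N. inverse (real N ^ k / real (card (inj_tuples k N)))) \<longlonglongrightarrow> inverse 1"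
    by (intro tendsto_inverse inj_tuples_tendsto) simp
  ultimately show ?thesis using True by simp
next
  case False
  then obtain l where l: "p l \<noteq> l" by fastforce
  then have lk: "l \<in> {1..k}" using p by (meson permutes_not_in)
  then have "p l \<in> {1..k}" using permutes_in_image[OF p] by blast
  then have "pattern_tuples k p N id = {}" for N
    using l lk unfolding pattern_tuples_def by (auto dest: inj_onD simp del: atLeastAtMost_iff)
  then show ?thesis using False by (simp add: exclusive_moment_eq)
qed

text \<open>There are finitely many patterns for given \<open>k\<close>, so the sum of their error
  bounds serves for all of them, as the stability estimate requires a single bound.\<close>

lemma walk_generator_limit_uniform:
  assumes conj: "\<And>N. N \<ge> 2 \<Longrightarrow> is_conjugacy_class N (C N)"
    and nontrivial: "\<And>N. N \<ge> 2 \<Longrightarrow> C N \<noteq> {id}"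
    and conv: "classes_converge C lam \<alpha>" and k: "k \<ge> 1"
  shows "\<exists>\<epsilon> N0. \<epsilon> \<longlonglongrightarrow> 0 \<and> N0 \<ge> 2 \<and> (\<forall>N\<ge>N0. \<forall>p S. p permutes {1..k} \<longrightarrow> S permutes {1..N} \<longrightarrow>
      \<bar>walk_generator N (C N) (exclusive_moment k p N) S -
       (\<Sum>r | r permutes {1..k}. system_matrix lam \<alpha> k p r * exclusive_moment k r N S)\<bar> \<le> \<epsilon> N)"
proof -
  let ?I = "{p. p permutes {1..k}}"
  define D where "D p N S = \<bar>walk_generator N (C N) (exclusive_moment k p N) S -
       (\<Sum>r | r permutes {1..k}. system_matrix lam \<alpha> k p r * exclusive_moment k r N S)\<bar>" for p N S
  have fin: "finite ?I" by (rule finite_permutation_group)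
  have "\<exists>e n. e \<longlonglongrightarrow> 0 \<and> (\<forall>N\<ge>n. \<forall>S. S permutes {1..N} \<longrightarrow> D p N S \<le> e N)" if p: "p permutes {1..k}" for p
  proof -
    have "\<exists>\<epsilon> N0. \<epsilon> \<longlonglongrightarrow> 0 \<and> N0 \<ge> 2 \<and> (\<forall>N\<ge>N0. \<forall>S. S permutes {1..N} \<longrightarrow>
      \<bar>walk_generator N (C N) (exclusive_moment k p N) S -
       (\<Sum>q | q permutes {1..k}. limit_coeff lam \<alpha> k p q * exclusive_moment k (inv_into UNIV q \<circ> p) N S)\<bar> \<le> \<epsilon> N)"
      by (rule walk_generator_limit[OF conj nontrivial conv p k])
    then show ?thesis unfolding D_def system_matrix_sum[OF p] by blast
  qed
  then obtain e n where e: "\<And>p. p permutes {1..k} \<Longrightarrow> e p \<longlonglongrightarrow> 0"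
    "\<And>p N S. p permutes {1..k} \<Longrightarrow> N \<ge> n p \<Longrightarrow> S permutes {1..N} \<Longrightarrow> D p N S \<le> e p N"
    by metis
  have lim: "(\<lambda>N. \<Sum>p\<in>?I. \<bar>e p N\<bar>) \<longlonglongrightarrow> 0"
    using e(1) by (intro tendsto_null_sum tendsto_rabs_zero) simp
  have "D p N S \<le> (\<Sum>p\<in>?I. \<bar>e p N\<bar>)" if "N \<ge> 2 + (\<Sum>p\<in>?I. n p)" and p: "p permutes {1..k}" and S: "S permutes {1..N}" for N p S
  proof -
    have "n p \<le> (\<Sum>p\<in>?I. n p)" using fin p by (intro member_le_sum) auto
    then have "D p N S \<le> e p N" using that by (intro e(2) p S) linarith
    also have "\<dots> \<le> \<bar>e p N\<bar>" by simp
    also have "\<dots> \<le> (\<Sum>p\<in>?I. \<bar>e p N\<bar>)" using fin p by (intro member_le_sum) auto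
    finally show ?thesis .
  qed
  then show ?thesis
    using lim unfolding D_def
    by (intro exI[of _ "\<lambda>N. \<Sum>p\<in>?I. \<bar>e p N\<bar>"] exI[of _ "2 + (\<Sum>p\<in>?I. n p)"] conjI allI impI) simp_all
qed

text \<open>The derivative of an expected moment is the expectation of the generator, hence the
  linear system plus the forcing \<open>h\<close>. The latter is an average of errors that are
  bounded for every state, so it inherits the bound \<open>\<epsilon> N\<close> uniformly in
  time.\<close>

lemma expected_exclusive_moment_tendsto:
  fixes M :: "nat \<Rightarrow> 'a measure" and S :: "nat \<Rightarrow> real \<Rightarrow> 'a \<Rightarrow> nat \<Rightarrow> nat"
  assumes conj: "\<And>N. N \<ge> 2 \<Longrightarrow> is_conjugacy_class N (C N)"
    and nontrivial: "\<And>N. N \<ge> 2 \<Longrightarrow> C N \<noteq> {id}"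
    and conv: "classes_converge C lam \<alpha>"
    and walk: "\<And>N. N \<ge> 2 \<Longrightarrow> random_walk N (C N) (M N) (S N)"
    and m: "moment_system lam \<alpha> m" and k: "k \<ge> 1" and p: "p permutes {1..k}" and t: "t \<ge> 0"
  shows "(\<lambda>N. \<integral>\<omega>. exclusive_moment k p N (S N t \<omega>) \<partial>(M N)) \<longlonglongrightarrow> m k p t"
proof -
  let ?I = "{p. p permutes {1..k}}" and ?E = "\<lambda>N. {p. p permutes {1..N}}"
  have "\<exists>P. markov_semigroup (?E N) P \<and> has_generator (?E N) P (walk_generator N (C N)) \<and>
    (\<forall>t\<ge>0. \<forall>f :: (nat \<Rightarrow> nat) \<Rightarrow> real. integral\<^sup>L (M N) (\<lambda>\<omega>. f (S N t \<omega>)) = measure_pmf.expectation (P t id) f)"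
    if N: "N \<ge> 2" for N
    using walk[OF N] unfolding random_walk_def
    by (intro markov_process_expectation finite_permutation_group) (auto simp: permutes_id)
  then obtain P where P: "\<And>N. N \<ge> 2 \<Longrightarrow> markov_semigroup (?E N) (P N)"
      "\<And>N. N \<ge> 2 \<Longrightarrow> has_generator (?E N) (P N) (walk_generator N (C N))"
      "\<And>N t f. N \<ge> 2 \<Longrightarrow> t \<ge> 0 \<Longrightarrow> integral\<^sup>L (M N) (\<lambda>\<omega>. f (S N t \<omega>) :: real) = measure_pmf.expectation (P N t id) f"
    by metis
  have "\<exists>\<epsilon> N0. \<epsilon> \<longlonglongrightarrow> 0 \<and> N0 \<ge> 2 \<and> (\<forall>N\<ge>N0. \<forall>p S. p permutes {1..k} \<longrightarrow> S permutes {1..N} \<longrightarrow>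
      \<bar>walk_generator N (C N) (exclusive_moment k p N) S -
       (\<Sum>r | r permutes {1..k}. system_matrix lam \<alpha> k p r * exclusive_moment k r N S)\<bar> \<le> \<epsilon> N)"
    by (rule walk_generator_limit_uniform[OF conj nontrivial conv k])
  then obtain \<epsilon> N0 where \<epsilon>: "\<epsilon> \<longlonglongrightarrow> 0" and N0: "N0 \<ge> 2"
    and bound: "\<And>N p S. N \<ge> N0 \<Longrightarrow> p permutes {1..k} \<Longrightarrow> S permutes {1..N} \<Longrightarrow>
      \<bar>walk_generator N (C N) (exclusive_moment k p N) S -
       (\<Sum>r | r permutes {1..k}. system_matrix lam \<alpha> k p r * exclusive_moment k r N S)\<bar> \<le> \<epsilon> N"
    by blast
  define y where "y N p t = measure_pmf.expectation (P N t id) (exclusive_moment k p N)" for N p t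
  define h where "h N p t = measure_pmf.expectation (P N t id) (\<lambda>S. walk_generator N (C N) (exclusive_moment k p N) S -
       (\<Sum>r\<in>?I. system_matrix lam \<alpha> k p r * exclusive_moment k r N S))" for N p t
  have idE: "id \<in> ?E N" for N by (simp add: permutes_id)
  have lim: "(\<lambda>N. y N p t) \<longlonglongrightarrow> m k p t"
  proof (rule linear_system_limit[OF finite_permutation_group t, where y = y and z = "m k" and A = "system_matrix lam \<alpha> k" and h = h and \<epsilon> = \<epsilon> and start = N0])
    show "p \<in> ?I" using p by simp
    show "\<epsilon> \<longlonglongrightarrow> 0" by (rule \<epsilon>)
    show "(y N i has_real_derivative (\<Sum>j\<in>?I. system_matrix lam \<alpha> k i j * y N j t) + h N i t) (at t within {0..})"
      if N: "N \<ge> N0" and t: "t \<ge> 0" for N i t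
    proof -
      have N2: "N \<ge> 2" using N N0 by simp
      note sg = finite_permutation_group P(1)[OF N2] P(2)[OF N2]
      note int = integrable_semigroup[OF sg t idE]
      have "h N i t = measure_pmf.expectation (P N t id) (walk_generator N (C N) (exclusive_moment k i N)) -
          (\<Sum>j\<in>?I. system_matrix lam \<alpha> k i j * y N j t)"
        unfolding h_def y_def by (subst Bochner_Integration.integral_diff) (simp_all add: int)
      then show ?thesis
        using expectation_has_derivative[OF sg idE t, of "exclusive_moment k i N"] unfolding y_def by simp
    qed
    show "\<bar>h N i t\<bar> \<le> \<epsilon> N" if N: "N \<ge> N0" and i: "i \<in> ?I" and t: "t \<ge> 0" for N i t
    proof -
      have N2: "N \<ge> 2" using N N0 by simp
      show ?thesis
        unfolding h_def using bound[OF N] i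
        by (intro abs_expectation_le[OF finite_permutation_group P(1)[OF N2] P(2)[OF N2] t idE]) simp
    qed
    show "(m k i has_real_derivative (\<Sum>j\<in>?I. system_matrix lam \<alpha> k i j * m k j t)) (at t within {0..})"
      if "i \<in> ?I" "t \<ge> 0" for i t
      using m k that unfolding moment_system_iff by simp
    show "(\<lambda>N. y N i 0) \<longlonglongrightarrow> m k i 0" if i: "i \<in> ?I" for i
    proof -
      have "m k i 0 = (if i = id then 1 else 0)" using m k i unfolding moment_system_iff by simp
      moreover have "eventually (\<lambda>N. exclusive_moment k i N id = y N i 0) sequentially"
        using eventually_ge_at_top[of 2]
      proof eventually_elim
        case (elim N)
        have "P N 0 id = return_pmf id"
          by (rule semigroup_0[OF finite_permutation_group P(1)[OF elim] P(2)[OF elim] idE])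
        then show ?case by (simp add: y_def)
      qed
      ultimately show ?thesis
        using Lim_transform_eventually[OF exclusive_moment_id_tendsto[of i k]] i by simp
    qed
  qed
  have "eventually (\<lambda>N. y N p t = (\<integral>\<omega>. exclusive_moment k p N (S N t \<omega>) \<partial>(M N))) sequentially"
    using eventually_ge_at_top[of 2] by eventually_elim (simp add: y_def P(3)[OF _ t])
  with lim show ?thesis by (rule Lim_transform_eventually)
qed

theorem theorem2p5:
  fixes C :: "nat \<Rightarrow> (nat \<Rightarrow> nat) set"
    and lam :: "nat \<Rightarrow> real" and \<alpha> :: real
    and M :: "nat \<Rightarrow> 'a measure"
    and S :: "nat \<Rightarrow> real \<Rightarrow> 'a \<Rightarrow> nat \<Rightarrow> nat"
  assumes "\<And>N. N \<ge> 2 \<Longrightarrow> is_conjugacy_class N (C N)"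
    and "\<And>N. N \<ge> 2 \<Longrightarrow> C N \<noteq> {id}"
    and "classes_converge C lam \<alpha>"
    and "\<And>N. N \<ge> 2 \<Longrightarrow> random_walk N (C N) (M N) (S N)"
  shows "\<exists>(mc :: nat \<Rightarrow> real \<Rightarrow> real) (minf :: real \<Rightarrow> real) (m :: nat \<Rightarrow> (nat \<Rightarrow> nat) \<Rightarrow> real \<Rightarrow> real).
    (\<forall>t\<ge>0.
       (\<forall>n\<ge>1. 0 \<le> mc n t) \<and>
       summable (\<lambda>n. mc (Suc n) t) \<and>
       minf t = 1 - (\<Sum>n. mc (Suc n) t) \<and> 0 \<le> minf t \<and>
       prob_space (circle_mixture (\<lambda>n. mc n t) (minf t)) \<and>
       measure (circle_mixture (\<lambda>n. mc n t) (minf t)) (sphere 0 1) = 1 \<and>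
       weakly_converges
         (\<lambda>N. mean_eigenvalue_distribution (M N) (\<lambda>\<omega>. perm_matrix N (S N t \<omega>)))
         (circle_mixture (\<lambda>n. mc n t) (minf t))) \<and>
    moment_system lam \<alpha> m \<and>
    (\<forall>m'. moment_system lam \<alpha> m' \<longrightarrow>
       (\<forall>k\<ge>1. \<forall>p. p permutes {1..k} \<longrightarrow> (\<forall>t\<ge>0. m' k p t = m k p t))) \<and>
    (\<forall>n\<ge>1. \<forall>t\<ge>0. mc n t = m n (cycle_of_list [1..<Suc n]) t) \<and>
    (\<forall>k\<ge>1. \<forall>p. p permutes {1..k} \<longrightarrow> (\<forall>t\<ge>0.
       (\<lambda>N. \<integral>\<omega>. exclusive_moment k p N (S N t \<omega>) \<partial>(M N)) \<longlonglongrightarrow> m k p t))"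
proof -
  obtain m where m: "moment_system lam \<alpha> m" using moment_system_exists by blast
  have lim: "(\<lambda>N. \<integral>\<omega>. exclusive_moment k p N (S N t \<omega>) \<partial>(M N)) \<longlonglongrightarrow> m k p t"
    if "k \<ge> 1" "p permutes {1..k}" "t \<ge> 0" for k p t
    by (rule expected_exclusive_moment_tendsto[OF assms m that])
  \<comment> \<open>The weights are defined through the limiting system. That they are nonnegative
    and have total mass at most 1 is deduced afterwards, from their being limits of expected
    proportions of points of period \<open>n\<close>.\<close>
  define mc where "mc n t = m n (cycle_of_list [1..<Suc n]) t" for n t
  define minf where "minf t = 1 - (\<Sum>n. mc (Suc n) t)" for t
  have main: "(\<forall>n\<ge>1. 0 \<le> mc n t) \<and> summable (\<lambda>n. mc (Suc n) t) \<and>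
       minf t = 1 - (\<Sum>n. mc (Suc n) t) \<and> 0 \<le> minf t \<and>
       prob_space (circle_mixture (\<lambda>n. mc n t) (minf t)) \<and>
       measure (circle_mixture (\<lambda>n. mc n t) (minf t)) (sphere 0 1) = 1 \<and>
       weakly_converges
         (\<lambda>N. mean_eigenvalue_distribution (M N) (\<lambda>\<omega>. perm_matrix N (S N t \<omega>)))
         (circle_mixture (\<lambda>n. mc n t) (minf t))" if t: "t \<ge> 0" for t
  proof -
    define a where "a N n = (\<integral>\<omega>. real (period_count N (S N t \<omega>) n) / real N \<partial>(M N))" for N n
    have prob: "prob_space (M N)" and X: "S N t \<in> measurable (M N) (count_space {p. p permutes {1..N}})" if "N \<ge> 2" for N
      using assms(4)[OF that] t unfolding random_walk_def markov_process_def by blast+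
    have SE: "S N t \<omega> permutes {1..N}" if "N \<ge> 2" "\<omega> \<in> space (M N)" for N \<omega>
      using measurable_space[OF X that(2)] that(1) by simp
    have a0: "0 \<le> a N n" for N n unfolding a_def by (rule integral_nonneg_AE) simp
    have a1: "(\<Sum>n=1..N. a N n) = 1" if N: "N \<ge> 2" for N
    proof -
      interpret prob_space "M N" by (rule prob[OF N])
      have "integral\<^sup>L (mean_eigenvalue_distribution (M N) (\<lambda>\<omega>. perm_matrix N (S N t \<omega>))) (\<lambda>_. 1) =
          (\<Sum>n=1..N. a N n * root_average (\<lambda>_. 1) n)"
        unfolding a_def using N by (intro integral_mean_eigenvalue_distribution prob X) auto
      have int: "integrable (M N) (\<lambda>\<omega>. real (period_count N (S N t \<omega>) n) / real N)" for n
        using N period_count_le measurable_compose[OF X[OF N], of "\<lambda>p. real (period_count N p n) / real N" borel]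
        by (intro integrable_const_bound[where B = 1]) auto
      have "(\<Sum>n=1..N. a N n) = (\<integral>\<omega>. (\<Sum>n=1..N. real (period_count N (S N t \<omega>) n) / real N) \<partial>(M N))"
        unfolding a_def by (rule Bochner_Integration.integral_sum[symmetric]) (rule int)
      also have "\<dots> = (\<integral>\<omega>. 1 \<partial>(M N))"
        using N by (intro Bochner_Integration.integral_cong refl sum_period_count SE) auto
      finally show ?thesis by (simp add: prob_space)
    qed
    have a_lim: "(\<lambda>N. a N n) \<longlonglongrightarrow> mc n t" if n: "n \<ge> 1" for n
    proof -
      have "eventually (\<lambda>N. (\<integral>\<omega>. exclusive_moment n (cycle_of_list [1..<Suc n]) N (S N t \<omega>) \<partial>(M N)) = a N n) sequentially"
        using eventually_ge_at_top[of 2]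
      proof eventually_elim
        case (elim N)
        show ?case unfolding a_def
          by (intro Bochner_Integration.integral_cong refl exclusive_moment_cycle[OF n] SE[OF elim])
      qed
      then show ?thesis unfolding mc_def
        by (rule Lim_transform_eventually[OF lim[OF n cycle_upt(1)[OF n] t]])
    qed
    note sub = subprobability_limit[of a "\<lambda>n. mc n t", OF a0 a1 a_lim]
    have mc0: "0 \<le> mc n t" if "n \<ge> 1" for n using sub(1) that by simp
    have sm: "summable (\<lambda>n. mc (Suc n) t)" using sub(2) by simp
    have minf0: "0 \<le> minf t" using sub(3) unfolding minf_def by simp
    have mix: "prob_space (circle_mixture (\<lambda>n. mc n t) (minf t))"
        "measure (circle_mixture (\<lambda>n. mc n t) (minf t)) (sphere 0 1) = 1"
      by (rule circle_mixture_facts(1,2)[OF mc0 sm minf_def minf0]; assumption)+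
    have mix_integral: "integral\<^sup>L (circle_mixture (\<lambda>n. mc n t) (minf t)) f =
        minf t * integral\<^sup>L uniform_circle f + (\<Sum>n. mc (Suc n) t * root_average f (Suc n))"
      if "continuous_on UNIV f" "bounded (range f)" for f
      by (rule circle_mixture_facts(3)[OF mc0 sm minf_def minf0 that])
    have "weakly_converges
         (\<lambda>N. mean_eigenvalue_distribution (M N) (\<lambda>\<omega>. perm_matrix N (S N t \<omega>)))
         (circle_mixture (\<lambda>n. mc n t) (minf t))"
      unfolding weakly_converges_def
    proof (intro allI impI, elim conjE)
      fix f :: "complex \<Rightarrow> real" assume f: "continuous_on UNIV f" "bounded (range f)"
      have "(\<lambda>N. \<Sum>n=1..N. a N n * root_average f n) \<longlonglongrightarrow>
          (1 - (\<Sum>n. mc (Suc n) t)) * integral\<^sup>L uniform_circle f + (\<Sum>n. mc (Suc n) t * root_average f (Suc n))"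
        by (rule weighted_average_tendsto[OF a0 a1 a_lim root_average_tendsto[OF f(1)]])
      then have lim_f: "(\<lambda>N. \<Sum>n=1..N. a N n * root_average f n) \<longlonglongrightarrow> integral\<^sup>L (circle_mixture (\<lambda>n. mc n t) (minf t)) f"
        unfolding mix_integral[OF f] unfolding minf_def .
      have "eventually (\<lambda>N. (\<Sum>n=1..N. a N n * root_average f n) =
          integral\<^sup>L (mean_eigenvalue_distribution (M N) (\<lambda>\<omega>. perm_matrix N (S N t \<omega>))) f) sequentially"
        using eventually_ge_at_top[of 2]
      proof eventually_elim
        case (elim N)
        show ?case unfolding a_def
          by (rule integral_mean_eigenvalue_distribution[OF prob[OF elim] X[OF elim] _ f, symmetric]) (use elim in simp)
      qed
      with lim_f show "(\<lambda>N. integral\<^sup>L (mean_eigenvalue_distribution (M N) (\<lambda>\<omega>. perm_matrix N (S N t \<omega>))) f)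
          \<longlonglongrightarrow> integral\<^sup>L (circle_mixture (\<lambda>n. mc n t) (minf t)) f"
        by (rule Lim_transform_eventually)
    qed
    then show ?thesis using mc0 sm minf0 mix minf_def by blast
  qed
  have unique: "\<forall>m'. moment_system lam \<alpha> m' \<longrightarrow>
       (\<forall>k\<ge>1. \<forall>p. p permutes {1..k} \<longrightarrow> (\<forall>t\<ge>0. m' k p t = m k p t))"
    using moment_system_unique[OF m] by blast
  show ?thesis
    using main m unique lim mc_def by (intro exI[of _ mc] exI[of _ minf] exI[of _ m] conjI allI impI) blast+
qed

end
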